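(* Suppose that $X_1(t)$ is a Pearson diffusion in steady state (of Hermite, Laguerre or Jacobi type, as described in the context), so that its correlation function is given by $\mathrm{corr}[X_1(t),X_1(s)]=\exp(-\theta|t-s|)$, where the correlation parameter $\theta=\lambda_1$ is the smallest positive eigenvalue of the generator $\mathcal{G}$ (in the sign convention $\mathcal{G}Q_n=-\lambda_nQ_n$). Let $0<\beta_1<\beta_2<\cdots<\beta_n<1$ and let $D(t)$ be a subordinator with Laplace exponent $\psi(s)=c_1s^{\beta_1}+c_2s^{\beta_2}+\cdots+c_ns^{\beta_n}$; that is, $\mathbb{E}[e^{-sD(t)}]=e^{-t\psi(s)}$. Let $E(t)=\inf\{\tau\ge 0: D(\tau)>t\}$ be the inverse subordinator, independent of $X_1$. Then the correlation function of the corresponding time-changed Pearson diffusion $X(t)=X_1(E(t))$ is given by $$\mathrm{corr}[X(t),X(s)]=\theta\int_{y=0}^{s}h_n(y)\,\Phi_{\theta,n}(t-y)\,dy+\Phi_{\theta,n}(t),$$ where the Laplace transform of $h_n$ is given by $$\tilde h_n(s)=\frac{1}{\psi(s)}=\frac{1}{c_1s^{\beta_1}+c_2s^{\beta_2}+\cdots+c_ns^{\beta_n}},$$ and the Laplace transform of $\Phi_{\theta,n}$ is given by $$\tilde\Phi_{\theta,n}(s)=\frac{\psi(s)}{s(\theta+\psi(s))}=\frac{c_1s^{\beta_1}+c_2s^{\beta_2}+\cdots+c_ns^{\beta_n}}{s(\theta+c_1s^{\beta_1}+c_2s^{\beta_2}+\cdots+c_ns^{\beta_n})}.$$ In this case $\Phi_{\theta,n}(t)=\mathbb{E}(e^{-\theta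 E(t)})$ is the Laplace transform of the inverse subordinator $E(t)$.
   Context: Pearson diffusion: the solution $X_1(t)$ of the stochastic differential equation $dX_1(t)=\mu(X_1(t))\,dt+\sigma(X_1(t))\,dW(t)$, with $W$ a standard Brownian motion, $\mu(x)=a_0+a_1x$ and $D(x)=\sigma^2(x)/2=d_0+d_1x+d_2x^2$ (this polynomial $D(x)$ is not to be confused with the subordinator $D(t)$). Its generator is $\mathcal{G}=\mu(y)\frac{\partial}{\partial y}+\frac{\sigma^2(y)}{2}\frac{\partial^2}{\partial y^2}$, and $m$ denotes the density of its steady-state distribution. It is assumed that one of three cases holds: (1) Hermite: $d_1=d_2=0$ and $d_0>0$, $m$ is a normal density, and the $Q_n$ are Hermite polynomials; (2) Laguerre: $d_2=0$, $m$ is a gamma density, and the $Q_n$ are Laguerre polynomials; (3) Jacobi: $D''(y)<0$ with two positive real roots, $m$ is a beta density, and the $Q_n$ are Jacobi polynomials. Here the $Q_n$ are eigenfunctions of the generator, $\mathcal{G}Q_n=-\lambda_nQ_n$ with $0=\lambda_0<\lambda_1<\lambda_2<\cdots$, forming an orthonormal basis of $L^2(m(y)\,dy)$; in these cases all moments exist. The process $X_1(t)$ is in steady state if its probability density is $m$ for all time; the time-changed process $X_1(E(t))$ is in steady state if it starts with the distribution $m$, and then its mean and variance do not vary over time. $\mathrm{corr}$ denotes the correlation coefficient of two random variables. The subordinator $D(t)$ can be written as $(c_1)^{1/\beta_1}D^1(t)+\cdots+(c_n)^{1/\beta_n}D^n(t)$, where $D^1,\dots,D^n$ are independent stable subordinators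 of indices $\beta_1,\dots,\beta_n$. The Laplace transform of a function $f$ on $(0,\infty)$ is $\tilde f(s)=\int_0^\infty e^{-st}f(t)\,dt$. *)

theory Defs
  imports "HOL-Probability.Probability" "HOL-Computational_Algebra.Polynomial"
begin

section \<open>Brownian motion, the Ito integral and stochastic differential equations\<close>

text \<open>Processes are functions of a real time, of which only the times \<open>t \<ge> 0\<close> matter.\<close>

definition filtration_on :: "'a measure \<Rightarrow> (real \<Rightarrow> 'a measure) \<Rightarrow> bool" where
  "filtration_on M F \<longleftrightarrow> filtration (space M) F \<and> (\<forall>t. sets (F t) \<subseteq> sets M)"

definition brownian_motion ::
  "'a measure \<Rightarrow> (real \<Rightarrow> 'a measure) \<Rightarrow> (real \<Rightarrow> 'a \<Rightarrow> real) \<Rightarrow> bool" where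
  "brownian_motion M F W \<longleftrightarrow>
     (\<forall>t\<ge>0. W t \<in> borel_measurable (F t)) \<and>
     (AE \<omega> in M. W 0 \<omega> = 0) \<and>
     (AE \<omega> in M. continuous_on {0..} (\<lambda>t. W t \<omega>)) \<and>
     (\<forall>s t. 0 \<le> s \<and> s < t \<longrightarrow>
        distributed M lborel (\<lambda>\<omega>. W t \<omega> - W s \<omega>) (\<lambda>x. ennreal (normal_density 0 (sqrt (t - s)) x)) \<and>
        prob_space.indep_set M (sets (F s))
          (sets (vimage_algebra (space M) (\<lambda>\<omega>. W t \<omega> - W s \<omega>) borel)))"

text \<open>
  Elementary processes on \<open>[0, T]\<close>: the value on \<open>[\<tau> i, \<tau> (i + 1))\<close> is the bounded,
  \<open>F (\<tau> i)\<close>-measurable random variable \<open>\<xi> i\<close>, for \<open>i < k\<close>.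
\<close>

definition elementary_process ::
  "'a measure \<Rightarrow> (real \<Rightarrow> 'a measure) \<Rightarrow> real \<Rightarrow> nat \<Rightarrow> (nat \<Rightarrow> real) \<Rightarrow> (nat \<Rightarrow> 'a \<Rightarrow> real) \<Rightarrow> bool"
where
  "elementary_process M F T k \<tau> \<xi> \<longleftrightarrow>
     \<tau> 0 = 0 \<and> \<tau> k = T \<and> mono_on {..k} \<tau> \<and>
     (\<forall>i<k. \<xi> i \<in> borel_measurable (F (\<tau> i)) \<and> (\<exists>C. \<forall>\<omega>\<in>space M. \<bar>\<xi> i \<omega>\<bar> \<le> C))"

definition elementary_value ::
  "nat \<Rightarrow> (nat \<Rightarrow> real) \<Rightarrow> (nat \<Rightarrow> 'a \<Rightarrow> real) \<Rightarrow> real \<Rightarrow> 'a \<Rightarrow> real" where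
  "elementary_value k \<tau> \<xi> u \<omega> = (\<Sum>i<k. \<xi> i \<omega> * indicator {\<tau> i..<\<tau> (Suc i)} u)"

definition elementary_integral ::
  "(real \<Rightarrow> 'a \<Rightarrow> real) \<Rightarrow> nat \<Rightarrow> (nat \<Rightarrow> real) \<Rightarrow> (nat \<Rightarrow> 'a \<Rightarrow> real) \<Rightarrow> 'a \<Rightarrow> real" where
  "elementary_integral W k \<tau> \<xi> \<omega> = (\<Sum>i<k. \<xi> i \<omega> * (W (\<tau> (Suc i)) \<omega> - W (\<tau> i) \<omega>))"

text \<open>
  \<open>Y\<close> is (a version of) the integral of \<open>H\<close> with respect to \<open>W\<close> over \<open>[0, T]\<close>: the limit in
  \<open>L\<^sup>2(M)\<close> of the integrals of elementary processes converging to \<open>H\<close> in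
  \<open>L\<^sup>2([0, T] \<times> M)\<close>.  The existence of such a sequence contains the square integrability of \<open>H\<close>,
  which is automatic for \<open>H u = \<sigma> (X u)\<close> if \<open>X\<close> is stationary with finite second moment and
  \<open>\<sigma>\<^sup>2\<close> is a quadratic polynomial on the state space.
\<close>

definition is_ito_integral ::
  "'a measure \<Rightarrow> (real \<Rightarrow> 'a measure) \<Rightarrow> (real \<Rightarrow> 'a \<Rightarrow> real) \<Rightarrow> (real \<Rightarrow> 'a \<Rightarrow> real) \<Rightarrow> real \<Rightarrow>
   ('a \<Rightarrow> real) \<Rightarrow> bool" where
  "is_ito_integral M F W H T Y \<longleftrightarrow>
     (\<lambda>(u, \<omega>). H u \<omega>) \<in> borel_measurable (restrict_space lborel {0..T} \<Otimes>\<^sub>M M) \<and>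
     (\<forall>u\<in>{0..T}. H u \<in> borel_measurable (F u)) \<and>
     Y \<in> borel_measurable M \<and>
     (\<exists>k \<tau> \<xi>.
        (\<forall>n::nat. elementary_process M F T (k n) (\<tau> n) (\<xi> n)) \<and>
        (\<lambda>n. \<integral>\<^sup>+(u, \<omega>). ennreal ((H u \<omega> - elementary_value (k n) (\<tau> n) (\<xi> n) u \<omega>)\<^sup>2)
               \<partial>(restrict_space lborel {0..T} \<Otimes>\<^sub>M M)) \<longlonglongrightarrow> 0 \<and>
        (\<lambda>n. \<integral>\<^sup>+\<omega>. ennreal ((Y \<omega> - elementary_integral W (k n) (\<tau> n) (\<xi> n) \<omega>)\<^sup>2) \<partial>M) \<longlonglongrightarrow> 0)"

text \<open>
  \<open>dX = \<mu>(X) dt + \<sigma>(X) dW\<close>.  Continuity is required of every path (not only of almost every one) so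
  that \<open>X\<close> evaluated at a random time is measurable although \<open>M\<close> need not be complete.
\<close>

definition sde_solution ::
  "'a measure \<Rightarrow> (real \<Rightarrow> 'a measure) \<Rightarrow> (real \<Rightarrow> 'a \<Rightarrow> real) \<Rightarrow> (real \<Rightarrow> real) \<Rightarrow> (real \<Rightarrow> real) \<Rightarrow>
   (real \<Rightarrow> 'a \<Rightarrow> real) \<Rightarrow> bool" where
  "sde_solution M F W \<mu> \<sigma> X \<longleftrightarrow>
     (\<forall>t\<ge>0. X t \<in> borel_measurable (F t)) \<and>
     (\<forall>\<omega>\<in>space M. continuous_on {0..} (\<lambda>t. X t \<omega>)) \<and>
     (\<exists>I. \<forall>t\<ge>0. is_ito_integral M F W (\<lambda>u \<omega>. \<sigma> (X u \<omega>)) t (I t) \<and>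
        (AE \<omega> in M. X t \<omega> = X 0 \<omega> + (LINT u:{0..t}|lborel. \<mu> (X u \<omega>)) + I t \<omega>))"

section \<open>Pearson diffusions\<close>

definition pearson_drift :: "real \<Rightarrow> real \<Rightarrow> real \<Rightarrow> real" where
  "pearson_drift a0 a1 x = a0 + a1 * x"

definition pearson_D :: "real \<Rightarrow> real \<Rightarrow> real \<Rightarrow> real \<Rightarrow> real" where
  "pearson_D d0 d1 d2 x = d0 + d1 * x + d2 * x\<^sup>2"

text \<open>
  The relation \<open>D(x) = \<sigma>\<^sup>2(x) / 2\<close> can only hold where \<open>D \<ge> 0\<close>, which is the closure of the state
  space; outside, \<open>\<sigma>\<close> is arbitrary.
\<close>

definition pearson_diffusion ::
  "'a measure \<Rightarrow> (real \<Rightarrow> 'a measure) \<Rightarrow> (real \<Rightarrow> 'a \<Rightarrow> real) \<Rightarrow> real \<Rightarrow> real \<Rightarrow> real \<Rightarrow> real \<Rightarrow> real \<Rightarrow>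
   (real \<Rightarrow> real) \<Rightarrow> (real \<Rightarrow> 'a \<Rightarrow> real) \<Rightarrow> bool" where
  "pearson_diffusion M F W a0 a1 d0 d1 d2 \<sigma> X \<longleftrightarrow>
     filtration_on M F \<and> brownian_motion M F W \<and>
     \<sigma> \<in> borel_measurable borel \<and>
     (\<forall>x. pearson_D d0 d1 d2 x \<ge> 0 \<longrightarrow> pearson_D d0 d1 d2 x = (\<sigma> x)\<^sup>2 / 2) \<and>
     sde_solution M F W (pearson_drift a0 a1) \<sigma> X"

definition steady_state :: "'a measure \<Rightarrow> (real \<Rightarrow> 'a \<Rightarrow> real) \<Rightarrow> (real \<Rightarrow> real) \<Rightarrow> bool" where
  "steady_state M X m \<longleftrightarrow> (\<forall>t\<ge>0. distributed M lborel (X t) (\<lambda>y. ennreal (m y)))"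

definition gamma_density :: "real \<Rightarrow> real \<Rightarrow> real \<Rightarrow> real" where
  "gamma_density a b x =
     (if 0 < x then b powr a / Gamma a * x powr (a - 1) * exp (- b * x) else 0)"

definition beta_density :: "real \<Rightarrow> real \<Rightarrow> real \<Rightarrow> real" where
  "beta_density p q x =
     (if 0 < x \<and> x < 1 then x powr (p - 1) * (1 - x) powr (q - 1) / Beta p q else 0)"

text \<open>
  The parameters of the densities are left existential, since they are determined by the
  coefficients as soon as \<open>m\<close> is a stationary density of the diffusion.  The gamma and beta densities
  are placed on the state space \<open>{y. D(y) > 0}\<close>: a half-line bounded by the root \<open>- d0 / d1\<close> of \<open>D\<close>
  (the positive half-line if \<open>d0 = 0\<close> and \<open>d1 > 0\<close>), and the interval between the roots of \<open>D\<close>.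
\<close>

definition hermite_case :: "real \<Rightarrow> real \<Rightarrow> real \<Rightarrow> (real \<Rightarrow> real) \<Rightarrow> bool" where
  "hermite_case d0 d1 d2 m \<longleftrightarrow> d1 = 0 \<and> d2 = 0 \<and> d0 > 0 \<and>
     (\<exists>\<nu> \<rho>. \<rho> > 0 \<and> (\<forall>y. m y = normal_density \<nu> \<rho> y))"

definition laguerre_case :: "real \<Rightarrow> real \<Rightarrow> real \<Rightarrow> (real \<Rightarrow> real) \<Rightarrow> bool" where
  "laguerre_case d0 d1 d2 m \<longleftrightarrow> d2 = 0 \<and> d1 \<noteq> 0 \<and>
     (\<exists>a b. a > 0 \<and> b > 0 \<and> (\<forall>y. m y = gamma_density a b (sgn d1 * (y + d0 / d1))))"

definition jacobi_case :: "real \<Rightarrow> real \<Rightarrow> real \<Rightarrow> (real \<Rightarrow> real) \<Rightarrow> bool" where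
  "jacobi_case d0 d1 d2 m \<longleftrightarrow> d2 < 0 \<and>
     (\<exists>r1 r2. 0 < r1 \<and> r1 < r2 \<and> pearson_D d0 d1 d2 r1 = 0 \<and> pearson_D d0 d1 d2 r2 = 0 \<and>
        (\<exists>p q. p > 0 \<and> q > 0 \<and>
           (\<forall>y. m y = beta_density p q ((y - r1) / (r2 - r1)) / (r2 - r1))))"

definition generator :: "(real \<Rightarrow> real) \<Rightarrow> (real \<Rightarrow> real) \<Rightarrow> (real \<Rightarrow> real) \<Rightarrow> real \<Rightarrow> real" where
  "generator \<mu> \<sigma> f y = \<mu> y * deriv f y + (\<sigma> y)\<^sup>2 / 2 * deriv (deriv f) y"

definition orthonormal_L2_basis :: "'b measure \<Rightarrow> (nat \<Rightarrow> 'b \<Rightarrow> real) \<Rightarrow> bool" where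
  "orthonormal_L2_basis N e \<longleftrightarrow>
     (\<forall>n. e n \<in> borel_measurable N \<and> integrable N (\<lambda>x. (e n x)\<^sup>2)) \<and>
     (\<forall>i j. (LINT x|N. e i x * e j x) = (if i = j then 1 else 0)) \<and>
     (\<forall>f\<in>borel_measurable N. integrable N (\<lambda>x. (f x)\<^sup>2) \<longrightarrow>
        (\<lambda>n. LINT x|N. (f x - (\<Sum>k<n. (LINT z|N. f z * e k z) * e k x))\<^sup>2) \<longlonglongrightarrow> 0)"

text \<open>
  The orthonormal polynomials \<open>Q n\<close> of degree \<open>n\<close> with respect to a normal, gamma or beta density
  are, up to sign, the normalised Hermite, Laguerre and Jacobi polynomials.  Restricting to polynomial
  eigenfunctions matters: without boundary conditions the differential operator can have further
  square integrable eigenfunctions (e.g. in the gamma case with shape below 2).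
\<close>

definition pearson_eigensystem ::
  "(real \<Rightarrow> real) \<Rightarrow> (real \<Rightarrow> real) \<Rightarrow> (real \<Rightarrow> real) \<Rightarrow> (real \<Rightarrow> real) \<Rightarrow> (nat \<Rightarrow> real poly) \<Rightarrow>
   (nat \<Rightarrow> real) \<Rightarrow> bool" where
  "pearson_eigensystem \<mu> D \<sigma> m Q lam \<longleftrightarrow>
     (\<forall>n. degree (Q n) = n) \<and>
     (\<forall>n y. 0 < D y \<longrightarrow> generator \<mu> \<sigma> (poly (Q n)) y = - lam n * poly (Q n) y) \<and>
     lam 0 = 0 \<and> strict_mono lam \<and>
     orthonormal_L2_basis (density lborel (\<lambda>y. ennreal (m y))) (\<lambda>n. poly (Q n))"

section \<open>Subordinators, correlation, Laplace transform\<close>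

definition subordinator :: "'a measure \<Rightarrow> (real \<Rightarrow> 'a \<Rightarrow> real) \<Rightarrow> bool" where
  "subordinator M D \<longleftrightarrow>
     (\<forall>t\<ge>0. D t \<in> borel_measurable M) \<and>
     (AE \<omega> in M. D 0 \<omega> = 0 \<and> mono_on {0..} (\<lambda>t. D t \<omega>) \<and>
        (\<forall>t\<ge>0. ((\<lambda>u. D u \<omega>) \<longlongrightarrow> D t \<omega>) (at_right t))) \<and>
     (\<forall>(k::nat) \<tau>. 0 \<le> \<tau> 0 \<and> mono \<tau> \<longrightarrow>
        prob_space.indep_vars M (\<lambda>_. borel) (\<lambda>i \<omega>. D (\<tau> (Suc i)) \<omega> - D (\<tau> i) \<omega>) {..<k}) \<and>
     (\<forall>s\<ge>0. \<forall>t\<ge>0. distr M borel (\<lambda>\<omega>. D (s + t) \<omega> - D s \<omega>) = distr M borel (D t))"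

definition has_laplace_exponent ::
  "'a measure \<Rightarrow> (real \<Rightarrow> 'a \<Rightarrow> real) \<Rightarrow> (real \<Rightarrow> real) \<Rightarrow> bool" where
  "has_laplace_exponent M D \<psi> \<longleftrightarrow>
     (\<forall>t\<ge>0. \<forall>s>0. (LINT \<omega>|M. exp (- s * D t \<omega>)) = exp (- t * \<psi> s))"

text \<open>
  The infimum over the empty set is \<open>\<infinity>\<close> in the literature and unspecified for real numbers; this
  happens only on a null set for the subordinators considered, where the value 0 is used.
\<close>

definition inverse_subordinator :: "(real \<Rightarrow> 'a \<Rightarrow> real) \<Rightarrow> real \<Rightarrow> 'a \<Rightarrow> real" where
  "inverse_subordinator D t \<omega> =
     (if \<exists>\<tau>\<ge>0. D \<tau> \<omega> > t then Inf {\<tau>. \<tau> \<ge> 0 \<and> D \<tau> \<omega> > t} else 0)"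

definition indep_processes ::
  "'a measure \<Rightarrow> (real \<Rightarrow> 'a \<Rightarrow> real) \<Rightarrow> (real \<Rightarrow> 'a \<Rightarrow> real) \<Rightarrow> bool" where
  "indep_processes M X Y \<longleftrightarrow>
     prob_space.indep_var M
       (PiM {0..} (\<lambda>_. borel)) (\<lambda>\<omega>. \<lambda>t\<in>{0..}. X t \<omega>)
       (PiM {0..} (\<lambda>_. borel)) (\<lambda>\<omega>. \<lambda>t\<in>{0..}. Y t \<omega>)"

definition time_change ::
  "(real \<Rightarrow> 'a \<Rightarrow> real) \<Rightarrow> (real \<Rightarrow> 'a \<Rightarrow> real) \<Rightarrow> real \<Rightarrow> 'a \<Rightarrow> real" where
  "time_change X E t \<omega> = X (E t \<omega>) \<omega>"

definition corr :: "'a measure \<Rightarrow> ('a \<Rightarrow> real) \<Rightarrow> ('a \<Rightarrow> real) \<Rightarrow> real" where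
  "corr M X Y =
     (LINT \<omega>|M. (X \<omega> - (LINT \<eta>|M. X \<eta>)) * (Y \<omega> - (LINT \<eta>|M. Y \<eta>))) /
     (sqrt (prob_space.variance M X) * sqrt (prob_space.variance M Y))"

definition has_laplace_transform :: "(real \<Rightarrow> real) \<Rightarrow> real \<Rightarrow> real \<Rightarrow> bool" where
  "has_laplace_transform f s L \<longleftrightarrow>
     set_integrable lborel {0<..} (\<lambda>t. exp (- s * t) * f t) \<and>
     (LINT t:{0<..}|lborel. exp (- s * t) * f t) = L"

definition laplace_exponent_sum :: "nat \<Rightarrow> (nat \<Rightarrow> real) \<Rightarrow> (nat \<Rightarrow> real) \<Rightarrow> real \<Rightarrow> real" where
  "laplace_exponent_sum n c \<beta> s = (\<Sum>i=1..n. c i * s powr \<beta> i)"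

end

theory Submission
  imports Defs
begin

text \<open>
  The eigenfunction \<open>Q\<^sub>1\<close> is affine, so \<open>G Q\<^sub>1 = - \<theta> Q\<^sub>1\<close> forces \<open>a\<^sub>1 = - \<theta>\<close>; and \<open>Q\<^sub>0\<close>, \<open>Q\<^sub>1\<close> being
  orthonormal gives the mean and the (positive) variance of the stationary law.  Pairing the integrated
  equation with \<open>X\<^sub>s - \<mu>\<close> kills the martingale part, so the covariance \<open>f\<close> satisfies
  \<open>f(t) = C - \<theta> \<integral>\<^sub>0\<^sup>t f\<close> for \<open>t \<ge> s\<close>, and is exponential.

  By independence the correlation of the time-changed process is \<open>\<bbbE> exp (- \<theta> |E\<^sub>t - E\<^sub>s|)\<close>.  For \<open>s \<le> t\<close>,
  \<open>exp (- \<theta> (E\<^sub>t - E\<^sub>s)) = exp (- \<theta> E\<^sub>t) + \<theta> \<integral>\<^sub>0\<^sup>\<infinity> 1{v < E\<^sub>s} exp (- \<theta> (E\<^sub>t - v)) dv\<close>, the event \<open>v < E\<^sub>s\<close> is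
  \<open>D\<^sub>v \<le> s\<close> for almost every \<open>v\<close>, and given \<open>D\<^sub>v\<close> the remaining time \<open>E\<^sub>t - v\<close> is distributed like \<open>E\<close> at
  level \<open>t - D\<^sub>v\<close>.  Hence the correlation is \<open>\<Phi>(t) + \<theta> \<integral>\<^sub>0\<^sup>s \<Phi>(t - y) U(dy)\<close> with the potential measure
  \<open>U = \<integral>\<^sub>0\<^sup>\<infinity> P(D\<^sub>v \<in> \<cdot>) dv\<close>, whose Laplace transform is \<open>1 / \<psi>\<close>; \<open>h\<close> is its density.
\<close>

text \<open>The obstacle is that E is given only through D, and D only through its Laplace exponent.
  Writing 1 - exp(-\<theta> b) as the integral of \<theta> exp(-\<theta> w) over [0, b] turns
  expectations involving E into integrals of probabilities of events D_u \<le> t at fixed times u.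
  Conditioning then takes place at deterministic times only, where it is Fubini for the joint law of
  D_v and D_{v+w} - D_v. These integrals are taken in [0, \<infinity>], so that exchanging them is
  Tonelli. The potential measure by itself yields a convolution against U(dy). That U has a density
  h is a separate question, settled from the transform 1 / \<psi> alone: a positive multiple of U is
  dominated by a measure whose density is an explicit power function. On the diffusion side, the
  pairing of the Ito integral with X_s - \<mu> does not vanish; it stops depending on t once t \<ge>
  s and ends up in the constant C. The integral equation is therefore available only from s on, and
  its initial value is the stationary variance.\<close>

section \<open>Uniqueness of Laplace transforms of measures\<close>

text \<open>On [0, 1] all moments are at most 1, so the Taylor sums of the characteristic function,
  which involve only moments, converge to it with error at most 2 |t|^n / n!. Equal moments
  therefore give equal characteristic functions, and Levy's theorem applies.\<close>

lemma moments_unique_unit_interval: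
  fixes M N :: "real measure"
  assumes M: "real_distribution M" and N: "real_distribution N"
    and aeM: "AE x in M. 0 \<le> x \<and> x \<le> 1" and aeN: "AE x in N. 0 \<le> x \<and> x \<le> 1"
    and eq: "\<And>k. (LINT x|M. x ^ k) = (LINT x|N. x ^ k)"
  shows "M = N"
proof (rule Levy_uniqueness[OF M N], rule ext)
  fix t :: real
  have *: "(\<lambda>n. \<Sum>k\<le>n. ((\<i> * t) ^ k / fact k) * complex_of_real (LINT x|K. x ^ k)) \<longlonglongrightarrow> char K t"
    if K: "real_distribution K" and ae: "AE x in K. 0 \<le> x \<and> x \<le> 1" for K :: "real measure"
  proof -
    interpret K: real_distribution K by fact
    have int: "integrable K (\<lambda>x. x ^ k)" for k
    proof (rule K.integrable_const_bound[where B=1])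
      show "AE x in K. norm (x ^ k) \<le> 1" using ae by eventually_elim (auto simp: power_le_one)
    qed simp
    have le: "(\<integral>x. \<bar>x\<bar> ^ k \<partial>K) \<le> 1" for k
    proof -
      have "(\<integral>x. \<bar>x\<bar> ^ k \<partial>K) \<le> (\<integral>x. 1 \<partial>K)"
      proof (rule integral_mono_AE)
        show "integrable K (\<lambda>x. \<bar>x\<bar> ^ k)" using integrable_abs[OF int[of k]] by (simp add: power_abs)
        show "AE x in K. \<bar>x\<bar> ^ k \<le> 1" using ae by eventually_elim (auto simp: power_le_one)
      qed simp
      then show ?thesis using K.prob_space by simp
    qed
    have bd: "cmod ((\<Sum>k\<le>n. ((\<i> * t) ^ k / fact k) * complex_of_real (LINT x|K. x ^ k)) - char K t)
       \<le> 2 * (\<bar>t\<bar> ^ n / fact n)" for n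
    proof -
      have "2 * \<bar>t\<bar> ^ n / fact n * (\<integral>x. \<bar>x\<bar> ^ n \<partial>K) \<le> 2 * \<bar>t\<bar> ^ n / fact n * 1"
        by (rule mult_left_mono[OF le]) auto
      then show ?thesis using K.char_approx1[of n t] int by (simp add: norm_minus_commute)
    qed
    have "(\<lambda>n. 2 * (\<bar>t\<bar> ^ n / fact n)) \<longlonglongrightarrow> 2 * 0"
      using summable_LIMSEQ_zero[OF summable_exp[of "\<bar>t\<bar>"]]
      by (intro tendsto_intros) (simp add: divide_inverse mult.commute)
    then have "(\<lambda>n. (\<Sum>k\<le>n. ((\<i> * t) ^ k / fact k) * complex_of_real (LINT x|K. x ^ k)) - char K t) \<longlonglongrightarrow> 0"
      by (intro Lim_null_comparison[OF always_eventually[OF allI[OF bd]]]) simp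
    then show ?thesis by (simp add: LIM_zero_iff)
  qed
  show "char M t = char N t"
    using *[OF M aeM] *[OF N aeN] unfolding eq by (rule LIMSEQ_unique)
qed

text \<open>The measures may be infinite. Tilting by exp(-x) / Z makes them probabilities, and the
  image under x \<mapsto> exp(-x) lives on [0, 1]; its k-th moment is the Laplace transform at k + 1
  divided by Z. The problem thus becomes a moment problem on the unit interval. If Z = 0, both
  measures vanish because exp(-x) is positive.\<close>

lemma laplace_measure_unique:
  fixes \<mu> \<nu> :: "real measure"
  assumes [measurable_cong]: "sets \<mu> = sets borel" "sets \<nu> = sets borel"
    and ae: "AE x in \<mu>. 0 \<le> x" "AE x in \<nu>. 0 \<le> x"
    and fin: "\<And>s. s > 0 \<Longrightarrow> (\<integral>\<^sup>+x. ennreal (exp (- s * x)) \<partial>\<mu>) < \<infinity>"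
    and eq: "\<And>s. s > 0 \<Longrightarrow>
      (\<integral>\<^sup>+x. ennreal (exp (- s * x)) \<partial>\<mu>) = (\<integral>\<^sup>+x. ennreal (exp (- s * x)) \<partial>\<nu>)"
  shows "\<mu> = \<nu>"
proof -
  define Z where "Z = (\<integral>\<^sup>+x. ennreal (exp (- x)) \<partial>\<mu>)"
  have Znu: "Z = (\<integral>\<^sup>+x. ennreal (exp (- x)) \<partial>\<nu>)" using eq[of 1] by (simp add: Z_def)
  have Zfin: "Z < \<infinity>" using fin[of 1] by (simp add: Z_def)
  show ?thesis
  proof (cases "Z = 0")
    case True
    have null: "emeasure K A = 0"
      if [measurable_cong]: "sets K = sets borel" and "(\<integral>\<^sup>+x. ennreal (exp (- x)) \<partial>K) = 0" for K A
    proof -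
      have "AE x in K. ennreal (exp (- x)) = 0"
        using that(2) by (subst (asm) nn_integral_0_iff_AE) auto
      then have "AE x in K. False" by eventually_elim simp
      then have "emeasure K (space K) = 0" by (simp add: AE_iff_null null_sets_def)
      then show ?thesis using emeasure_space[of K A] by simp
    qed
    show ?thesis
      by (rule measure_eqI) (use null[of \<mu>] null[of \<nu>] True Z_def Znu in \<open>auto simp: assms\<close>)
  next
    case False
    define N where "N K = distr (density K (\<lambda>x. ennreal (exp (- x)) / Z)) borel (\<lambda>x. exp (- x))"
      for K :: "real measure"
    have ZZ: "Z / Z = 1" using False Zfin by (simp add: ennreal_divide_self)
    have N_int: "(\<integral>\<^sup>+y. f y \<partial>N K) = (\<integral>\<^sup>+x. ennreal (exp (- x)) / Z * f (exp (- x)) \<partial>K)"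
      if [measurable_cong]: "sets K = sets borel" and [measurable]: "f \<in> borel_measurable borel" for K f
      unfolding N_def
      by (subst nn_integral_distr) (simp_all add: nn_integral_density)
    have N_rd: "real_distribution (N K)"
      if [measurable_cong]: "sets K = sets borel" and Z: "(\<integral>\<^sup>+x. ennreal (exp (- x)) \<partial>K) = Z" for K
    proof -
      have "emeasure (N K) UNIV = (\<integral>\<^sup>+y. 1 \<partial>N K)" by (simp add: N_def)
      also have "\<dots> = (\<integral>\<^sup>+x. ennreal (exp (- x)) / Z \<partial>K)" by (subst N_int[OF that(1)]) auto
      also have "\<dots> = 1" by (subst nn_integral_divide) (auto simp: Z ZZ)
      finally have "prob_space (N K)" by (intro prob_spaceI) (simp add: N_def)
      then show ?thesis
        unfolding real_distribution_def real_distribution_axioms_def by (simp add: N_def)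
    qed
    have N_ae: "AE y in N K. 0 \<le> y \<and> y \<le> 1"
      if [measurable_cong]: "sets K = sets borel" and "AE x in K. 0 \<le> x" for K
      unfolding N_def
      by (subst AE_distr_iff) (use that(2) in \<open>auto simp: AE_density\<close>)
    have mom: "(\<integral>\<^sup>+y. ennreal (\<bar>y\<bar> ^ k) \<partial>N K) = (\<integral>\<^sup>+x. ennreal (exp (- real (Suc k) * x)) \<partial>K) / Z"
      if [measurable_cong]: "sets K = sets borel" for K k
    proof -
      have "(\<integral>\<^sup>+y. ennreal (\<bar>y\<bar> ^ k) \<partial>N K) = (\<integral>\<^sup>+x. ennreal (exp (- real (Suc k) * x)) / Z \<partial>K)"
      proof (subst N_int[OF that], simp, intro nn_integral_cong)
        fix x :: real
        have "exp (- x) * \<bar>exp (- x)\<bar> ^ k = exp (- real (Suc k) * x)"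
          by (simp add: exp_of_nat_mult[symmetric] mult_exp_exp algebra_simps)
        then show "ennreal (exp (- x)) / Z * ennreal (\<bar>exp (- x)\<bar> ^ k) = ennreal (exp (- real (Suc k) * x)) / Z"
          by (simp add: divide_ennreal_def ennreal_mult[symmetric] mult.commute mult.left_commute)
      qed
      then show ?thesis by (simp add: nn_integral_divide)
    qed
    have "N \<mu> = N \<nu>"
    proof (rule moments_unique_unit_interval)
      show "real_distribution (N \<mu>)" "real_distribution (N \<nu>)"
        using Z_def Znu by (auto intro!: N_rd assms)
      show ae': "AE x in N \<mu>. 0 \<le> x \<and> x \<le> 1" "AE x in N \<nu>. 0 \<le> x \<and> x \<le> 1"
        by (rule N_ae[OF assms(1) ae(1)], rule N_ae[OF assms(2) ae(2)])
      fix k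
      have *: "(LINT x|K. x ^ k) = enn2real (\<integral>\<^sup>+y. ennreal (\<bar>y\<bar> ^ k) \<partial>K)"
        if [measurable_cong]: "sets K = sets borel" and "AE x in K. 0 \<le> x \<and> x \<le> (1::real)" for K
      proof -
        have "(LINT x|K. x ^ k) = (LINT x|K. \<bar>x\<bar> ^ k)"
          using that(2) by (intro integral_cong_AE) (auto elim!: eventually_mono)
        then show ?thesis by (simp add: integral_eq_nn_integral)
      qed
      have "(\<integral>\<^sup>+y. ennreal (\<bar>y\<bar> ^ k) \<partial>N \<mu>) = (\<integral>\<^sup>+y. ennreal (\<bar>y\<bar> ^ k) \<partial>N \<nu>)"
        using eq[of "real (Suc k)"] by (simp only: mom assms)
      then show "(LINT x|N \<mu>. x ^ k) = (LINT x|N \<nu>. x ^ k)"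
        by (subst (1 2) *) (simp_all only: ae', simp_all add: N_def)
    qed
    \<comment> \<open>Tilting and transport can be undone: y = exp(-x) gives x = - ln y, and the
      weight Z / y cancels the factor exp(-x) / Z. Hence \<open>N\<close> determines the measure it
      came from.\<close>
    have recover: "emeasure K A = (\<integral>\<^sup>+y. indicator A (- ln y) * Z * ennreal (1 / y) \<partial>N K)"
      if [measurable_cong]: "sets K = sets borel" and [measurable]: "A \<in> sets borel" for K A
    proof -
      have "(\<integral>\<^sup>+y. indicator A (- ln y) * Z * ennreal (1 / y) \<partial>N K)
        = (\<integral>\<^sup>+x. ennreal (exp (- x)) / Z * (indicator A (- ln (exp (- x))) * Z * ennreal (1 / exp (- x))) \<partial>K)"
        by (subst N_int[OF that(1)]) auto
      also have "\<dots> = (\<integral>\<^sup>+x. indicator A x \<partial>K)"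
      proof (intro nn_integral_cong)
        fix x :: real
        have "ennreal (exp (- x)) * ennreal (1 / exp (- x)) = 1"
          by (subst ennreal_mult[symmetric]) auto
        moreover have "ennreal (exp (- x)) / Z * (indicator A (- ln (exp (- x))) * Z * ennreal (1 / exp (- x)))
          = (ennreal (exp (- x)) * ennreal (1 / exp (- x))) * (Z / Z) * indicator A x"
          by (simp add: divide_ennreal_def ac_simps)
        ultimately show "ennreal (exp (- x)) / Z * (indicator A (- ln (exp (- x))) * Z * ennreal (1 / exp (- x)))
          = indicator A x" by (simp add: ZZ)
      qed
      finally show ?thesis using that by simp
    qed
    show ?thesis
      by (rule measure_eqI) (use recover[of \<mu>] recover[of \<nu>] \<open>N \<mu> = N \<nu>\<close> in \<open>auto simp: assms\<close>)
  qed
qed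

text \<open>Euler's integral for \<open>Gamma a\<close> after the substitution t = s x. The two
  integrands may differ at the point 0, since Euler's integral is taken over the closed
  half-line.\<close>

lemma nn_integral_powr_exp:
  fixes a s :: real
  assumes "a > 0" "s > 0"
  shows "(\<integral>\<^sup>+x. ennreal (indicator {0<..} x * x powr (a - 1) / Gamma a) * ennreal (exp (- s * x)) \<partial>lborel)
    = ennreal (s powr (- a))"
proof -
  have G: "Gamma a > 0" using assms by (rule_tac Gamma_real_pos)
  note G' = less_imp_neq[OF G, symmetric]
  have "ennreal (Gamma a) = (\<integral>\<^sup>+t. ennreal (indicator {0..} t * t powr (a - 1) / exp t) \<partial>lborel)"
    using Gamma_conv_nn_integral_real[OF assms(1)] .
  also have "\<dots> = \<bar>s\<bar> * (\<integral>\<^sup>+x. ennreal (indicator {0..} (0 + s * x) * (0 + s * x) powr (a - 1) / exp (0 + s * x)) \<partial>lborel)"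
    using assms by (subst nn_integral_real_affine[where c=s and t=0]) auto
  also have "\<dots> = (\<integral>\<^sup>+x. ennreal (s powr a * Gamma a) *
      (ennreal (indicator {0<..} x * x powr (a - 1) / Gamma a) * ennreal (exp (- s * x))) \<partial>lborel)"
  proof (subst nn_integral_cmult[symmetric], simp, intro nn_integral_cong_AE, goal_cases)
    case 1
    have "AE x in lborel. (x::real) \<noteq> 0" by (rule AE_lborel_singleton)
    then show ?case
    proof eventually_elim
      case (elim x)
      have "s * (s * x) powr (a - 1) = s powr a * x powr (a - 1)" if "x > 0"
        using assms that by (simp add: powr_mult powr_diff)
      then show ?case using elim G assms G'
        by (auto simp: indicator_def ennreal_mult[symmetric] exp_minus field_simps zero_le_mult_iff)
    qed
  qed
  also have "\<dots> = ennreal (s powr a * Gamma a) *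
      (\<integral>\<^sup>+x. ennreal (indicator {0<..} x * x powr (a - 1) / Gamma a) * ennreal (exp (- s * x)) \<partial>lborel)"
    by (subst nn_integral_cmult) auto
  finally have eq: "ennreal (Gamma a) = ennreal (s powr a * Gamma a) *
      (\<integral>\<^sup>+x. ennreal (indicator {0<..} x * x powr (a - 1) / Gamma a) * ennreal (exp (- s * x)) \<partial>lborel)"
      (is "_ = _ * ?I") .
  have "ennreal (s powr (- a)) = ennreal (s powr (- a) / Gamma a) * ennreal (Gamma a)"
    using G by (simp add: ennreal_mult[symmetric])
  also have "\<dots> = ennreal (s powr (- a) / Gamma a) * ennreal (s powr a * Gamma a) * ?I"
    by (subst eq) (simp add: mult.assoc)
  also have "ennreal (s powr (- a) / Gamma a) * ennreal (s powr a * Gamma a) = 1"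
    using G G' assms by (simp add: ennreal_mult[symmetric] powr_minus field_simps)
  finally show ?thesis by simp
qed

section \<open>Absolute continuity of the potential measure\<close>

lemma AE_nonneg_of_emeasure:
  fixes R :: "real measure"
  assumes "sets R = sets borel" "emeasure R {..<0} = 0"
  shows "AE x in R. 0 \<le> x"
  by (rule AE_I[where N="{..<0}"]) (use assms in \<open>auto simp: not_le\<close>)

lemma laplace_exponent_sum_pos:
  assumes "n \<ge> 1" "\<forall>i\<in>{1..n}. c i > 0" "s > 0"
  shows "laplace_exponent_sum n c \<beta> s > 0"
  unfolding laplace_exponent_sum_def using assms by (intro sum_pos) auto

text \<open>
  With \<open>g\<^sub>\<delta>(x) = x\<^bsup>\<delta>-1\<^esup> / \<Gamma>(\<delta>)\<close>, whose Laplace transform is \<open>s\<^bsup>-\<delta>\<^esup>\<close>, the trivial identity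
  \<open>c\<^sub>n / \<psi> + (\<Sum>i<n. c\<^sub>i s\<^bsup>-(\<beta>\<^sub>n-\<beta>\<^sub>i)\<^esup>) / \<psi> = s\<^bsup>-\<beta>\<^sub>n\<^esup>\<close> says that \<open>c\<^sub>n U\<close> plus a nonnegative measure has
  density \<open>g\<^bsub>\<beta>\<^sub>n\<^esub>\<close>.  The measure \<open>R\<close> below is that sum, i.e. the convolution of \<open>U\<close> with
  \<open>c\<^sub>n \<delta>\<^sub>0 + (\<Sum>i<n. c\<^sub>i g\<^bsub>\<beta>\<^sub>n-\<beta>\<^sub>i\<^esub>)\<close>; the unit mass at \<open>0\<close> is realised as the image of Lebesgue measure
  on \<open>(0, 1)\<close>.
\<close>

lemma absolutely_continuous_potential:
  fixes U :: "real measure"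
  assumes U [measurable_cong]: "sets U = sets borel" and ae: "AE x in U. 0 \<le> x"
    and n: "n \<ge> 1" and c: "\<forall>i\<in>{1..n}. c i > 0" and \<beta>: "\<forall>i\<in>{1..n}. 0 < \<beta> i" "strict_mono_on {1..n} \<beta>"
    and lap: "\<And>s. s > 0 \<Longrightarrow>
      (\<integral>\<^sup>+x. ennreal (exp (- s * x)) \<partial>U) = ennreal (1 / laplace_exponent_sum n c \<beta> s)"
  shows "absolutely_continuous lborel U"
proof -
  define g where "g a x = ennreal (indicator {0<..} x * x powr (a - 1) / Gamma a)" for a x :: real
  have [measurable]: "g a \<in> borel_measurable borel" for a unfolding g_def by measurable
  have g_lap: "(\<integral>\<^sup>+x. g a x * ennreal (exp (- s * x)) \<partial>lborel) = ennreal (s powr (- a))"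
    if "a > 0" "s > 0" for a s
    unfolding g_def using nn_integral_powr_exp[OF that] .
  \<comment> \<open>A point (i, x) of \<open>B\<close> lies on the i-th copy of the line, one copy
    for each term of \<psi>. With weight \<open>k\<close> and displacement \<open>q\<close>, the
    whole finite sum of convolutions with U becomes a single push-forward.\<close>
  define B where "B = count_space {1..n} \<Otimes>\<^sub>M (lborel :: real measure)"
  define k where "k = (\<lambda>(i, x). ennreal (c i) * (if i = n then indicator {0<..<1} x else g (\<beta> n - \<beta> i) x))"
  define q where "q = (\<lambda>(i, x). if i = n then 0 else x :: real)"
  define R where "R = distr (density (U \<Otimes>\<^sub>M B) (\<lambda>(y, p). k p)) borel (\<lambda>(y, p). y + q p)"
  interpret B: sigma_finite_measure B
    unfolding B_def
    by (intro sigma_finite_pair_measure sigma_finite_measure_count_space_finite sigma_finite_lborel) simp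
  have [measurable]: "k \<in> borel_measurable B" "q \<in> borel_measurable B"
    unfolding B_def k_def q_def by (auto intro!: measurable_pair_measure_countable1)
  have B_int: "(\<integral>\<^sup>+p. f p \<partial>B) = (\<Sum>i\<in>{1..n}. \<integral>\<^sup>+x. f (i, x) \<partial>lborel)"
    if "f \<in> borel_measurable B" for f
    using lborel.nn_integral_fst[of f "count_space {1..n}"] that
    by (simp add: B_def nn_integral_count_space_finite)
  have R_int: "(\<integral>\<^sup>+z. f z \<partial>R) = (\<integral>\<^sup>+y. (\<Sum>i\<in>{1..n}. \<integral>\<^sup>+x. k (i, x) * f (y + q (i, x)) \<partial>lborel) \<partial>U)"
    if [measurable]: "f \<in> borel_measurable borel" for f
  proof -
    have "(\<integral>\<^sup>+z. f z \<partial>R) = (\<integral>\<^sup>+(y, p). k p * f (y + q p) \<partial>(U \<Otimes>\<^sub>M B))"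
      unfolding R_def by (subst nn_integral_distr) (auto simp: nn_integral_density case_prod_unfold)
    also have "\<dots> = (\<integral>\<^sup>+y. (\<integral>\<^sup>+p. k p * f (y + q p) \<partial>B) \<partial>U)"
      by (subst B.nn_integral_fst[symmetric]) auto
    also have "\<dots> = (\<integral>\<^sup>+y. (\<Sum>i\<in>{1..n}. \<integral>\<^sup>+x. k (i, x) * f (y + q (i, x)) \<partial>lborel) \<partial>U)"
      by (intro nn_integral_cong B_int) (simp add: U)
    finally show ?thesis .
  qed
  have qn: "q (i, x) = (if i = n then 0 else x)" for i x by (simp add: q_def)
  have kn: "k (i, x) = ennreal (c i) * (if i = n then indicator {0<..<1} x else g (\<beta> n - \<beta> i) x)" for i x
    by (simp add: k_def)
  have meas_part: "(\<lambda>y. \<Sum>i\<in>{1..n}. \<integral>\<^sup>+x. k (i, x) * f (y + q (i, x)) \<partial>lborel) \<in> borel_measurable U"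
    if [measurable]: "f \<in> borel_measurable borel" for f
    unfolding kn qn by measurable
  have \<delta>: "\<beta> n - \<beta> i > 0" if "i \<in> {1..n}" "i \<noteq> n" for i
    using \<beta>(2) that n by (auto simp: strict_mono_on_def)
  have R_lap: "(\<integral>\<^sup>+z. ennreal (exp (- s * z)) \<partial>R) = ennreal (s powr (- \<beta> n))" if s: "s > 0" for s
  proof -
    have part: "(\<integral>\<^sup>+x. k (i, x) * ennreal (exp (- s * (y + q (i, x)))) \<partial>lborel)
      = ennreal (exp (- s * y)) * ennreal (c i * s powr (\<beta> i - \<beta> n))" if i: "i \<in> {1..n}" for i y
    proof (cases "i = n")
      case True
      have "(\<integral>\<^sup>+x. k (i, x) * ennreal (exp (- s * (y + q (i, x)))) \<partial>lborel)
        = (\<integral>\<^sup>+x. (ennreal (exp (- s * y)) * ennreal (c i)) * indicator {0<..<1::real} x \<partial>lborel)"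
        using True by (intro nn_integral_cong) (simp add: qn kn mult.commute mult.left_commute)
      also have "\<dots> = ennreal (exp (- s * y)) * ennreal (c i)"
        by (subst nn_integral_cmult_indicator) auto
      finally show ?thesis using True s by simp
    next
      case False
      have "(\<integral>\<^sup>+x. k (i, x) * ennreal (exp (- s * (y + q (i, x)))) \<partial>lborel)
        = (\<integral>\<^sup>+x. (ennreal (exp (- s * y)) * ennreal (c i)) *
            (g (\<beta> n - \<beta> i) x * ennreal (exp (- s * x))) \<partial>lborel)"
        using False by (intro nn_integral_cong)
          (simp add: qn kn ring_distribs exp_add exp_diff exp_minus ennreal_mult ac_simps divide_inverse)
      also have "\<dots> = (ennreal (exp (- s * y)) * ennreal (c i)) * ennreal (s powr (- (\<beta> n - \<beta> i)))"
        by (subst nn_integral_cmult) (auto simp: g_lap[OF \<delta>[OF i False] s, simplified])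
      finally show ?thesis
        using less_imp_le[OF bspec[OF c i]] by (simp add: ennreal_mult mult.assoc)
    qed
    have "(\<integral>\<^sup>+z. ennreal (exp (- s * z)) \<partial>R)
      = (\<integral>\<^sup>+y. (\<Sum>i\<in>{1..n}. ennreal (exp (- s * y)) * ennreal (c i * s powr (\<beta> i - \<beta> n))) \<partial>U)"
      by (subst R_int, measurable, intro nn_integral_cong sum.cong refl part)
    also have "\<dots> = (\<integral>\<^sup>+y. ennreal (exp (- s * y)) * ennreal (\<Sum>i\<in>{1..n}. c i * s powr (\<beta> i - \<beta> n)) \<partial>U)"
      using c s by (intro nn_integral_cong) (auto simp: sum_distrib_left[symmetric] intro!: arg_cong2[where f="(*)"] sum_ennreal)
    also have "\<dots> = ennreal (1 / laplace_exponent_sum n c \<beta> s) * ennreal (\<Sum>i\<in>{1..n}. c i * s powr (\<beta> i - \<beta> n))"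
      by (subst nn_integral_multc) (auto simp: lap[OF s, simplified])
    \<comment> \<open>The sum is \<psi>(s) s^(-\<beta>_n), so the factor 1 / \<psi>(s) contributed
      by U cancels and only the pure power is left.\<close>
    also have "(\<Sum>i\<in>{1..n}. c i * s powr (\<beta> i - \<beta> n)) = laplace_exponent_sum n c \<beta> s * s powr (- \<beta> n)"
      unfolding laplace_exponent_sum_def by (simp add: sum_distrib_right powr_diff powr_minus divide_inverse mult.assoc)
    finally show ?thesis
      using laplace_exponent_sum_pos[OF n c s, of \<beta>] by (simp add: ennreal_mult[symmetric])
  qed
  have R_eq: "R = density lborel (g (\<beta> n))"
  proof (rule laplace_measure_unique)
    show "sets R = sets borel" by (simp add: R_def)
    show "AE x in R. 0 \<le> x"
    proof (rule AE_nonneg_of_emeasure)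
      show "sets R = sets borel" by (simp add: R_def)
      have "(\<integral>\<^sup>+z. indicator {..<0} z \<partial>R)
        = (\<integral>\<^sup>+y. (\<Sum>i\<in>{1..n}. \<integral>\<^sup>+x. k (i, x) * indicator {..<0} (y + q (i, x)) \<partial>lborel) \<partial>U)"
        by (rule R_int) simp
      also have "\<dots> = (\<integral>\<^sup>+y. 0 \<partial>U)"
      proof (rule nn_integral_cong_AE)
        show "AE y in U. (\<Sum>i\<in>{1..n}. \<integral>\<^sup>+x. k (i, x) * indicator {..<0} (y + q (i, x)) \<partial>lborel) = 0"
          using ae
        proof eventually_elim
          case (elim y)
          have z: "k (i, x) * indicator {..<0} (y + q (i, x)) = 0" for i x
            using elim by (auto simp: kn qn g_def indicator_def)
          show ?case unfolding z by simp
        qed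
      qed
      finally show "emeasure R {..<0} = 0" by (simp add: R_def)
    qed
    show "AE x in density lborel (g (\<beta> n)). 0 \<le> x"
      by (subst AE_density) (auto simp: g_def indicator_def)
    fix s :: real assume s: "s > 0"
    show "(\<integral>\<^sup>+z. ennreal (exp (- s * z)) \<partial>R) < \<infinity>" using R_lap[OF s] by simp
    have "\<beta> n > 0" using \<beta> n by simp
    then show "(\<integral>\<^sup>+z. ennreal (exp (- s * z)) \<partial>R) = (\<integral>\<^sup>+z. ennreal (exp (- s * z)) \<partial>density lborel (g (\<beta> n)))"
      using R_lap[OF s] g_lap[OF _ s, of "\<beta> n"] by (simp add: nn_integral_density)
  qed simp
  show ?thesis
    unfolding absolutely_continuous_def
  proof
    fix A assume A: "A \<in> null_sets (lborel :: real measure)"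
    then have [measurable]: "A \<in> sets borel" by auto
    have "A \<in> null_sets (density lborel (g (\<beta> n)))"
      using A absolutely_continuousI_density[of "g (\<beta> n)" lborel] by (auto simp: absolutely_continuous_def)
    then have "emeasure R A = 0" unfolding R_eq by auto
    \<comment> \<open>Keeping only the term i = n, whose displacement is 0, bounds c_n U by
      \<open>R\<close>. As c_n > 0, null sets of \<open>R\<close> are null sets of U.\<close>
    moreover have "ennreal (c n) * emeasure U A \<le> emeasure R A"
    proof -
      have "ennreal (c n) * emeasure U A = (\<integral>\<^sup>+y. ennreal (c n) * indicator A y \<partial>U)"
        by (subst nn_integral_cmult_indicator) (auto simp: U)
      also have "\<dots> \<le> (\<integral>\<^sup>+y. (\<Sum>i\<in>{1..n}. \<integral>\<^sup>+x. k (i, x) * indicator A (y + q (i, x)) \<partial>lborel) \<partial>U)"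
      proof (rule nn_integral_mono)
        fix y
        have "ennreal (c n) * indicator A y = (\<integral>\<^sup>+x. (ennreal (c n) * indicator A y) * indicator {0<..<1::real} x \<partial>lborel)"
          by (subst nn_integral_cmult_indicator) auto
        also have "\<dots> = (\<integral>\<^sup>+x. k (n, x) * indicator A (y + q (n, x)) \<partial>lborel)"
          by (intro nn_integral_cong) (simp add: qn kn ac_simps)
        also have "\<dots> \<le> (\<Sum>i\<in>{1..n}. \<integral>\<^sup>+x. k (i, x) * indicator A (y + q (i, x)) \<partial>lborel)"
          using n by (intro member_le_sum) auto
        finally show "ennreal (c n) * indicator A y \<le> (\<Sum>i\<in>{1..n}. \<integral>\<^sup>+x. k (i, x) * indicator A (y + q (i, x)) \<partial>lborel)" .
      qed
      also have "\<dots> = (\<integral>\<^sup>+z. indicator A z \<partial>R)" by (rule R_int[symmetric]) simp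
      also have "\<dots> = emeasure R A" by (simp add: R_def)
      finally show ?thesis .
    qed
    moreover have "c n > 0" using c n by auto
    ultimately show "A \<in> null_sets U" by (auto simp: null_sets_def U)
  qed
qed

text \<open>The Radon-Nikodym derivative takes values in [0, \<infinity>]. Finiteness of the
  transform at s = 1 makes it finite almost everywhere, so a real version exists; setting it to 0 on
  the negative half-line is harmless because U sits on [0, \<infinity>), and it later lets integrals
  over {..s} be read over {0..s}.\<close>

lemma potential_density_exists:
  fixes U :: "real measure"
  assumes U [measurable_cong]: "sets U = sets borel" and ae: "AE x in U. 0 \<le> x"
    and n: "n \<ge> 1" and c: "\<forall>i\<in>{1..n}. c i > 0" and \<beta>: "\<forall>i\<in>{1..n}. 0 < \<beta> i" "strict_mono_on {1..n} \<beta>"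
    and lap: "\<And>s. s > 0 \<Longrightarrow>
      (\<integral>\<^sup>+x. ennreal (exp (- s * x)) \<partial>U) = ennreal (1 / laplace_exponent_sum n c \<beta> s)"
  obtains h where "h \<in> borel_measurable borel" "\<And>x. 0 \<le> h x" "\<And>x. x < 0 \<Longrightarrow> h x = 0"
    "U = density lborel (\<lambda>x. ennreal (h x))"
proof -
  obtain f where f [measurable]: "f \<in> borel_measurable lborel" and Uf: "density lborel f = U"
    using sigma_finite_measure.Radon_Nikodym[OF sigma_finite_lborel absolutely_continuous_potential[OF assms]] U by auto
  have "(\<integral>\<^sup>+x. f x * ennreal (exp (- x)) \<partial>lborel) = (\<integral>\<^sup>+x. ennreal (exp (- 1 * x)) \<partial>U)"
    unfolding Uf[symmetric] by (simp add: nn_integral_density)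
  then have "(\<integral>\<^sup>+x. f x * ennreal (exp (- x)) \<partial>lborel) \<noteq> \<infinity>"
    by (subst (asm) lap) auto
  then have "AE x in lborel. f x * ennreal (exp (- x)) \<noteq> \<infinity>"
    by (intro nn_integral_PInf_AE) auto
  moreover have "AE x in lborel. 0 < f x \<longrightarrow> 0 \<le> x"
    using ae unfolding Uf[symmetric] by (subst (asm) AE_density) auto
  ultimately have "AE x in lborel. f x = ennreal (if x < 0 then 0 else enn2real (f x))"
    by eventually_elim (auto simp: ennreal_enn2real_if ennreal_mult_eq_top_iff not_less zero_less_iff_neq_zero)
  then have "U = density lborel (\<lambda>x. ennreal (if x < 0 then 0 else enn2real (f x)))"
    unfolding Uf[symmetric] by (intro density_cong) auto
  then show thesis
    by (intro that[of "\<lambda>x. if x < 0 then 0 else enn2real (f x)"]) (use f in auto)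
qed

section \<open>Subordinators with regular paths and their inverses\<close>

text \<open>Applied both to the subordinator and to the continuous diffusion. Each approximation
  evaluates the process at countably many times only, where measurability in the sample point
  suffices. The argument \<open>max 0 t\<close> extends the process to negative times, at which
  nothing is assumed.\<close>

lemma joint_measurable_right_continuous:
  fixes X :: "real \<Rightarrow> 'a \<Rightarrow> real"
  assumes meas: "\<And>t. t \<ge> 0 \<Longrightarrow> X t \<in> borel_measurable N"
    and rc: "\<And>\<omega> t. \<omega> \<in> space N \<Longrightarrow> t \<ge> 0 \<Longrightarrow> ((\<lambda>u. X u \<omega>) \<longlongrightarrow> X t \<omega>) (at_right t)"
  shows "(\<lambda>(t, \<omega>). X (max 0 t) \<omega>) \<in> borel_measurable (borel \<Otimes>\<^sub>M N)"
proof (rule borel_measurable_LIMSEQ_real)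
  \<comment> \<open>A point of the grid of mesh 1 / (i + 1) strictly to the right of t: the added 1
    gives strictness, since a limit along \<open>at_right\<close> says nothing about t
    itself.\<close>
  define r where "r i t = real (nat \<lfloor>real (Suc i) * max 0 t\<rfloor> + 1) / real (Suc i)" for i and t :: real
  show "(\<lambda>(t, \<omega>). X (r i t) \<omega>) \<in> borel_measurable (borel \<Otimes>\<^sub>M N)" for i
  proof -
    have "(\<lambda>p :: real \<times> 'a. X (real (nat \<lfloor>real (Suc i) * max 0 (fst p)\<rfloor> + 1) / real (Suc i)) (snd p))
      \<in> borel_measurable (borel \<Otimes>\<^sub>M N)"
    proof (rule measurable_compose_countable[where f="\<lambda>k p. X (real (k + 1) / real (Suc i)) (snd p)"])
      show "(\<lambda>p :: real \<times> 'a. X (real (k + 1) / real (Suc i)) (snd p)) \<in> borel_measurable (borel \<Otimes>\<^sub>M N)" for k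
        by (rule measurable_compose[OF measurable_snd meas]) simp
    qed measurable
    then show ?thesis by (simp add: split_beta r_def)
  qed
  fix p :: "real \<times> 'a" assume p: "p \<in> space (borel \<Otimes>\<^sub>M N)"
  define t where "t = max 0 (fst p)"
  have "filterlim (\<lambda>i. r i t) (at_right t) sequentially"
    unfolding filterlim_at
  proof (intro conjI)
    have b: "t < r i t \<and> r i t \<le> t + 1 / real (Suc i)" for i
    proof -
      define K N where "K = real (Suc i)" and "N = real (nat \<lfloor>K * t\<rfloor> + 1)"
      have K: "K > 0" by (simp add: K_def)
      have t0: "max 0 t = t" "t \<ge> 0" by (auto simp: t_def)
      have "N = of_int \<lfloor>K * t\<rfloor> + 1" using t0 K by (simp add: N_def)
      then have "K * t < N" "N \<le> K * t + 1" by linarith+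
      then have "t < N / K \<and> N / K \<le> t + 1 / K" using K by (simp add: field_simps)
      then show ?thesis unfolding r_def t0 N_def K_def .
    qed
    then show "\<forall>\<^sub>F i in sequentially. r i t \<in> {t<..} \<and> r i t \<noteq> t" by (intro always_eventually allI) (metis greaterThan_iff less_irrefl)
    have "(\<lambda>i. t + 1 / real (Suc i)) \<longlonglongrightarrow> t + 0"
      by (intro tendsto_intros LIMSEQ_Suc[OF lim_1_over_n])
    then show "(\<lambda>i. r i t) \<longlonglongrightarrow> t"
      by (intro tendsto_sandwich[of "\<lambda>_. t" "\<lambda>i. r i t" sequentially "\<lambda>i. t + 1 / real (Suc i)"])
        (use b in \<open>auto intro!: always_eventually simp: less_imp_le\<close>)
  qed
  then have "(\<lambda>i. X (r i t) (snd p)) \<longlonglongrightarrow> X t (snd p)"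
    using p by (intro filterlim_compose[OF rc]) (auto simp: t_def space_pair_measure)
  moreover have "r i t = r i (fst p)" for i by (simp add: r_def t_def)
  ultimately show "(\<lambda>i. case p of (t, \<omega>) \<Rightarrow> X (r i t) \<omega>) \<longlonglongrightarrow> (case p of (t, \<omega>) \<Rightarrow> X (max 0 t) \<omega>)"
    by (simp add: split_beta t_def)
qed

text \<open>Registered for automatic measurability proofs, where indicators of {..t - D_v} with a
  random end point occur.\<close>

lemma pred_atMost [measurable (raw)]:
  fixes f g :: "'a \<Rightarrow> real"
  assumes [measurable]: "f \<in> borel_measurable N" "g \<in> borel_measurable N"
  shows "Measurable.pred N (\<lambda>x. f x \<in> {..g x})"
  by simp

lemma nn_integral_exp_atLeastAtMost:
  fixes \<theta> b :: real
  assumes "\<theta> > 0" "b \<ge> 0"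
  shows "(\<integral>\<^sup>+w. ennreal (\<theta> * exp (- \<theta> * w)) * indicator {0..b} w \<partial>lborel) = ennreal (1 - exp (- \<theta> * b))"
proof -
  have "(\<integral>\<^sup>+w. ennreal (\<theta> * exp (- \<theta> * w)) * indicator {0..b} w \<partial>lborel)
    = ennreal (- exp (- \<theta> * b) - (- exp (- \<theta> * 0)))"
    using assms by (intro nn_integral_FTC_Icc) (auto intro!: derivative_eq_intros)
  then show ?thesis by simp
qed

lemma nn_integral_exp_atLeast:
  fixes a b :: real
  assumes "a > 0"
  shows "(\<integral>\<^sup>+w. ennreal (exp (- a * w)) * indicator {b..} w \<partial>lborel) = ennreal (exp (- a * b) / a)"
proof -
  have "(\<integral>\<^sup>+w. ennreal (exp (- a * w)) * indicator {b..} w \<partial>lborel) = ennreal (0 - (- exp (- a * b) / a))"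
  proof (rule nn_integral_FTC_atLeast)
    show "((\<lambda>w. - exp (- a * w) / a) \<longlongrightarrow> 0) at_top"
      using assms by real_asymp
  qed (use assms in \<open>auto intro!: derivative_eq_intros\<close>)
  then show ?thesis by simp
qed

lemma inverse_subordinator_le:
  assumes "\<tau> \<ge> 0" "D \<tau> \<omega> > t"
  shows "inverse_subordinator D t \<omega> \<le> \<tau>"
proof -
  have "Inf {\<tau>. \<tau> \<ge> 0 \<and> D \<tau> \<omega> > t} \<le> \<tau>"
    using assms by (intro cInf_lower) (auto intro!: bdd_belowI[of _ 0])
  then show ?thesis using assms by (auto simp: inverse_subordinator_def)
qed

lemma inverse_subordinator_nonneg: "inverse_subordinator D t \<omega> \<ge> 0"
  unfolding inverse_subordinator_def by (auto intro!: cInf_greatest)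

text \<open>Path properties are demanded at every sample point, so that pathwise identities need no
  exceptional sets. Unboundedness keeps the default value of \<open>inverse_subordinator\<close>
  from occurring. Independence of increments has the two-time form that the Markov property uses. A
  given subordinator is brought into this form by \<open>regular_version\<close>.\<close>

locale regular_subordinator = prob_space M for M :: "'a measure" +
  fixes D :: "real \<Rightarrow> 'a \<Rightarrow> real" and \<psi> :: "real \<Rightarrow> real"
  assumes D_meas: "\<And>t. t \<ge> 0 \<Longrightarrow> D t \<in> borel_measurable M"
    and D_zero: "\<And>\<omega>. \<omega> \<in> space M \<Longrightarrow> D 0 \<omega> = 0"
    and D_mono: "\<And>\<omega>. \<omega> \<in> space M \<Longrightarrow> mono_on {0..} (\<lambda>t. D t \<omega>)"
    and D_right: "\<And>\<omega> t. \<omega> \<in> space M \<Longrightarrow> t \<ge> 0 \<Longrightarrow> ((\<lambda>u. D u \<omega>) \<longlongrightarrow> D t \<omega>) (at_right t)"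
    and D_unbounded: "\<And>\<omega> C. \<omega> \<in> space M \<Longrightarrow> \<exists>\<tau>\<ge>0. D \<tau> \<omega> > C"
    and D_laplace: "\<And>s t. s > 0 \<Longrightarrow> t \<ge> 0 \<Longrightarrow>
      (\<integral>\<^sup>+\<omega>. ennreal (exp (- s * D t \<omega>)) \<partial>M) = ennreal (exp (- t * \<psi> s))"
    and D_indep: "\<And>v w. v \<ge> 0 \<Longrightarrow> w \<ge> 0 \<Longrightarrow> indep_var borel (D v) borel (\<lambda>\<omega>. D (v + w) \<omega> - D v \<omega>)"
    and D_stat: "\<And>v w. v \<ge> 0 \<Longrightarrow> w \<ge> 0 \<Longrightarrow>
      distr M borel (\<lambda>\<omega>. D (v + w) \<omega> - D v \<omega>) = distr M borel (D w)"
    and \<psi>_pos: "\<And>s. s > 0 \<Longrightarrow> \<psi> s > 0"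
begin

abbreviation "E \<equiv> inverse_subordinator D"

text \<open>Monotonicity puts every time at which D exceeds t at or beyond v, and unboundedness
  makes the infimum one over a nonempty set. Together with \<open>less_E_imp_D_le\<close> this
  leaves only v = E_t undecided, a Lebesgue null set.\<close>

lemma D_le_imp_le_E:
  assumes "\<omega> \<in> space M" "v \<ge> 0" "D v \<omega> \<le> t"
  shows "v \<le> E t \<omega>"
proof -
  obtain \<tau> where \<tau>: "\<tau> \<ge> 0" "D \<tau> \<omega> > t" using D_unbounded[OF assms(1)] by blast
  have "v \<le> Inf {\<tau>. \<tau> \<ge> 0 \<and> D \<tau> \<omega> > t}"
  proof (rule cInf_greatest)
    show "{\<tau>. \<tau> \<ge> 0 \<and> D \<tau> \<omega> > t} \<noteq> {}" using \<tau> by auto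
    fix u assume u: "u \<in> {\<tau>. \<tau> \<ge> 0 \<and> D \<tau> \<omega> > t}"
    show "v \<le> u"
    proof (rule ccontr)
      assume "\<not> v \<le> u"
      then have "D u \<omega> \<le> D v \<omega>" using u assms D_mono[OF assms(1)] by (intro mono_onD[of "{0..}" "\<lambda>t. D t \<omega>"]) auto
      then show False using u assms by auto
    qed
  qed
  then show ?thesis using \<tau> by (auto simp: inverse_subordinator_def)
qed

lemma less_E_imp_D_le: "v \<ge> 0 \<Longrightarrow> v < E t \<omega> \<Longrightarrow> D v \<omega> \<le> t"
  using inverse_subordinator_le[of v t D \<omega>] by force

lemma E_mono: "\<omega> \<in> space M \<Longrightarrow> s \<le> t \<Longrightarrow> E s \<omega> \<le> E t \<omega>"
proof (rule ccontr)
  assume *: "\<omega> \<in> space M" "s \<le> t" "\<not> E s \<omega> \<le> E t \<omega>"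
  then obtain v where v: "E t \<omega> < v" "v < E s \<omega>" using dense[of "E t \<omega>" "E s \<omega>"] by (auto simp: not_le)
  then have "v \<ge> 0" using inverse_subordinator_nonneg[of D t \<omega>] by linarith
  then show False using D_le_imp_le_E[OF *(1), of v t] less_E_imp_D_le[of v s \<omega>] v * by linarith
qed

section \<open>Joint measurability and first passage\<close>

text \<open>Uncurried and frozen at time 0 for negative arguments, so that it is measurable on the
  whole product space and bounded below by 0; an indicator of the half-line restores the intended
  range in integrals.\<close>

definition D_ext :: "real \<times> 'a \<Rightarrow> real" where "D_ext = (\<lambda>(w, \<omega>). D (max 0 w) \<omega>)"

lemma D_ext_measurable [measurable]: "D_ext \<in> borel_measurable (borel \<Otimes>\<^sub>M M)"
  unfolding D_ext_def by (rule joint_measurable_right_continuous[OF D_meas D_right])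

lemma D_ext_eq: "w \<ge> 0 \<Longrightarrow> D_ext (w, \<omega>) = D w \<omega>" by (simp add: D_ext_def)

lemma D_nonneg: "\<omega> \<in> space M \<Longrightarrow> 0 \<le> D_ext (w, \<omega>)"
  using mono_onD[OF D_mono, of \<omega> 0 "max 0 w"] D_zero[of \<omega>] by (simp add: D_ext_def)

text \<open>Up to the single point w = E_t - v, the events D_{v+w} \<le> t cut out the interval
  [0, E_t - v], over which \<theta> exp(-\<theta> w) is integrated. A function of the passage time
  is thereby expressed by values of D at fixed times.\<close>

lemma nn_integral_passage:
  assumes \<omega>: "\<omega> \<in> space M" and \<theta>: "\<theta> > 0" and v: "v \<ge> 0" "v \<le> E t \<omega>"
  shows "(\<integral>\<^sup>+w. ennreal (\<theta> * exp (- \<theta> * w)) * indicator {0..} w * indicator {..t} (D_ext (v + w, \<omega>)) \<partial>lborel)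
    = ennreal (1 - exp (- \<theta> * (E t \<omega> - v)))"
proof -
  have "(\<integral>\<^sup>+w. ennreal (\<theta> * exp (- \<theta> * w)) * indicator {0..} w * indicator {..t} (D_ext (v + w, \<omega>)) \<partial>lborel)
    = (\<integral>\<^sup>+w. ennreal (\<theta> * exp (- \<theta> * w)) * indicator {0..E t \<omega> - v} w \<partial>lborel)"
  proof (rule nn_integral_cong_AE)
    have "AE w in lborel. w \<noteq> E t \<omega> - v" by (rule AE_lborel_singleton)
    then show "AE w in lborel. ennreal (\<theta> * exp (- \<theta> * w)) * indicator {0..} w * indicator {..t} (D_ext (v + w, \<omega>))
      = ennreal (\<theta> * exp (- \<theta> * w)) * indicator {0..E t \<omega> - v} w"
    proof eventually_elim
      case (elim w)
      show ?case
      proof (cases "w \<ge> 0")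
        case True
        then have "D (v + w) \<omega> \<le> t \<longleftrightarrow> w \<le> E t \<omega> - v"
          using D_le_imp_le_E[OF \<omega>, of "v + w" t] less_E_imp_D_le[of "v + w" t \<omega>] v elim by fastforce
        then show ?thesis using True v by (auto simp: D_ext_eq indicator_def)
      qed (auto simp: indicator_def)
    qed
  qed
  also have "\<dots> = ennreal (1 - exp (- \<theta> * (E t \<omega> - v)))"
    using v \<theta> by (intro nn_integral_exp_atLeastAtMost) auto
  finally show ?thesis .
qed

text \<open>The passage identity with \<theta> = 1 and v = 0, solved for E_t, writes it as - ln (1 -
  I), where I is a parameter integral with jointly measurable integrand.\<close>

lemma E_joint_measurable [measurable]: "(\<lambda>(t, \<omega>). E t \<omega>) \<in> borel_measurable (borel \<Otimes>\<^sub>M M)"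
proof -
  have *: "E t \<omega> = - ln (1 - enn2real (\<integral>\<^sup>+w. ennreal (1 * exp (- 1 * w)) * indicator {0..} w * indicator {..t} (D_ext (0 + w, \<omega>)) \<partial>lborel))"
    if "\<omega> \<in> space M" for t \<omega>
    by (subst nn_integral_passage[OF that]) (auto simp: inverse_subordinator_nonneg)
  have "(\<lambda>p. - ln (1 - enn2real (\<integral>\<^sup>+w. ennreal (1 * exp (- 1 * w)) * indicator {0..} w *
      (if D_ext (0 + w, snd p) \<le> fst p then 1 else 0) \<partial>lborel))) \<in> borel_measurable (borel \<Otimes>\<^sub>M M)"
    by measurable
  then show ?thesis
    by (rule measurable_cong[THEN iffD1, rotated]) (auto simp: space_pair_measure * indicator_def of_bool_def)
qed

lemma E_measurable [measurable]: "E t \<in> borel_measurable M"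
  using measurable_compose[OF measurable_Pair1' E_joint_measurable, of t] by simp


section \<open>Laplace transforms of the inverse and of the potential measure\<close>

definition \<Phi> :: "real \<Rightarrow> real \<Rightarrow> real" where "\<Phi> \<theta> t = (LINT \<omega>|M. exp (- \<theta> * E t \<omega>))"

text \<open>The occupation measure: the mass of a Borel set is the expected Lebesgue amount of time
  that D spends in it.\<close>

definition potential :: "real measure" where
  "potential = distr (density (lborel \<Otimes>\<^sub>M M) (\<lambda>p. indicator {0..} (fst p))) borel D_ext"

lemma D_ext_measurable_lborel [measurable]: "D_ext \<in> borel_measurable (lborel \<Otimes>\<^sub>M M)"
  using D_ext_measurable by (simp cong: measurable_cong_sets)

lemma nn_integral_potential:
  assumes [measurable]: "f \<in> borel_measurable borel"
  shows "(\<integral>\<^sup>+x. f x \<partial>potential) = (\<integral>\<^sup>+v. indicator {0..} v * (\<integral>\<^sup>+\<omega>. f (D_ext (v, \<omega>)) \<partial>M) \<partial>lborel)"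
  unfolding potential_def
  by (simp add: nn_integral_distr nn_integral_density nn_integral_fst[symmetric] nn_integral_cmult)

lemma sets_potential [simp, measurable_cong]: "sets potential = sets borel"
  by (simp add: potential_def)

lemma potential_nonneg: "AE x in potential. 0 \<le> x"
  unfolding potential_def by (subst AE_distr_iff) (auto simp: space_pair_measure intro!: AE_I2 D_nonneg)

text \<open>By Tonelli the transform is the integral of exp(-v \<psi>(s)) over v \<ge> 0, which
  converges because \<psi>(s) > 0.\<close>

lemma potential_laplace:
  assumes s: "s > 0"
  shows "(\<integral>\<^sup>+x. ennreal (exp (- s * x)) \<partial>potential) = ennreal (1 / \<psi> s)"
proof -
  have "(\<integral>\<^sup>+x. ennreal (exp (- s * x)) \<partial>potential)
    = (\<integral>\<^sup>+v. ennreal (exp (- \<psi> s * v)) * indicator {0..} v \<partial>lborel)"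
    by (subst nn_integral_potential)
      (auto intro!: nn_integral_cong simp: D_ext_eq D_laplace[OF s, simplified] mult.commute split: split_indicator)
  also have "\<dots> = ennreal (1 / \<psi> s)"
    using nn_integral_exp_atLeast[OF \<psi>_pos[OF s], of 0] by simp
  finally show ?thesis .
qed

lemma exp_E_integrable [simp]: "\<theta> > 0 \<Longrightarrow> integrable M (\<lambda>\<omega>. exp (- \<theta> * E t \<omega>))"
  by (rule integrable_const_bound[where B=1]) (auto simp: inverse_subordinator_nonneg)

lemma \<Phi>_nn: "\<theta> > 0 \<Longrightarrow> ennreal (\<Phi> \<theta> t) = (\<integral>\<^sup>+\<omega>. ennreal (exp (- \<theta> * E t \<omega>)) \<partial>M)"
  unfolding \<Phi>_def using exp_E_integrable[of \<theta> t] by (subst nn_integral_eq_integral) auto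

lemma \<Phi>_bounds: assumes "\<theta> > 0" shows "0 \<le> \<Phi> \<theta> t" "\<Phi> \<theta> t \<le> 1"
proof -
  show "0 \<le> \<Phi> \<theta> t" by (simp add: \<Phi>_def)
  have "\<Phi> \<theta> t \<le> (LINT \<omega>|M. 1)"
    unfolding \<Phi>_def using assms exp_E_integrable[OF assms, of t] by (intro integral_mono) (auto simp: inverse_subordinator_nonneg)
  then show "\<Phi> \<theta> t \<le> 1" using prob_space by simp
qed

lemma \<Phi>_measurable [measurable]: "\<Phi> \<theta> \<in> borel_measurable borel"
  unfolding \<Phi>_def by measurable

text \<open>The complement 1 - \<Phi> is what the passage identity represents: averaged over the
  sample space, it becomes an integral of the probabilities that D_w \<le> t. Statements about
  \<Phi> itself are recovered by subtraction.\<close>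

lemma one_minus_\<Phi>:
  assumes \<theta>: "\<theta> > 0"
  shows "ennreal (1 - \<Phi> \<theta> t) =
    (\<integral>\<^sup>+w. ennreal (\<theta> * exp (- \<theta> * w)) * indicator {0..} w * (\<integral>\<^sup>+\<omega>. indicator {..t} (D_ext (w, \<omega>)) \<partial>M) \<partial>lborel)"
proof -
  interpret P: pair_sigma_finite M lborel ..
  have "ennreal (1 - \<Phi> \<theta> t) = ennreal (LINT \<omega>|M. 1 - exp (- \<theta> * E t \<omega>))"
    using exp_E_integrable[OF \<theta>, of t] prob_space by (simp add: \<Phi>_def)
  also have "\<dots> = (\<integral>\<^sup>+\<omega>. ennreal (1 - exp (- \<theta> * E t \<omega>)) \<partial>M)"
    using exp_E_integrable[OF \<theta>, of t] \<theta>
    by (subst nn_integral_eq_integral) (auto simp: inverse_subordinator_nonneg)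
  also have "\<dots> = (\<integral>\<^sup>+\<omega>. (\<integral>\<^sup>+w. ennreal (\<theta> * exp (- \<theta> * w)) * indicator {0..} w * indicator {..t} (D_ext (0 + w, \<omega>)) \<partial>lborel) \<partial>M)"
    using \<theta> by (intro nn_integral_cong, subst nn_integral_passage) (auto simp: inverse_subordinator_nonneg)
  also have "\<dots> = (\<integral>\<^sup>+w. (\<integral>\<^sup>+\<omega>. ennreal (\<theta> * exp (- \<theta> * w)) * indicator {0..} w * indicator {..t} (D_ext (0 + w, \<omega>)) \<partial>M) \<partial>lborel)"
    by (intro P.Fubini'[symmetric]) measurable
  finally show ?thesis by (simp add: nn_integral_cmult)
qed

text \<open>For 1 - \<Phi> the integrals are rearranged so that t comes first, where exp(-s t) over
  [D_w, \<infinity>) gives exp(-s D_w) / s. The expectation turns this into exp(-w \<psi>(s)) / s,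
  and the weight \<theta> exp(-\<theta> w) integrates it to \<theta> / (s (\<theta> +
  \<psi>(s))).\<close>

lemma \<Phi>_laplace:
  assumes \<theta>: "\<theta> > 0" and s: "s > 0"
  shows "has_laplace_transform (\<Phi> \<theta>) s (\<psi> s / (s * (\<theta> + \<psi> s)))"
proof -
  interpret P: pair_sigma_finite M lborel ..
  have "(\<integral>\<^sup>+t. ennreal (exp (- s * t)) * indicator {0..} t * ennreal (1 - \<Phi> \<theta> t) \<partial>lborel)
    = (\<integral>\<^sup>+t. (\<integral>\<^sup>+w. ennreal (exp (- s * t)) * indicator {0..} t *
        (ennreal (\<theta> * exp (- \<theta> * w)) * indicator {0..} w * (\<integral>\<^sup>+\<omega>. indicator {..t} (D_ext (w, \<omega>)) \<partial>M)) \<partial>lborel) \<partial>lborel)"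
    by (subst one_minus_\<Phi>[OF \<theta>]) (simp add: nn_integral_cmult)
  also have "\<dots> = (\<integral>\<^sup>+w. (\<integral>\<^sup>+t. ennreal (exp (- s * t)) * indicator {0..} t *
        (ennreal (\<theta> * exp (- \<theta> * w)) * indicator {0..} w * (\<integral>\<^sup>+\<omega>. indicator {..t} (D_ext (w, \<omega>)) \<partial>M)) \<partial>lborel) \<partial>lborel)"
    by (intro lborel_pair.Fubini') measurable
  also have "\<dots> = (\<integral>\<^sup>+w. ennreal (\<theta> / s) * (ennreal (exp (- (\<theta> + \<psi> s) * w)) * indicator {0..} w) \<partial>lborel)"
  proof (intro nn_integral_cong)
    fix w :: real
    have "(\<integral>\<^sup>+t. ennreal (exp (- s * t)) * indicator {0..} t *
        (ennreal (\<theta> * exp (- \<theta> * w)) * indicator {0..} w * (\<integral>\<^sup>+\<omega>. indicator {..t} (D_ext (w, \<omega>)) \<partial>M)) \<partial>lborel)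
      = ennreal (\<theta> * exp (- \<theta> * w)) * indicator {0..} w *
        (\<integral>\<^sup>+t. (\<integral>\<^sup>+\<omega>. ennreal (exp (- s * t)) * indicator {0..} t * indicator {..t} (D_ext (w, \<omega>)) \<partial>M) \<partial>lborel)"
      by (simp add: nn_integral_cmult[symmetric] ac_simps)
    also have "(\<integral>\<^sup>+t. (\<integral>\<^sup>+\<omega>. ennreal (exp (- s * t)) * indicator {0..} t * indicator {..t} (D_ext (w, \<omega>)) \<partial>M) \<partial>lborel)
      = (\<integral>\<^sup>+\<omega>. (\<integral>\<^sup>+t. ennreal (exp (- s * t)) * indicator {0..} t * indicator {..t} (D_ext (w, \<omega>)) \<partial>lborel) \<partial>M)"
      by (intro P.Fubini') measurable
    also have "\<dots> = (\<integral>\<^sup>+\<omega>. ennreal (exp (- s * D_ext (w, \<omega>)) / s) \<partial>M)"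
    proof (intro nn_integral_cong)
      fix \<omega> assume "\<omega> \<in> space M"
      then have "(\<integral>\<^sup>+t. ennreal (exp (- s * t)) * indicator {0..} t * indicator {..t} (D_ext (w, \<omega>)) \<partial>lborel)
        = (\<integral>\<^sup>+t. ennreal (exp (- s * t)) * indicator {D_ext (w, \<omega>)..} t \<partial>lborel)"
        using D_nonneg[of \<omega> w] by (intro nn_integral_cong) (auto split: split_indicator)
      then show "(\<integral>\<^sup>+t. ennreal (exp (- s * t)) * indicator {0..} t * indicator {..t} (D_ext (w, \<omega>)) \<partial>lborel)
        = ennreal (exp (- s * D_ext (w, \<omega>)) / s)" using nn_integral_exp_atLeast[OF s] by simp
    qed
    also have "\<dots> = (\<integral>\<^sup>+\<omega>. ennreal (1 / s) * ennreal (exp (- s * D_ext (w, \<omega>))) \<partial>M)"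
      using s by (simp add: ennreal_mult[symmetric])
    also have "\<dots> = ennreal (1 / s) * (\<integral>\<^sup>+\<omega>. ennreal (exp (- s * D_ext (w, \<omega>))) \<partial>M)"
      by (rule nn_integral_cmult) measurable
    finally have eq: "(\<integral>\<^sup>+t. ennreal (exp (- s * t)) * indicator {0..} t *
        (ennreal (\<theta> * exp (- \<theta> * w)) * indicator {0..} w * (\<integral>\<^sup>+\<omega>. indicator {..t} (D_ext (w, \<omega>)) \<partial>M)) \<partial>lborel)
      = ennreal (\<theta> * exp (- \<theta> * w)) * indicator {0..} w * (ennreal (1 / s) * (\<integral>\<^sup>+\<omega>. ennreal (exp (- s * D_ext (w, \<omega>))) \<partial>M))" .
    show "(\<integral>\<^sup>+t. ennreal (exp (- s * t)) * indicator {0..} t *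
        (ennreal (\<theta> * exp (- \<theta> * w)) * indicator {0..} w * (\<integral>\<^sup>+\<omega>. indicator {..t} (D_ext (w, \<omega>)) \<partial>M)) \<partial>lborel)
      = ennreal (\<theta> / s) * (ennreal (exp (- (\<theta> + \<psi> s) * w)) * indicator {0..} w)"
    proof (cases "w \<ge> 0")
      case True
      have "(\<integral>\<^sup>+\<omega>. ennreal (exp (- s * D_ext (w, \<omega>))) \<partial>M) = ennreal (exp (- w * \<psi> s))"
        using D_laplace[OF s True] by (simp add: D_ext_eq[OF True])
      then show ?thesis
        unfolding eq using True \<theta> s
        by (simp add: ennreal_mult[symmetric] mult_exp_exp algebra_simps)
    qed (simp add: eq)
  qed
  also have "\<dots> = ennreal (\<theta> / s) * ennreal (1 / (\<theta> + \<psi> s))"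
    using nn_integral_exp_atLeast[of "\<theta> + \<psi> s" 0] \<theta> \<psi>_pos[OF s] by (subst nn_integral_cmult) auto
  finally have 1: "(\<integral>\<^sup>+t. ennreal (exp (- s * t)) * indicator {0..} t * ennreal (1 - \<Phi> \<theta> t) \<partial>lborel)
    = ennreal (\<theta> / (s * (\<theta> + \<psi> s)))"
    using \<theta> s \<psi>_pos[OF s] by (simp add: ennreal_mult[symmetric])
  \<comment> \<open>The transforms of 1 - \<Phi> and \<Phi> add up to 1 / s. The former is finite,
    so it can be cancelled in [0, \<infinity>].\<close>
  have "(\<integral>\<^sup>+t. ennreal (exp (- s * t)) * indicator {0..} t * ennreal (1 - \<Phi> \<theta> t) \<partial>lborel) +
      (\<integral>\<^sup>+t. ennreal (exp (- s * t)) * indicator {0..} t * ennreal (\<Phi> \<theta> t) \<partial>lborel)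
    = (\<integral>\<^sup>+t. ennreal (exp (- s * t)) * indicator {0..} t \<partial>lborel)"
    using \<Phi>_bounds[OF \<theta>]
    by (subst nn_integral_add[symmetric]) (auto intro!: nn_integral_cong simp: ring_distribs[symmetric] ennreal_plus[symmetric] simp del: ennreal_plus)
  also have "\<dots> = ennreal (1 / s)" using nn_integral_exp_atLeast[OF s, of 0] by simp
  also have "1 / s = \<theta> / (s * (\<theta> + \<psi> s)) + \<psi> s / (s * (\<theta> + \<psi> s))"
    using \<theta> s \<psi>_pos[OF s] by (simp add: add_divide_distrib[symmetric])
  also have "ennreal \<dots> = ennreal (\<theta> / (s * (\<theta> + \<psi> s))) + ennreal (\<psi> s / (s * (\<theta> + \<psi> s)))"
    using \<theta> s \<psi>_pos[OF s] by (intro ennreal_plus) auto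
  finally have 2: "(\<integral>\<^sup>+t. ennreal (exp (- s * t)) * indicator {0..} t * ennreal (\<Phi> \<theta> t) \<partial>lborel)
    = ennreal (\<psi> s / (s * (\<theta> + \<psi> s)))"
    unfolding 1 by (simp add: ennreal_add_left_cancel)
  have "has_bochner_integral lborel (\<lambda>t. indicator {0<..} t *\<^sub>R (exp (- s * t) * \<Phi> \<theta> t)) (\<psi> s / (s * (\<theta> + \<psi> s)))"
  proof (rule has_bochner_integral_nn_integral)
    show "(\<integral>\<^sup>+t. ennreal (indicator {0<..} t *\<^sub>R (exp (- s * t) * \<Phi> \<theta> t)) \<partial>lborel) = ennreal (\<psi> s / (s * (\<theta> + \<psi> s)))"
      unfolding 2[symmetric]
    proof (rule nn_integral_cong_AE)
      have "AE t in lborel. (t::real) \<noteq> 0" by (rule AE_lborel_singleton)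
      then show "AE t in lborel. ennreal (indicator {0<..} t *\<^sub>R (exp (- s * t) * \<Phi> \<theta> t))
        = ennreal (exp (- s * t)) * indicator {0..} t * ennreal (\<Phi> \<theta> t)"
        by eventually_elim (use \<Phi>_bounds[OF \<theta>] in \<open>auto simp: ennreal_mult split: split_indicator\<close>)
    qed
  qed (use \<theta> s \<psi>_pos[OF s] \<Phi>_bounds[OF \<theta>] in auto)
  then show ?thesis
    unfolding has_laplace_transform_def set_integrable_def set_lebesgue_integral_def
    by (auto simp: has_bochner_integral_iff)
qed

section \<open>Markov property at fixed times and the increment formula\<close>

text \<open>Conditioning on D_v written as Fubini: the joint law of D_v and the increment is a
  product, and stationarity replaces the law of the increment by that of D_w. The variable \<eta>
  plays the role of an independent copy of the path.\<close>

lemma indep_increment_integral: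
  assumes v: "v \<ge> 0" and w: "w \<ge> 0"
  shows "(\<integral>\<^sup>+\<omega>. indicator {..s} (D v \<omega>) * indicator {..t} (D (v + w) \<omega>) \<partial>M)
    = (\<integral>\<^sup>+\<omega>. indicator {..s} (D v \<omega>) * (\<integral>\<^sup>+\<eta>. indicator {..t - D v \<omega>} (D w \<eta>) \<partial>M) \<partial>M)"
proof -
  note [measurable] = D_meas[OF v] D_meas[OF w] D_meas[of "v + w"]
  have vw: "v + w \<ge> 0" using v w by simp
  define f where "f = (\<lambda>(x, z). indicator {..s} x * indicator {..t} (x + z) :: ennreal)"
  have [measurable]: "f \<in> borel_measurable (borel \<Otimes>\<^sub>M borel)" unfolding f_def by measurable
  interpret W: prob_space "distr M borel (D w)" by (rule prob_space_distr) measurable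
  have "(\<integral>\<^sup>+\<omega>. indicator {..s} (D v \<omega>) * indicator {..t} (D (v + w) \<omega>) \<partial>M)
    = (\<integral>\<^sup>+\<omega>. f (D v \<omega>, D (v + w) \<omega> - D v \<omega>) \<partial>M)" by (simp add: f_def)
  also have "\<dots> = (\<integral>\<^sup>+p. f p \<partial>distr M (borel \<Otimes>\<^sub>M borel) (\<lambda>\<omega>. (D v \<omega>, D (v + w) \<omega> - D v \<omega>)))"
    using vw by (subst nn_integral_distr) measurable
  also have "distr M (borel \<Otimes>\<^sub>M borel) (\<lambda>\<omega>. (D v \<omega>, D (v + w) \<omega> - D v \<omega>)) =
    distr M borel (D v) \<Otimes>\<^sub>M distr M borel (\<lambda>\<omega>. D (v + w) \<omega> - D v \<omega>)"
    using D_indep[OF v w] unfolding indep_var_distribution_eq by simp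
  also have "\<dots> = distr M borel (D v) \<Otimes>\<^sub>M distr M borel (D w)" unfolding D_stat[OF v w] ..
  also have "(\<integral>\<^sup>+p. f p \<partial>(distr M borel (D v) \<Otimes>\<^sub>M distr M borel (D w)))
    = (\<integral>\<^sup>+x. (\<integral>\<^sup>+z. f (x, z) \<partial>distr M borel (D w)) \<partial>distr M borel (D v))"
    by (rule W.nn_integral_fst[symmetric]) simp
  also have "\<dots> = (\<integral>\<^sup>+\<omega>. (\<integral>\<^sup>+\<eta>. f (D v \<omega>, D w \<eta>) \<partial>M) \<partial>M)"
    by (subst nn_integral_distr; (subst nn_integral_distr)?) (auto intro!: W.borel_measurable_nn_integral)
  also have "\<dots> = (\<integral>\<^sup>+\<omega>. indicator {..s} (D v \<omega>) * (\<integral>\<^sup>+\<eta>. indicator {..t - D v \<omega>} (D w \<eta>) \<partial>M) \<partial>M)"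
  proof (intro nn_integral_cong)
    fix \<omega>
    have "f (D v \<omega>, D w \<eta>) = indicator {..s} (D v \<omega>) * indicator {..t - D v \<omega>} (D w \<eta>)" for \<eta>
      by (auto simp: f_def indicator_def)
    then show "(\<integral>\<^sup>+\<eta>. f (D v \<omega>, D w \<eta>) \<partial>M)
      = indicator {..s} (D v \<omega>) * (\<integral>\<^sup>+\<eta>. indicator {..t - D v \<omega>} (D w \<eta>) \<partial>M)"
      by (simp add: nn_integral_cmult)
  qed
  finally show ?thesis .
qed

text \<open>On D_v \<le> s \<le> t the passage time E_t is at least v, so the passage identity
  started at v applies. Its events D_{v+w} \<le> t are handled for each fixed w by
  \<open>indep_increment_integral\<close>, and integrating over w afterwards reassembles 1 - \<Phi>
  at the level t - D_v.\<close>

lemma markov_property: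
  assumes \<theta>: "\<theta> > 0" and v: "v \<ge> 0" and st: "s \<le> t"
  shows "(\<integral>\<^sup>+\<omega>. indicator {..s} (D v \<omega>) * ennreal (exp (- \<theta> * (E t \<omega> - v))) \<partial>M)
    = (\<integral>\<^sup>+\<omega>. indicator {..s} (D v \<omega>) * ennreal (\<Phi> \<theta> (t - D v \<omega>)) \<partial>M)"
proof -
  interpret P: pair_sigma_finite M lborel ..
  note [measurable] = D_meas[OF v]
  let ?A = "\<lambda>\<omega>. indicator {..s} (D v \<omega>) :: ennreal"
  let ?g = "\<lambda>w. ennreal (\<theta> * exp (- \<theta> * w)) * indicator {0..} w"
  have le: "v \<le> E t \<omega>" if "\<omega> \<in> space M" "D v \<omega> \<le> s" for \<omega>
    using D_le_imp_le_E[OF that(1) v] that(2) st by simp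
  have "(\<integral>\<^sup>+\<omega>. ?A \<omega> * ennreal (1 - exp (- \<theta> * (E t \<omega> - v))) \<partial>M)
    = (\<integral>\<^sup>+\<omega>. (\<integral>\<^sup>+w. ?A \<omega> * (?g w * indicator {..t} (D_ext (v + w, \<omega>))) \<partial>lborel) \<partial>M)"
  proof (intro nn_integral_cong)
    fix \<omega> assume \<omega>: "\<omega> \<in> space M"
    have "(\<integral>\<^sup>+w. ?A \<omega> * (?g w * indicator {..t} (D_ext (v + w, \<omega>))) \<partial>lborel)
      = ?A \<omega> * (\<integral>\<^sup>+w. ?g w * indicator {..t} (D_ext (v + w, \<omega>)) \<partial>lborel)"
      using \<omega> by (intro nn_integral_cmult) measurable
    also have "\<dots> = ?A \<omega> * ennreal (1 - exp (- \<theta> * (E t \<omega> - v)))"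
      using nn_integral_passage[OF \<omega> \<theta> v, of t] le[OF \<omega>] by (simp split: split_indicator)
    finally show "?A \<omega> * ennreal (1 - exp (- \<theta> * (E t \<omega> - v)))
      = (\<integral>\<^sup>+w. ?A \<omega> * (?g w * indicator {..t} (D_ext (v + w, \<omega>))) \<partial>lborel)" ..
  qed
  also have "\<dots> = (\<integral>\<^sup>+w. (\<integral>\<^sup>+\<omega>. ?A \<omega> * (?g w * indicator {..t} (D_ext (v + w, \<omega>))) \<partial>M) \<partial>lborel)"
    by (intro P.Fubini'[symmetric]) measurable
  also have "\<dots> = (\<integral>\<^sup>+w. (\<integral>\<^sup>+\<omega>. ?A \<omega> * (?g w * (\<integral>\<^sup>+\<eta>. indicator {..t - D v \<omega>} (D_ext (w, \<eta>)) \<partial>M)) \<partial>M) \<partial>lborel)"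
  proof (rule nn_integral_cong)
    fix w :: real
    show "(\<integral>\<^sup>+\<omega>. ?A \<omega> * (?g w * indicator {..t} (D_ext (v + w, \<omega>))) \<partial>M)
      = (\<integral>\<^sup>+\<omega>. ?A \<omega> * (?g w * (\<integral>\<^sup>+\<eta>. indicator {..t - D v \<omega>} (D_ext (w, \<eta>)) \<partial>M)) \<partial>M)"
    proof (cases "w \<ge> 0")
      case True
      note [measurable] = D_meas[OF True] D_meas[of "v + w"]
      have "(\<integral>\<^sup>+\<omega>. ?A \<omega> * (?g w * indicator {..t} (D_ext (v + w, \<omega>))) \<partial>M)
        = (\<integral>\<^sup>+\<omega>. ?g w * (?A \<omega> * indicator {..t} (D (v + w) \<omega>)) \<partial>M)"
        using v True by (intro nn_integral_cong) (simp add: D_ext_eq ac_simps)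
      also have "\<dots> = ?g w * (\<integral>\<^sup>+\<omega>. ?A \<omega> * indicator {..t} (D (v + w) \<omega>) \<partial>M)"
        using v True by (intro nn_integral_cmult) simp
      also have "\<dots> = ?g w * (\<integral>\<^sup>+\<omega>. ?A \<omega> * (\<integral>\<^sup>+\<eta>. indicator {..t - D v \<omega>} (D w \<eta>) \<partial>M) \<partial>M)"
        by (simp only: indep_increment_integral[OF v True])
      also have "\<dots> = (\<integral>\<^sup>+\<omega>. ?g w * (?A \<omega> * (\<integral>\<^sup>+\<eta>. indicator {..t - D v \<omega>} (D w \<eta>) \<partial>M)) \<partial>M)"
        by (intro nn_integral_cmult[symmetric]) measurable
      finally show ?thesis using True by (simp add: D_ext_eq ac_simps)
    qed (simp add: indicator_def)
  qed
  also have "\<dots> = (\<integral>\<^sup>+\<omega>. (\<integral>\<^sup>+w. ?A \<omega> * (?g w * (\<integral>\<^sup>+\<eta>. indicator {..t - D v \<omega>} (D_ext (w, \<eta>)) \<partial>M)) \<partial>lborel) \<partial>M)"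
    by (intro P.Fubini') measurable
  also have "\<dots> = (\<integral>\<^sup>+\<omega>. ?A \<omega> * ennreal (1 - \<Phi> \<theta> (t - D v \<omega>)) \<partial>M)"
    unfolding one_minus_\<Phi>[OF \<theta>] by (intro nn_integral_cong nn_integral_cmult) measurable
  finally have 1: "(\<integral>\<^sup>+\<omega>. ?A \<omega> * ennreal (1 - exp (- \<theta> * (E t \<omega> - v))) \<partial>M)
    = (\<integral>\<^sup>+\<omega>. ?A \<omega> * ennreal (1 - \<Phi> \<theta> (t - D v \<omega>)) \<partial>M)" .
  \<comment> \<open>Passage from the complements back to the functions themselves: on both sides the
    two parts add up to the probability of D_v \<le> s, which is finite, so the equal complements
    cancel.\<close>
  have split: "(\<integral>\<^sup>+\<omega>. ?A \<omega> * ennreal (1 - F \<omega>) \<partial>M) + (\<integral>\<^sup>+\<omega>. ?A \<omega> * ennreal (F \<omega>) \<partial>M) = (\<integral>\<^sup>+\<omega>. ?A \<omega> \<partial>M)"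
    if [measurable]: "F \<in> borel_measurable M" and F: "\<And>\<omega>. \<omega> \<in> space M \<Longrightarrow> D v \<omega> \<le> s \<Longrightarrow> 0 \<le> F \<omega> \<and> F \<omega> \<le> 1" for F
    using F by (subst nn_integral_add[symmetric])
      (auto intro!: nn_integral_cong simp: ennreal_plus[symmetric] simp del: ennreal_plus split: split_indicator)
  have fin: "(\<integral>\<^sup>+\<omega>. ?A \<omega> \<partial>M) \<noteq> \<infinity>"
  proof -
    have "(\<integral>\<^sup>+\<omega>. ?A \<omega> \<partial>M) \<le> (\<integral>\<^sup>+\<omega>. 1 \<partial>M)" by (intro nn_integral_mono) (auto split: split_indicator)
    then show ?thesis by (auto simp: emeasure_space_1 top_unique)
  qed
  have s1: "(\<integral>\<^sup>+\<omega>. ?A \<omega> * ennreal (1 - exp (- \<theta> * (E t \<omega> - v))) \<partial>M)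
      + (\<integral>\<^sup>+\<omega>. ?A \<omega> * ennreal (exp (- \<theta> * (E t \<omega> - v))) \<partial>M) = (\<integral>\<^sup>+\<omega>. ?A \<omega> \<partial>M)"
    by (rule split) (use le \<theta> in auto)
  have s2: "(\<integral>\<^sup>+\<omega>. ?A \<omega> * ennreal (1 - \<Phi> \<theta> (t - D v \<omega>)) \<partial>M)
      + (\<integral>\<^sup>+\<omega>. ?A \<omega> * ennreal (\<Phi> \<theta> (t - D v \<omega>)) \<partial>M) = (\<integral>\<^sup>+\<omega>. ?A \<omega> \<partial>M)"
    by (rule split) (use \<Phi>_bounds[OF \<theta>] in auto)
  have fin': "(\<integral>\<^sup>+\<omega>. ?A \<omega> * ennreal (1 - \<Phi> \<theta> (t - D v \<omega>)) \<partial>M) \<noteq> \<infinity>"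
  proof
    assume "(\<integral>\<^sup>+\<omega>. ?A \<omega> * ennreal (1 - \<Phi> \<theta> (t - D v \<omega>)) \<partial>M) = \<infinity>"
    then show False using fin unfolding s2[symmetric] by simp
  qed
  show ?thesis
    by (rule ennreal_add_left_cancel[THEN iffD1, OF trans[OF s1[unfolded 1] s2[symmetric]], THEN disjE])
      (use fin' in simp_all)
qed

lemma exp_increment_E:
  assumes \<theta>: "\<theta> > 0" and st: "s \<le> t"
  shows "(\<integral>\<^sup>+\<omega>. ennreal (exp (- \<theta> * (E t \<omega> - E s \<omega>))) \<partial>M)
    = ennreal \<theta> * (\<integral>\<^sup>+y. indicator {..s} y * ennreal (\<Phi> \<theta> (t - y)) \<partial>potential) + ennreal (\<Phi> \<theta> t)"
proof -
  interpret P: pair_sigma_finite M lborel ..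
  let ?B = "\<lambda>v \<omega>. indicator {..s} (D_ext (v, \<omega>)) :: ennreal"
  have *: "(\<integral>\<^sup>+v. indicator {0..} v * (ennreal \<theta> * (?B v \<omega> * ennreal (exp (- \<theta> * (E t \<omega> - v))))) \<partial>lborel)
      + ennreal (exp (- \<theta> * E t \<omega>)) = ennreal (exp (- \<theta> * (E t \<omega> - E s \<omega>)))" if \<omega>: "\<omega> \<in> space M" for \<omega>
  proof -
    have "(\<integral>\<^sup>+v. indicator {0..} v * (ennreal \<theta> * (?B v \<omega> * ennreal (exp (- \<theta> * (E t \<omega> - v))))) \<partial>lborel)
      = (\<integral>\<^sup>+v. ennreal (\<theta> * exp (- \<theta> * (E t \<omega> - v))) * indicator {0..E s \<omega>} v \<partial>lborel)"
    proof (rule nn_integral_cong_AE)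
      have "AE v in lborel. v \<noteq> E s \<omega>" by (rule AE_lborel_singleton)
      then show "AE v in lborel. indicator {0..} v * (ennreal \<theta> * (?B v \<omega> * ennreal (exp (- \<theta> * (E t \<omega> - v)))))
        = ennreal (\<theta> * exp (- \<theta> * (E t \<omega> - v))) * indicator {0..E s \<omega>} v"
      proof eventually_elim
        case (elim v)
        show ?case
        proof (cases "v \<ge> 0")
          case True
          then have "D v \<omega> \<le> s \<longleftrightarrow> v \<le> E s \<omega>"
            using D_le_imp_le_E[OF \<omega>, of v s] less_E_imp_D_le[of v s \<omega>] elim by fastforce
          then show ?thesis using True \<theta> by (auto simp: D_ext_eq indicator_def ennreal_mult)
        qed (auto simp: indicator_def)
      qed
    qed
    also have "\<dots> = ennreal (exp (- \<theta> * (E t \<omega> - E s \<omega>)) - exp (- \<theta> * (E t \<omega> - 0)))"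
      using \<theta> by (intro nn_integral_FTC_Icc) (auto intro!: derivative_eq_intros simp: inverse_subordinator_nonneg)
    finally show ?thesis
      using \<theta> by (simp add: ennreal_plus[symmetric] inverse_subordinator_nonneg del: ennreal_plus)
  qed
  have "(\<integral>\<^sup>+\<omega>. ennreal (exp (- \<theta> * (E t \<omega> - E s \<omega>))) \<partial>M)
    = (\<integral>\<^sup>+\<omega>. (\<integral>\<^sup>+v. indicator {0..} v * (ennreal \<theta> * (?B v \<omega> * ennreal (exp (- \<theta> * (E t \<omega> - v))))) \<partial>lborel)
      + ennreal (exp (- \<theta> * E t \<omega>)) \<partial>M)"
    by (intro nn_integral_cong *[symmetric])
  also have "\<dots> = (\<integral>\<^sup>+\<omega>. (\<integral>\<^sup>+v. indicator {0..} v * (ennreal \<theta> * (?B v \<omega> * ennreal (exp (- \<theta> * (E t \<omega> - v))))) \<partial>lborel) \<partial>M)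
      + ennreal (\<Phi> \<theta> t)"
    unfolding \<Phi>_nn[OF \<theta>] by (rule nn_integral_add) measurable
  also have "(\<integral>\<^sup>+\<omega>. (\<integral>\<^sup>+v. indicator {0..} v * (ennreal \<theta> * (?B v \<omega> * ennreal (exp (- \<theta> * (E t \<omega> - v))))) \<partial>lborel) \<partial>M)
    = (\<integral>\<^sup>+v. (\<integral>\<^sup>+\<omega>. indicator {0..} v * (ennreal \<theta> * (?B v \<omega> * ennreal (exp (- \<theta> * (E t \<omega> - v))))) \<partial>M) \<partial>lborel)"
    by (intro P.Fubini'[symmetric]) measurable
  \<comment> \<open>After the Markov property the integrand depends on the sample point only through
    D_v. This is what allows the integral over v and the expectation to be merged into one integral
    against \<open>potential\<close>.\<close>
  also have "\<dots> = (\<integral>\<^sup>+v. ennreal \<theta> * (indicator {0..} v * (\<integral>\<^sup>+\<omega>. ?B v \<omega> * ennreal (\<Phi> \<theta> (t - D_ext (v, \<omega>))) \<partial>M)) \<partial>lborel)"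
  proof (intro nn_integral_cong)
    fix v :: real
    show "(\<integral>\<^sup>+\<omega>. indicator {0..} v * (ennreal \<theta> * (?B v \<omega> * ennreal (exp (- \<theta> * (E t \<omega> - v))))) \<partial>M)
      = ennreal \<theta> * (indicator {0..} v * (\<integral>\<^sup>+\<omega>. ?B v \<omega> * ennreal (\<Phi> \<theta> (t - D_ext (v, \<omega>))) \<partial>M))"
    proof (cases "v \<ge> 0")
      case True
      note [measurable] = D_meas[OF True]
      show ?thesis
        using True markov_property[OF \<theta> True st] by (simp add: D_ext_eq nn_integral_cmult)
    qed (simp add: indicator_def)
  qed
  also have "\<dots> = ennreal \<theta> * (\<integral>\<^sup>+v. indicator {0..} v * (\<integral>\<^sup>+\<omega>. ?B v \<omega> * ennreal (\<Phi> \<theta> (t - D_ext (v, \<omega>))) \<partial>M) \<partial>lborel)"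
    by (rule nn_integral_cmult) measurable
  also have "(\<integral>\<^sup>+v. indicator {0..} v * (\<integral>\<^sup>+\<omega>. ?B v \<omega> * ennreal (\<Phi> \<theta> (t - D_ext (v, \<omega>))) \<partial>M) \<partial>lborel)
    = (\<integral>\<^sup>+y. indicator {..s} y * ennreal (\<Phi> \<theta> (t - y)) \<partial>potential)"
    by (rule nn_integral_potential[symmetric]) measurable
  finally show ?thesis .
qed

end

section \<open>Regularisation of a subordinator\<close>

text \<open>Independence says that the joint law is the product of the marginal laws, and laws do
  not see null sets.\<close>

lemma (in prob_space) indep_var_cong_AE:
  assumes ind: "indep_var S X T Y"
    and [measurable]: "X' \<in> measurable M S" "Y' \<in> measurable M T"
    and X: "AE \<omega> in M. X \<omega> = X' \<omega>" and Y: "AE \<omega> in M. Y \<omega> = Y' \<omega>"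
  shows "indep_var S X' T Y'"
proof -
  have [measurable]: "X \<in> measurable M S" "Y \<in> measurable M T"
    using ind by (blast dest: indep_var_rv1 indep_var_rv2)+
  have "distr M S X = distr M S X'" "distr M T Y = distr M T Y'"
    using X Y by (auto intro!: distr_cong_AE)
  moreover have "distr M (S \<Otimes>\<^sub>M T) (\<lambda>\<omega>. (X \<omega>, Y \<omega>)) = distr M (S \<Otimes>\<^sub>M T) (\<lambda>\<omega>. (X' \<omega>, Y' \<omega>))"
  proof (rule distr_cong_AE)
    show "AE \<omega> in M. (X \<omega>, Y \<omega>) = (X' \<omega>, Y' \<omega>)" using X Y by eventually_elim simp
  qed measurable
  ultimately show ?thesis using ind by (simp add: indep_var_distribution_eq)
qed

lemma (in prob_space) laplace_exponent_nn:
  assumes D: "has_laplace_exponent M D \<psi>" and [measurable]: "D t \<in> borel_measurable M"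
    and "s > 0" "t \<ge> 0"
  shows "(\<integral>\<^sup>+\<omega>. ennreal (exp (- s * D t \<omega>)) \<partial>M) = ennreal (exp (- t * \<psi> s))"
proof -
  have eq: "(LINT \<omega>|M. exp (- s * D t \<omega>)) = exp (- t * \<psi> s)"
    using D assms by (simp add: has_laplace_exponent_def)
  \<comment> \<open>The Bochner integral of a non-integrable function is 0 by convention. The value
    here is an exponential, hence nonzero, so the function is integrable.\<close>
  then have "integrable M (\<lambda>\<omega>. exp (- s * D t \<omega>))"
    by (metis exp_not_eq_zero not_integrable_integral_eq)
  then show ?thesis by (subst nn_integral_eq_integral) (auto simp: eq[simplified])
qed

text \<open>If D stays below C at all integer times on an event A, then exp(-C) P(A) is at most the
  expectation of exp(-D_k), which is exp(-\<psi>(1))^k and tends to 0. Countably many integer bounds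
  C suffice.\<close>

lemma (in prob_space) subordinator_unbounded:
  assumes D: "has_laplace_exponent M D \<psi>" and D_meas: "\<And>t. t \<ge> 0 \<Longrightarrow> D t \<in> borel_measurable M"
    and pos: "\<psi> 1 > 0"
  shows "AE \<omega> in M. \<forall>C. \<exists>\<tau>\<ge>0. D \<tau> \<omega> > C"
proof -
  note [measurable] = D_meas[OF of_nat_0_le_iff]
  have "AE \<omega> in M. \<exists>k. D (real k) \<omega> > real C" for C :: nat
  proof -
    define A where "A = {\<omega>\<in>space M. \<forall>k. D (real k) \<omega> \<le> real C}"
    have [measurable]: "A \<in> sets M" unfolding A_def by measurable
    have le: "exp (- real C) * prob A \<le> exp (- \<psi> 1) ^ k" for k
    proof -
      have "ennreal (exp (- real C) * prob A) = (\<integral>\<^sup>+\<omega>. ennreal (exp (- real C)) * indicator A \<omega> \<partial>M)"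
        by (simp add: nn_integral_cmult_indicator emeasure_eq_measure ennreal_mult)
      also have "\<dots> \<le> (\<integral>\<^sup>+\<omega>. ennreal (exp (- 1 * D (real k) \<omega>)) \<partial>M)"
        by (intro nn_integral_mono) (auto simp: A_def split: split_indicator)
      also have "\<dots> = ennreal (exp (- \<psi> 1) ^ k)"
        by (subst laplace_exponent_nn[OF D]) (auto simp: exp_of_nat_mult[symmetric])
      finally show ?thesis by simp
    qed
    have "(\<lambda>k. exp (- \<psi> 1) ^ k) \<longlonglongrightarrow> 0" using pos by (intro LIMSEQ_realpow_zero) auto
    then have "exp (- real C) * prob A \<le> 0" by (rule LIMSEQ_le_const) (use le in auto)
    then have "prob A = 0" using measure_nonneg[of M A] by (simp add: mult_le_0_iff)
    then have "A \<in> null_sets M" by (auto simp: null_sets_def emeasure_eq_measure)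
    then show ?thesis by (rule AE_I') (auto simp: A_def not_less)
  qed
  then have "AE \<omega> in M. \<forall>C::nat. \<exists>k. D (real k) \<omega> > real C" by (simp add: AE_all_countable)
  then show ?thesis
  proof eventually_elim
    case (elim \<omega>)
    show ?case
    proof
      fix C :: real
      obtain n :: nat where "C < real n" using reals_Archimedean2 by blast
      moreover obtain k where "D (real k) \<omega> > real n" using elim by blast
      ultimately show "\<exists>\<tau>\<ge>0. D \<tau> \<omega> > C" by (intro exI[of _ "real k"]) auto
    qed
  qed
qed

lemma (in prob_space) subordinator_indep_increment:
  assumes sub: "subordinator M D" and v: "v \<ge> 0" and w: "w \<ge> 0"
  shows "indep_var borel (D v) borel (\<lambda>\<omega>. D (v + w) \<omega> - D v \<omega>)"
proof -
  have m [measurable]: "D t \<in> borel_measurable M" if "t \<ge> 0" for t using sub that by (simp add: subordinator_def)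
  have [measurable]: "D v \<in> borel_measurable M" "D (v + w) \<in> borel_measurable M" using v w by (auto intro: m)
  \<comment> \<open>The partition 0, v, v + w, constant from then on. Its first increment is D_v -
    D_0, which equals D_v only almost surely.\<close>
  define \<tau> :: "nat \<Rightarrow> real" where "\<tau> i = (if i = 0 then 0 else if i = 1 then v else v + w)" for i
  have "0 \<le> \<tau> 0 \<and> mono \<tau>" using v w by (auto simp: \<tau>_def mono_def)
  then have "indep_vars (\<lambda>_. borel) (\<lambda>i \<omega>. D (\<tau> (Suc i)) \<omega> - D (\<tau> i) \<omega>) {..<2::nat}"
    using sub unfolding subordinator_def by blast
  from indep_var_compose[OF indep_var_restrict[OF this, of "{0}" "{1}"], of "\<lambda>f. f 0" borel "\<lambda>f. f 1" borel]
  have ind: "indep_var borel (\<lambda>\<omega>. D v \<omega> - D 0 \<omega>) borel (\<lambda>\<omega>. D (v + w) \<omega> - D v \<omega>)"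
    by (simp add: \<tau>_def comp_def)
  have ae: "AE \<omega> in M. D v \<omega> - D 0 \<omega> = D v \<omega>"
    using sub unfolding subordinator_def by (auto elim!: eventually_mono)
  show ?thesis
    by (rule indep_var_cong_AE[OF ind _ _ ae AE_I2[OF refl]]) measurable
qed

text \<open>The set of bad paths need not be measurable; it is enclosed in a measurable null set
  \<open>N\<close>, and the paths are changed on all of \<open>N\<close>. Outside \<open>N\<close>
  the paths coincide, so the inverses agree for all levels t simultaneously.\<close>

lemma (in prob_space) regular_version:
  assumes sub: "subordinator M D" and lap: "has_laplace_exponent M D \<psi>"
    and pos: "\<And>s. s > 0 \<Longrightarrow> \<psi> s > 0"
  obtains D' where "regular_subordinator M D' \<psi>"
    "AE \<omega> in M. \<forall>t. inverse_subordinator D t \<omega> = inverse_subordinator D' t \<omega>"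
proof -
  have m: "D t \<in> borel_measurable M" if "t \<ge> 0" for t using sub that by (simp add: subordinator_def)
  have "AE \<omega> in M. D 0 \<omega> = 0 \<and> mono_on {0..} (\<lambda>t. D t \<omega>) \<and>
      (\<forall>t\<ge>0. ((\<lambda>u. D u \<omega>) \<longlongrightarrow> D t \<omega>) (at_right t))"
    using sub by (simp add: subordinator_def)
  moreover have "AE \<omega> in M. \<forall>C. \<exists>\<tau>\<ge>0. D \<tau> \<omega> > C"
    by (rule subordinator_unbounded[OF lap m pos]) auto
  ultimately have "AE \<omega> in M. (D 0 \<omega> = 0 \<and> mono_on {0..} (\<lambda>t. D t \<omega>) \<and>
      (\<forall>t\<ge>0. ((\<lambda>u. D u \<omega>) \<longlongrightarrow> D t \<omega>) (at_right t))) \<and> (\<forall>C. \<exists>\<tau>\<ge>0. D \<tau> \<omega> > C)"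
    (is "AE \<omega> in M. ?P \<omega>") by eventually_elim simp
  then obtain N where N: "{\<omega> \<in> space M. \<not> ?P \<omega>} \<subseteq> N" "emeasure M N = 0" and N_sets [measurable]: "N \<in> sets M"
    by (rule AE_E)
  have P: "?P \<omega>" if "\<omega> \<in> space M" "\<omega> \<notin> N" for \<omega> using N(1) that by blast
  \<comment> \<open>The path t \<mapsto> t starts at 0 and is monotone, continuous and unbounded,
    hence a legitimate replacement.\<close>
  define D' where "D' t \<omega> = (if \<omega> \<in> N then t else D t \<omega>)" for t \<omega>
  have aeN: "AE \<omega> in M. \<omega> \<notin> N" using N by (intro AE_not_in) (auto simp: null_sets_def)
  have ae: "AE \<omega> in M. D t \<omega> = D' t \<omega>" for t using aeN by eventually_elim (simp add: D'_def)
  have m' [measurable]: "D' t \<in> borel_measurable M" if "t \<ge> 0" for t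
    unfolding D'_def using m[OF that] by measurable
  have ae2: "AE \<omega> in M. D t \<omega> - D s \<omega> = D' t \<omega> - D' s \<omega>" for t s
    using ae[of t] ae[of s] by eventually_elim simp
  have "regular_subordinator M D' \<psi>"
  proof
    fix \<omega> assume \<omega>: "\<omega> \<in> space M"
    show "D' 0 \<omega> = 0" using P[OF \<omega>] by (auto simp: D'_def)
    show "mono_on {0..} (\<lambda>t. D' t \<omega>)"
      using P[OF \<omega>] by (cases "\<omega> \<in> N") (auto simp: D'_def mono_on_def)
    show "((\<lambda>u. D' u \<omega>) \<longlongrightarrow> D' t \<omega>) (at_right t)" if "t \<ge> 0" for t
      using P[OF \<omega>] that by (cases "\<omega> \<in> N") (auto simp: D'_def)
    show "\<exists>\<tau>\<ge>0. D' \<tau> \<omega> > C" for C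
      using P[OF \<omega>] by (cases "\<omega> \<in> N") (auto simp: D'_def intro: exI[of _ "\<bar>C\<bar> + 1"])
  next
    fix t :: real assume t: "t \<ge> 0"
    show "D' t \<in> borel_measurable M" using t by (rule m')
    fix s :: real assume s: "s > 0"
    have "(\<integral>\<^sup>+\<omega>. ennreal (exp (- s * D' t \<omega>)) \<partial>M) = (\<integral>\<^sup>+\<omega>. ennreal (exp (- s * D t \<omega>)) \<partial>M)"
    proof (rule nn_integral_cong_AE)
      show "AE \<omega> in M. ennreal (exp (- s * D' t \<omega>)) = ennreal (exp (- s * D t \<omega>))"
        using ae[of t] by eventually_elim simp
    qed
    then show "(\<integral>\<^sup>+\<omega>. ennreal (exp (- s * D' t \<omega>)) \<partial>M) = ennreal (exp (- t * \<psi> s))"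
      using laplace_exponent_nn[OF lap m[OF t] s t] by simp
  next
    fix v w :: real assume v: "v \<ge> 0" and w: "w \<ge> 0"
    then have vw: "v + w \<ge> 0" by simp
    note [measurable] = m[OF v] m[OF w] m[OF vw] m'[OF v] m'[OF w] m'[OF vw]
    show "indep_var borel (D' v) borel (\<lambda>\<omega>. D' (v + w) \<omega> - D' v \<omega>)"
      by (rule indep_var_cong_AE[OF subordinator_indep_increment[OF sub v w]]) (auto intro: ae ae2)
    have "distr M borel (\<lambda>\<omega>. D (v + w) \<omega> - D v \<omega>) = distr M borel (\<lambda>\<omega>. D' (v + w) \<omega> - D' v \<omega>)"
      by (intro distr_cong_AE ae2) auto
    moreover have "distr M borel (D w) = distr M borel (D' w)"
      by (intro distr_cong_AE ae) auto
    moreover have "distr M borel (\<lambda>\<omega>. D (v + w) \<omega> - D v \<omega>) = distr M borel (D w)"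
      using sub v w by (simp add: subordinator_def)
    ultimately show "distr M borel (\<lambda>\<omega>. D' (v + w) \<omega> - D' v \<omega>) = distr M borel (D' w)" by simp
  qed (rule pos)
  moreover have "AE \<omega> in M. \<forall>t. inverse_subordinator D t \<omega> = inverse_subordinator D' t \<omega>"
    using aeN
  proof eventually_elim
    case (elim \<omega>)
    then have eq: "D' \<tau> \<omega> = D \<tau> \<omega>" for \<tau> by (simp add: D'_def)
    show ?case unfolding inverse_subordinator_def eq by simp
  qed
  ultimately show thesis by (rule that)
qed

section \<open>Independent time change\<close>

text \<open>Independence of whole paths allows the random times to be frozen: under the product law
  the sample point driving X and the one driving E are decoupled, and Tonelli integrates over the
  former first.\<close>

lemma indep_processes_nn_integral:
  fixes X E :: "real \<Rightarrow> 'a \<Rightarrow> real"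
  assumes M: "prob_space M" and ind: "indep_processes M X E"
    and cont: "\<And>\<omega>. \<omega> \<in> space M \<Longrightarrow> continuous_on {0..} (\<lambda>t. X t \<omega>)"
    and E: "\<And>t \<omega>. E t \<omega> \<ge> 0" and TS: "T \<ge> 0" "S \<ge> 0"
    and \<phi> [measurable]: "\<phi> \<in> borel_measurable (borel \<Otimes>\<^sub>M borel)"
  shows "(\<integral>\<^sup>+\<omega>. \<phi> (X (E T \<omega>) \<omega>, X (E S \<omega>) \<omega>) \<partial>M)
      = (\<integral>\<^sup>+\<eta>. (\<integral>\<^sup>+\<omega>. \<phi> (X (E T \<eta>) \<omega>, X (E S \<eta>) \<omega>) \<partial>M) \<partial>M)" (is ?int)
    and "time_change X E T \<in> borel_measurable M" (is ?meas)
proof -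
  interpret prob_space M by fact
  define Pi where "Pi = PiM {0::real..} (\<lambda>_. borel :: real measure)"
  define path where "path Z \<omega> = (\<lambda>t\<in>{0..}. Z t \<omega>)" for Z :: "real \<Rightarrow> 'a \<Rightarrow> real" and \<omega>
  \<comment> \<open>Evaluation of a path at a time is not jointly measurable on the product space of
    all functions. The sigma-algebra generated by the path is therefore placed on the sample space
    itself, every point of which has a continuous path of X. The diagonal map into
    \<open>G X\<close> times \<open>G E\<close> then has a product law.\<close>
  define G where "G Z = vimage_algebra (space M) (path Z) Pi" for Z
  have ind': "indep_var Pi (path X) Pi (path E)"
    using ind unfolding indep_processes_def Pi_def path_def .
  then have pX: "path X \<in> measurable M Pi" and pE: "path E \<in> measurable M Pi"
    by (blast dest: indep_var_rv1 indep_var_rv2)+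
  have space_G [simp]: "space (G Z) = space M" for Z by (simp add: G_def)
  have comp: "Z t \<in> borel_measurable (G Z)" if "t \<ge> 0" "path Z \<in> measurable M Pi" for Z t
  proof -
    have "(\<lambda>\<omega>. path Z \<omega> t) \<in> borel_measurable (G Z)"
      unfolding G_def
      by (rule measurable_compose[OF measurable_vimage_algebra1])
        (use that in \<open>auto simp: Pi_def dest: measurable_space\<close>)
    then show ?thesis using that by (simp add: path_def)
  qed
  have ident: "(\<lambda>\<omega>. \<omega>) \<in> measurable M (G Z)" if "path Z \<in> measurable M Pi" for Z
    unfolding G_def by (rule measurable_vimage_algebra2) (use that in auto)
  have preimages: "{(\<lambda>\<omega>. \<omega>) -` A \<inter> space M | A. A \<in> sets (G Z)} = {path Z -` A \<inter> space M | A. A \<in> sets Pi}"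
    if "path Z \<in> measurable M Pi" for Z
  proof -
    have "sets (G Z) = {path Z -` A \<inter> space M | A. A \<in> sets Pi}"
      unfolding G_def by (rule sets_vimage_algebra2) (use that in \<open>auto dest: measurable_space\<close>)
    then show ?thesis by (auto simp: vimage_def)
  qed
  have "indep_var (G X) (\<lambda>\<omega>. \<omega>) (G E) (\<lambda>\<omega>. \<omega>)"
    using ind' unfolding indep_var_eq preimages[OF pX] preimages[OF pE] by (simp add: ident pX pE)
  then have prod: "distr M (G X) (\<lambda>\<omega>. \<omega>) \<Otimes>\<^sub>M distr M (G E) (\<lambda>\<omega>. \<omega>)
      = distr M (G X \<Otimes>\<^sub>M G E) (\<lambda>\<omega>. (\<omega>, \<omega>))" and
    [measurable]: "(\<lambda>\<omega>. \<omega>) \<in> measurable M (G X)" "(\<lambda>\<omega>. \<omega>) \<in> measurable M (G E)"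
    unfolding indep_var_distribution_eq by auto
  have [measurable]: "E T \<in> borel_measurable (G E)" "E S \<in> borel_measurable (G E)"
    using TS pE by (auto intro: comp)
  have J [measurable]: "(\<lambda>(t, \<omega>). X (max 0 t) \<omega>) \<in> borel_measurable (borel \<Otimes>\<^sub>M G X)"
  proof (rule joint_measurable_right_continuous)
    show "X t \<in> borel_measurable (G X)" if "t \<ge> 0" for t using comp[OF that pX] .
    fix \<omega> and t :: real assume "\<omega> \<in> space (G X)" "t \<ge> 0"
    then have "((\<lambda>u. X u \<omega>) \<longlongrightarrow> X t \<omega>) (at t within {0..})"
      using cont[of \<omega>] by (auto simp: continuous_on)
    then show "((\<lambda>u. X u \<omega>) \<longlongrightarrow> X t \<omega>) (at_right t)"
      by (rule tendsto_within_subset) (use \<open>t \<ge> 0\<close> in auto)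
  qed
  have XE: "(\<lambda>p. X (E t (snd p)) (fst p)) \<in> borel_measurable (G X \<Otimes>\<^sub>M G E)" if "t \<in> {T, S}" for t
  proof -
    have [measurable]: "E t \<in> borel_measurable (G E)" using that TS pE by (auto intro: comp)
    have "(\<lambda>p. (\<lambda>(t, \<omega>). X (max 0 t) \<omega>) (E t (snd p), fst p)) \<in> borel_measurable (G X \<Otimes>\<^sub>M G E)"
      by measurable
    then show ?thesis using E by simp
  qed
  define h where "h p = \<phi> (X (E T (snd p)) (fst p), X (E S (snd p)) (fst p))" for p
  have h [measurable]: "h \<in> borel_measurable (G X \<Otimes>\<^sub>M G E)"
    using XE[of T] XE[of S] unfolding h_def by measurable
  interpret P: pair_sigma_finite "distr M (G X) (\<lambda>\<omega>. \<omega>)" "distr M (G E) (\<lambda>\<omega>. \<omega>)"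
    by (intro pair_sigma_finite.intro prob_space_imp_sigma_finite prob_space_distr) measurable
  have "(\<integral>\<^sup>+\<omega>. \<phi> (X (E T \<omega>) \<omega>, X (E S \<omega>) \<omega>) \<partial>M) = (\<integral>\<^sup>+p. h p \<partial>distr M (G X \<Otimes>\<^sub>M G E) (\<lambda>\<omega>. (\<omega>, \<omega>)))"
    by (subst nn_integral_distr) (auto simp: h_def)
  also have "\<dots> = (\<integral>\<^sup>+\<eta>. (\<integral>\<^sup>+\<omega>. h (\<omega>, \<eta>) \<partial>distr M (G X) (\<lambda>\<omega>. \<omega>)) \<partial>distr M (G E) (\<lambda>\<omega>. \<omega>))"
    unfolding prod[symmetric] by (rule P.nn_integral_snd[symmetric]) measurable
  also have "\<dots> = (\<integral>\<^sup>+\<eta>. (\<integral>\<^sup>+\<omega>. h (\<omega>, \<eta>) \<partial>distr M (G X) (\<lambda>\<omega>. \<omega>)) \<partial>M)"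
    by (subst nn_integral_distr) measurable
  also have "\<dots> = (\<integral>\<^sup>+\<eta>. (\<integral>\<^sup>+\<omega>. h (\<omega>, \<eta>) \<partial>M) \<partial>M)"
    by (intro nn_integral_cong nn_integral_distr) (auto intro!: measurable_compose[OF measurable_Pair2' h])
  finally show ?int by (simp add: h_def)
  have "(\<lambda>\<omega>. X (E T (snd (\<omega>, \<omega>))) (fst (\<omega>, \<omega>))) \<in> borel_measurable M"
    by (rule measurable_compose[OF _ XE]) auto
  then show ?meas by (simp add: time_change_def[abs_def])
qed

lemma integrable_mult_of_squares:
  fixes f g :: "'a \<Rightarrow> real"
  assumes [measurable]: "f \<in> borel_measurable N" "g \<in> borel_measurable N"
    and "integrable N (\<lambda>x. (f x)\<^sup>2)" "integrable N (\<lambda>x. (g x)\<^sup>2)"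
  shows "integrable N (\<lambda>x. f x * g x)"
proof (rule Bochner_Integration.integrable_bound[OF Bochner_Integration.integrable_add[OF assms(3,4)]])
  show "AE x in N. norm (f x * g x) \<le> norm ((f x)\<^sup>2 + (g x)\<^sup>2)"
  proof (rule AE_I2)
    fix x
    have "2 * \<bar>f x * g x\<bar> \<le> (f x)\<^sup>2 + (g x)\<^sup>2"
      using sum_squares_bound[of "\<bar>f x\<bar>" "\<bar>g x\<bar>"] by (simp add: abs_mult)
    then show "norm (f x * g x) \<le> norm ((f x)\<^sup>2 + (g x)\<^sup>2)" by simp
  qed
qed measurable

text \<open>
  Only squares are transferred through the independence formula, so that Tonelli suffices: the mean,
  the variance and the covariance are recovered from the second moments of \<open>Y - \<mu>\<close>, \<open>Y - \<mu> + 1\<close> and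
  \<open>Y - Y'\<close>.
\<close>

lemma corr_time_change:
  fixes X E :: "real \<Rightarrow> 'a \<Rightarrow> real"
  assumes M: "prob_space M" and ind: "indep_processes M X E"
    and cont: "\<And>\<omega>. \<omega> \<in> space M \<Longrightarrow> continuous_on {0..} (\<lambda>t. X t \<omega>)"
    and E: "\<And>t \<omega>. E t \<omega> \<ge> 0" and TS: "T \<ge> 0" "S \<ge> 0"
    and Em: "\<And>t. t \<ge> 0 \<Longrightarrow> E t \<in> borel_measurable M"
    and Xm: "\<And>t. t \<ge> 0 \<Longrightarrow> X t \<in> borel_measurable M"
    and V: "V > 0" and \<theta>: "\<theta> > 0"
    and sq: "\<And>t. t \<ge> 0 \<Longrightarrow> integrable M (\<lambda>\<omega>. (X t \<omega> - \<mu>)\<^sup>2)"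
    and mean: "\<And>t. t \<ge> 0 \<Longrightarrow> (LINT \<omega>|M. X t \<omega> - \<mu>) = 0"
    and cov: "\<And>t s. t \<ge> 0 \<Longrightarrow> s \<ge> 0 \<Longrightarrow>
      (LINT \<omega>|M. (X t \<omega> - \<mu>) * (X s \<omega> - \<mu>)) = V * exp (- \<theta> * \<bar>t - s\<bar>)"
  shows "corr M (time_change X E T) (time_change X E S) = (LINT \<omega>|M. exp (- \<theta> * \<bar>E T \<omega> - E S \<omega>\<bar>))"
proof -
  interpret prob_space M by fact
  note [measurable] = Em[OF TS(1)] Em[OF TS(2)]
  let ?Y = "time_change X E"
  have Ym [measurable]: "?Y T \<in> borel_measurable M"
    \<comment> \<open>The measurability conclusion does not mention \<phi>, which is instantiated by
      a constant.\<close>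
    by (rule indep_processes_nn_integral(2)[OF M ind cont E TS borel_measurable_const[of 0]])
  have Ym' [measurable]: "?Y S \<in> borel_measurable M"
    by (rule indep_processes_nn_integral(2)[OF M ind cont E TS(2) TS(2) borel_measurable_const[of 0]])
  have lin: "integrable M (\<lambda>\<omega>. X t \<omega> - \<mu>)" if "t \<ge> 0" for t
    using Xm[OF that] sq[OF that] by (rule_tac square_integrable_imp_integrable) auto
  have int_shift: "(\<integral>\<^sup>+\<omega>. ennreal ((?Y t \<omega> - \<mu> + a)\<^sup>2) \<partial>M) = ennreal (V + a\<^sup>2)" if t: "t \<ge> 0" for t a
  proof -
    have *: "(\<integral>\<^sup>+\<omega>. ennreal ((X u \<omega> - \<mu> + a)\<^sup>2) \<partial>M) = ennreal (V + a\<^sup>2)" if u: "u \<ge> 0" for u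
    proof -
      have eq: "(X u \<omega> - \<mu> + a)\<^sup>2 = (X u \<omega> - \<mu>)\<^sup>2 + 2 * a * (X u \<omega> - \<mu>) + a\<^sup>2" for \<omega>
        by (simp add: power2_eq_square algebra_simps)
      have "(LINT \<omega>|M. (X u \<omega> - \<mu> + a)\<^sup>2) = V + a\<^sup>2"
        unfolding eq using sq[OF u] lin[OF u] mean[OF u] cov[OF u u] prob_space
        by (simp add: power2_eq_square del: Bochner_Integration.integral_diff)
      moreover have "integrable M (\<lambda>\<omega>. (X u \<omega> - \<mu> + a)\<^sup>2)"
        unfolding eq using sq[OF u] lin[OF u] by auto
      ultimately show ?thesis by (subst nn_integral_eq_integral) auto
    qed
    have "(\<integral>\<^sup>+\<omega>. ennreal ((?Y t \<omega> - \<mu> + a)\<^sup>2) \<partial>M)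
      = (\<integral>\<^sup>+\<eta>. (\<integral>\<^sup>+\<omega>. ennreal ((X (E t \<eta>) \<omega> - \<mu> + a)\<^sup>2) \<partial>M) \<partial>M)"
      using indep_processes_nn_integral(1)[OF M ind cont E t t, where \<phi>="\<lambda>(x, y). ennreal ((x - \<mu> + a)\<^sup>2)"]
      by (simp add: time_change_def)
    also have "\<dots> = ennreal (V + a\<^sup>2)" by (simp add: * E emeasure_space_1)
    finally show ?thesis .
  qed
  have Y_bochner: "has_bochner_integral M (\<lambda>\<omega>. (?Y t \<omega> - \<mu> + a)\<^sup>2) (V + a\<^sup>2)" if "t \<in> {T, S}" for t a
    by (rule has_bochner_integral_nn_integral) (use int_shift[of t a] that V TS in \<open>auto intro!: add_nonneg_nonneg\<close>)
  have Ysq: "integrable M (\<lambda>\<omega>. (?Y t \<omega> - \<mu>)\<^sup>2)" and Yvar: "(LINT \<omega>|M. (?Y t \<omega> - \<mu>)\<^sup>2) = V"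
    if "t \<in> {T, S}" for t
    using Y_bochner[OF that, of 0] by (auto simp: has_bochner_integral_iff)
  have Ylin: "integrable M (\<lambda>\<omega>. ?Y t \<omega> - \<mu>)" if "t \<in> {T, S}" for t
    using that Ysq[OF that] by (rule_tac square_integrable_imp_integrable) auto
  have Yint: "integrable M (?Y t)" if "t \<in> {T, S}" for t
    using Bochner_Integration.integrable_add[OF Ylin[OF that], of "\<lambda>_. \<mu>"] by simp
  have Ymean: "(LINT \<omega>|M. ?Y t \<omega>) = \<mu>" if "t \<in> {T, S}" for t
  proof -
    have eq: "(?Y t \<omega> - \<mu> + 1)\<^sup>2 = (?Y t \<omega> - \<mu>)\<^sup>2 + 2 * (?Y t \<omega> - \<mu>) + 1" for \<omega>
      by (simp add: power2_eq_square algebra_simps)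
    have "V + 1 = (LINT \<omega>|M. (?Y t \<omega> - \<mu> + 1)\<^sup>2)"
      using Y_bochner[OF that, of 1] by (simp add: has_bochner_integral_iff)
    also have "\<dots> = V + 2 * (LINT \<omega>|M. ?Y t \<omega> - \<mu>) + 1"
      unfolding eq using Ysq[OF that] Ylin[OF that] Yvar[OF that] prob_space
      by (simp del: Bochner_Integration.integral_diff right_diff_distrib_numeral)
    finally have "(LINT \<omega>|M. ?Y t \<omega> - \<mu>) = 0" by simp
    then show ?thesis using Yint[OF that] prob_space by simp
  qed
  define e where "e \<omega> = exp (- \<theta> * \<bar>E T \<omega> - E S \<omega>\<bar>)" for \<omega>
  have [measurable]: "e \<in> borel_measurable M" unfolding e_def by measurable
  have e: "0 \<le> e \<omega>" "e \<omega> \<le> 1" for \<omega> using \<theta> by (auto simp: e_def)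
  have e_int: "integrable M e" by (rule integrable_const_bound[where B=1]) (use e in auto)
  \<comment> \<open>The mean square of the difference depends only on |t - s|. It is evaluated at
    the two frozen random times, and polarization turns it into the covariance of the time-changed
    process.\<close>
  have diff: "(\<integral>\<^sup>+\<omega>. ennreal ((X t \<omega> - X s \<omega>)\<^sup>2) \<partial>M) = ennreal (2 * V * (1 - exp (- \<theta> * \<bar>t - s\<bar>)))"
    if "t \<ge> 0" "s \<ge> 0" for t s
  proof -
    have eq: "(X t \<omega> - X s \<omega>)\<^sup>2 = (X t \<omega> - \<mu>)\<^sup>2 + (X s \<omega> - \<mu>)\<^sup>2 - 2 * ((X t \<omega> - \<mu>) * (X s \<omega> - \<mu>))" for \<omega>
      by (simp add: power2_eq_square algebra_simps)
    have prod: "integrable M (\<lambda>\<omega>. (X t \<omega> - \<mu>) * (X s \<omega> - \<mu>))"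
      using Xm that sq by (rule_tac integrable_mult_of_squares) auto
    have var: "(LINT \<omega>|M. (X u \<omega> - \<mu>)\<^sup>2) = V" if "u \<ge> 0" for u
      using cov[OF that that] by (simp add: power2_eq_square)
    have "(LINT \<omega>|M. (X t \<omega> - X s \<omega>)\<^sup>2) = V + V - 2 * (LINT \<omega>|M. (X t \<omega> - \<mu>) * (X s \<omega> - \<mu>))"
      unfolding eq using sq[OF that(1)] sq[OF that(2)] prod by (simp add: var that)
    then have "(LINT \<omega>|M. (X t \<omega> - X s \<omega>)\<^sup>2) = 2 * V * (1 - exp (- \<theta> * \<bar>t - s\<bar>))"
      unfolding cov[OF that] by (simp add: algebra_simps)
    moreover have "integrable M (\<lambda>\<omega>. (X t \<omega> - X s \<omega>)\<^sup>2)"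
      unfolding eq using sq[OF that(1)] sq[OF that(2)] prod by auto
    ultimately show ?thesis by (subst nn_integral_eq_integral) auto
  qed
  have "(\<integral>\<^sup>+\<omega>. ennreal ((?Y T \<omega> - ?Y S \<omega>)\<^sup>2) \<partial>M) = (\<integral>\<^sup>+\<eta>. ennreal (2 * V * (1 - e \<eta>)) \<partial>M)"
    using indep_processes_nn_integral(1)[OF M ind cont E TS, where \<phi>="\<lambda>(x, y). ennreal ((x - y)\<^sup>2)"]
    by (simp add: time_change_def diff E e_def)
  also have "\<dots> = ennreal (LINT \<eta>|M. 2 * V * (1 - e \<eta>))"
    using e_int V e by (intro nn_integral_eq_integral) auto
  also have "(LINT \<eta>|M. 2 * V * (1 - e \<eta>)) = 2 * V * (1 - (LINT \<eta>|M. e \<eta>))"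
    using e_int prob_space by simp
  finally have d: "(\<integral>\<^sup>+\<omega>. ennreal ((?Y T \<omega> - ?Y S \<omega>)\<^sup>2) \<partial>M) = ennreal (2 * V * (1 - (LINT \<eta>|M. e \<eta>)))" .
  have "(LINT \<eta>|M. e \<eta>) \<le> (LINT \<eta>|M. 1)" using e_int e by (intro integral_mono) auto
  then have le: "(LINT \<eta>|M. e \<eta>) \<le> 1" using prob_space by simp
  have "has_bochner_integral M (\<lambda>\<omega>. (?Y T \<omega> - ?Y S \<omega>)\<^sup>2) (2 * V * (1 - (LINT \<eta>|M. e \<eta>)))"
    by (rule has_bochner_integral_nn_integral) (use d V le in auto)
  then have dd: "(LINT \<omega>|M. (?Y T \<omega> - ?Y S \<omega>)\<^sup>2) = 2 * V * (1 - (LINT \<eta>|M. e \<eta>))"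
    by (simp add: has_bochner_integral_iff)
  have prod: "integrable M (\<lambda>\<omega>. (?Y T \<omega> - \<mu>) * (?Y S \<omega> - \<mu>))"
    using Ysq by (rule_tac integrable_mult_of_squares) auto
  have "(?Y T \<omega> - ?Y S \<omega>)\<^sup>2 = (?Y T \<omega> - \<mu>)\<^sup>2 + (?Y S \<omega> - \<mu>)\<^sup>2 - 2 * ((?Y T \<omega> - \<mu>) * (?Y S \<omega> - \<mu>))" for \<omega>
    by (simp add: power2_eq_square algebra_simps)
  then have "(LINT \<omega>|M. (?Y T \<omega> - ?Y S \<omega>)\<^sup>2) = V + V - 2 * (LINT \<omega>|M. (?Y T \<omega> - \<mu>) * (?Y S \<omega> - \<mu>))"
    using Ysq[of T] Ysq[of S] Yvar[of T] Yvar[of S] prod by simp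
  then have "(LINT \<omega>|M. (?Y T \<omega> - \<mu>) * (?Y S \<omega> - \<mu>)) = V * (LINT \<eta>|M. e \<eta>)"
    unfolding dd by (simp add: algebra_simps)
  then have "corr M (?Y T) (?Y S) = V * (LINT \<eta>|M. e \<eta>) / (sqrt V * sqrt V)"
    unfolding corr_def using Ymean[of T] Ymean[of S] Yvar[of T] Yvar[of S] by simp
  then show ?thesis using V by (simp add: e_def[abs_def])
qed

section \<open>Martingale property of the Ito integral\<close>

locale brownian = prob_space M for M :: "'a measure" +
  fixes F :: "real \<Rightarrow> 'a measure" and W :: "real \<Rightarrow> 'a \<Rightarrow> real"
  assumes filt: "filtration_on M F" and bm: "brownian_motion M F W"
begin

lemma space_F [simp]: "space (F t) = space M"
  using filt by (simp add: filtration_on_def filtration.space_F)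

lemma F_mono: "s \<le> t \<Longrightarrow> f \<in> borel_measurable (F s) \<Longrightarrow> f \<in> borel_measurable (F t)"
  using filt filtration.sets_F_mono[of "space M" F s t]
  by (auto simp: filtration_on_def intro: measurable_mono[THEN subsetD, of borel borel])

lemma F_M: "f \<in> borel_measurable (F s) \<Longrightarrow> f \<in> borel_measurable M"
  using filt by (auto simp: filtration_on_def measurable_def)

lemma W_F: "t \<ge> 0 \<Longrightarrow> W t \<in> borel_measurable (F t)"
  using bm by (simp add: brownian_motion_def)

lemma W_F': "0 \<le> s \<Longrightarrow> s \<le> t \<Longrightarrow> W s \<in> borel_measurable (F t)"
  using F_mono[OF _ W_F] by simp

lemma W_M [measurable (raw)]: "t \<ge> 0 \<Longrightarrow> W t \<in> borel_measurable M"
  using F_M[OF W_F] .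

lemma increment_normal:
  assumes "0 \<le> a" "a < b"
  shows "distributed M lborel (\<lambda>\<omega>. W b \<omega> - W a \<omega>) (\<lambda>x. ennreal (normal_density 0 (sqrt (b - a)) x))"
  using bm assms by (simp add: brownian_motion_def)

lemma increment_moments:
  assumes ab: "0 \<le> a" "a \<le> b"
  shows "integrable M (\<lambda>\<omega>. W b \<omega> - W a \<omega>)" "(LINT \<omega>|M. W b \<omega> - W a \<omega>) = 0"
    "integrable M (\<lambda>\<omega>. (W b \<omega> - W a \<omega>)\<^sup>2)" "(LINT \<omega>|M. (W b \<omega> - W a \<omega>)\<^sup>2) = b - a"
proof -
  have "integrable M (\<lambda>\<omega>. W b \<omega> - W a \<omega>) \<and> (LINT \<omega>|M. W b \<omega> - W a \<omega>) = 0 \<and>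
    integrable M (\<lambda>\<omega>. (W b \<omega> - W a \<omega>)\<^sup>2) \<and> (LINT \<omega>|M. (W b \<omega> - W a \<omega>)\<^sup>2) = b - a"
  proof (cases "a = b")
    case False
    with ab have "a < b" by simp
    note D = increment_normal[OF ab(1) this]
    have pos: "sqrt (b - a) > 0" using \<open>a < b\<close> by simp
    have [measurable]: "W a \<in> borel_measurable M" "W b \<in> borel_measurable M" using ab by auto
    have e: "(LINT \<omega>|M. W b \<omega> - W a \<omega>) = 0" by (rule normal_distributed_expectation[OF pos D])
    have v: "(LINT \<omega>|M. (W b \<omega> - W a \<omega>)\<^sup>2) = b - a"
      using normal_distributed_variance[OF pos D] \<open>a < b\<close> unfolding e by simp
    \<comment> \<open>A nonzero Bochner integral certifies integrability, the default value being 0.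
      This is why the case a = b is treated apart.\<close>
    have i: "integrable M (\<lambda>\<omega>. (W b \<omega> - W a \<omega>)\<^sup>2)"
      using v \<open>a < b\<close> not_integrable_integral_eq[of M "\<lambda>\<omega>. (W b \<omega> - W a \<omega>)\<^sup>2"] by force
    show ?thesis using e v i by (auto intro: square_integrable_imp_integrable)
  qed simp
  then show "integrable M (\<lambda>\<omega>. W b \<omega> - W a \<omega>)" "(LINT \<omega>|M. W b \<omega> - W a \<omega>) = 0"
    "integrable M (\<lambda>\<omega>. (W b \<omega> - W a \<omega>)\<^sup>2)" "(LINT \<omega>|M. (W b \<omega> - W a \<omega>)\<^sup>2) = b - a" by auto
qed

lemma indep_increment:
  assumes ab: "0 \<le> a" "a < b" and Y: "Y \<in> borel_measurable (F a)"
  shows "indep_var borel Y borel (\<lambda>\<omega>. W b \<omega> - W a \<omega>)"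
  unfolding indep_var_eq
proof (intro conjI)
  show "random_variable borel Y" using F_M[OF Y] .
  show "random_variable borel (\<lambda>\<omega>. W b \<omega> - W a \<omega>)" using ab by auto
  have ind: "indep_set (sets (F a)) (sets (vimage_algebra (space M) (\<lambda>\<omega>. W b \<omega> - W a \<omega>) borel))"
    using bm ab unfolding brownian_motion_def by blast
  have "sigma_sets (space (F a)) {Y -` A \<inter> space M |A. A \<in> sets borel} \<subseteq> sets (F a)"
    using Y by (intro sets.sigma_sets_subset) (auto dest: measurable_sets)
  then show "indep_set (sigma_sets (space M) {Y -` A \<inter> space M |A. A \<in> sets borel})
     (sigma_sets (space M) {(\<lambda>\<omega>. W b \<omega> - W a \<omega>) -` A \<inter> space M |A. A \<in> sets borel})"
    using ind unfolding indep_set_def sets_vimage_algebra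
    by (elim indep_sets_mono_sets) (auto split: bool.split)
qed

lemma mult_increment:
  assumes ab: "0 \<le> a" "a \<le> b" and Y: "Y \<in> borel_measurable (F a)" "integrable M Y"
  shows "integrable M (\<lambda>\<omega>. Y \<omega> * (W b \<omega> - W a \<omega>))" "(LINT \<omega>|M. Y \<omega> * (W b \<omega> - W a \<omega>)) = 0"
    "integrable M (\<lambda>\<omega>. Y \<omega> * (W b \<omega> - W a \<omega>)\<^sup>2)"
    "(LINT \<omega>|M. Y \<omega> * (W b \<omega> - W a \<omega>)\<^sup>2) = (LINT \<omega>|M. Y \<omega>) * (b - a)"
proof -
  have "integrable M (\<lambda>\<omega>. Y \<omega> * (W b \<omega> - W a \<omega>)) \<and> (LINT \<omega>|M. Y \<omega> * (W b \<omega> - W a \<omega>)) = 0 \<and>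
    integrable M (\<lambda>\<omega>. Y \<omega> * (W b \<omega> - W a \<omega>)\<^sup>2) \<and>
    (LINT \<omega>|M. Y \<omega> * (W b \<omega> - W a \<omega>)\<^sup>2) = (LINT \<omega>|M. Y \<omega>) * (b - a)"
  proof (cases "a = b")
    case False
    with ab have "a < b" by simp
    note ind = indep_increment[OF ab(1) this Y(1)]
    have ind2: "indep_var borel Y borel (\<lambda>\<omega>. (W b \<omega> - W a \<omega>)\<^sup>2)"
      using indep_var_compose[OF ind, of "\<lambda>x. x" borel "\<lambda>x. x\<^sup>2" borel] by (simp add: comp_def)
    note m = increment_moments[OF ab]
    show ?thesis
      using indep_var_integrable[OF ind Y(2) m(1)] indep_var_lebesgue_integral[OF ind Y(2) m(1)]
        indep_var_integrable[OF ind2 Y(2) m(3)] indep_var_lebesgue_integral[OF ind2 Y(2) m(3)]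
      by (simp add: m)
  qed simp
  then show "integrable M (\<lambda>\<omega>. Y \<omega> * (W b \<omega> - W a \<omega>))" "(LINT \<omega>|M. Y \<omega> * (W b \<omega> - W a \<omega>)) = 0"
    "integrable M (\<lambda>\<omega>. Y \<omega> * (W b \<omega> - W a \<omega>)\<^sup>2)"
    "(LINT \<omega>|M. Y \<omega> * (W b \<omega> - W a \<omega>)\<^sup>2) = (LINT \<omega>|M. Y \<omega>) * (b - a)" by auto
qed

section \<open>Bounded adapted coefficients and the isometry for elementary integrals\<close>

definition bdd_F :: "real \<Rightarrow> ('a \<Rightarrow> real) \<Rightarrow> bool" where
  "bdd_F t Y \<longleftrightarrow> Y \<in> borel_measurable (F t) \<and> (\<exists>C. \<forall>\<omega>\<in>space M. \<bar>Y \<omega>\<bar> \<le> C)"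

lemma bdd_F_mono: "s \<le> t \<Longrightarrow> bdd_F s Y \<Longrightarrow> bdd_F t Y"
  unfolding bdd_F_def using F_mono by blast

lemma bdd_F_mult: "bdd_F t Y \<Longrightarrow> bdd_F t Z \<Longrightarrow> bdd_F t (\<lambda>\<omega>. Y \<omega> * Z \<omega>)"
  unfolding bdd_F_def
proof (safe, goal_cases)
  case (2 C1 C2)
  then have "\<forall>\<omega>\<in>space M. \<bar>Y \<omega> * Z \<omega>\<bar> \<le> C1 * C2"
    by (auto simp: abs_mult intro!: mult_mono order_trans[OF abs_ge_zero])
  then show ?case by blast
qed auto

lemma bdd_F_uminus: "bdd_F t Y \<Longrightarrow> bdd_F t (\<lambda>\<omega>. - Y \<omega>)"
  unfolding bdd_F_def by auto

lemma bdd_F_0: "bdd_F t (\<lambda>_. 0)"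
  unfolding bdd_F_def by auto

lemma bdd_F_M: "bdd_F t Y \<Longrightarrow> Y \<in> borel_measurable M"
  unfolding bdd_F_def using F_M by blast

lemma bdd_F_mult_integrable:
  assumes Y: "bdd_F t Y" and Z: "integrable M Z"
  shows "integrable M (\<lambda>\<omega>. Y \<omega> * Z \<omega>)"
proof -
  obtain C where C: "\<forall>\<omega>\<in>space M. \<bar>Y \<omega>\<bar> \<le> C" using Y by (auto simp: bdd_F_def)
  have [measurable]: "Y \<in> borel_measurable M" using bdd_F_M[OF Y] .
  show ?thesis
  proof (rule Bochner_Integration.integrable_bound[of _ "\<lambda>\<omega>. C * Z \<omega>"])
    show "AE \<omega> in M. norm (Y \<omega> * Z \<omega>) \<le> norm (C * Z \<omega>)"
      using C by (intro AE_I2) (force simp: abs_mult intro!: mult_right_mono)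
  qed (use Z in auto)
qed

lemma bdd_F_integrable: "bdd_F t Y \<Longrightarrow> integrable M Y"
  using bdd_F_mult_integrable[of t Y "\<lambda>_. 1"] by simp

lemma increments_mult_integrable:
  assumes "0 \<le> a" "a \<le> b" "0 \<le> c" "c \<le> d" "bdd_F t Y"
  shows "integrable M (\<lambda>\<omega>. Y \<omega> * ((W b \<omega> - W a \<omega>) * (W d \<omega> - W c \<omega>)))"
proof (rule bdd_F_mult_integrable)
  show "integrable M (\<lambda>\<omega>. (W b \<omega> - W a \<omega>) * (W d \<omega> - W c \<omega>))"
    by (rule integrable_mult_of_squares) (use increment_moments(3) assms in auto)
qed fact

text \<open>Everything up to the last factor is measurable at time c, and the increment after c is
  independent of that past with mean 0.\<close>

lemma increments_orthogonal:
  assumes "0 \<le> a" "a \<le> b" "b \<le> c" "c \<le> d" and Y: "bdd_F c Y"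
  shows "(LINT \<omega>|M. Y \<omega> * ((W b \<omega> - W a \<omega>) * (W d \<omega> - W c \<omega>))) = 0"
proof -
  have "(LINT \<omega>|M. (Y \<omega> * (W b \<omega> - W a \<omega>)) * (W d \<omega> - W c \<omega>)) = 0"
  proof (rule mult_increment)
    have [measurable]: "Y \<in> borel_measurable (F c)" using Y by (simp add: bdd_F_def)
    have [measurable]: "W a \<in> borel_measurable (F c)" "W b \<in> borel_measurable (F c)"
      using assms by (auto intro: W_F')
    show "(\<lambda>\<omega>. Y \<omega> * (W b \<omega> - W a \<omega>)) \<in> borel_measurable (F c)" by measurable
    show "integrable M (\<lambda>\<omega>. Y \<omega> * (W b \<omega> - W a \<omega>))"
      by (rule bdd_F_mult_integrable[OF Y]) (use increment_moments assms in auto)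
  qed (use assms in auto)
  then show ?thesis by (simp add: mult.assoc)
qed

text \<open>Because a \<le> c, the product of the coefficients is known at time c. Cutting at c and
  at the end of the overlap leaves one squared increment, which contributes the overlap length; the
  cross terms are orthogonal. The outer \<open>max 0\<close> covers disjoint intervals.\<close>

lemma increments_pair_le:
  assumes a: "0 \<le> a" "a \<le> b" "a \<le> c" "c \<le> d" and \<xi>: "bdd_F a \<xi>" and \<eta>: "bdd_F c \<eta>"
  shows "(LINT \<omega>|M. (\<xi> \<omega> * (W b \<omega> - W a \<omega>)) * (\<eta> \<omega> * (W d \<omega> - W c \<omega>)))
    = (LINT \<omega>|M. \<xi> \<omega> * \<eta> \<omega>) * max 0 (min b d - max a c)"
proof -
  define \<zeta> where "\<zeta> \<omega> = \<xi> \<omega> * \<eta> \<omega>" for \<omega>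
  have \<zeta>: "bdd_F c \<zeta>"
    unfolding \<zeta>_def using bdd_F_mult[OF bdd_F_mono[OF a(3) \<xi>] \<eta>] by simp
  have eq: "(\<xi> \<omega> * (W b \<omega> - W a \<omega>)) * (\<eta> \<omega> * (W d \<omega> - W c \<omega>)) = \<zeta> \<omega> * ((W b \<omega> - W a \<omega>) * (W d \<omega> - W c \<omega>))" for \<omega>
    by (simp add: \<zeta>_def)
  show ?thesis
  proof (cases "b \<le> c")
    case True
    then show ?thesis unfolding eq using increments_orthogonal[OF a(1,2) True a(4) \<zeta>] by simp
  next
    case False
    \<comment> \<open>[c, e] is the overlap of the two intervals, and [e, f] is what the one ending
      later has beyond it.\<close>
    define e f where "e = min b d" and "f = max b d"
    have cef: "c \<le> e" "e \<le> f" "0 \<le> c" using False a by (auto simp: e_def f_def)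
    have split: "\<zeta> \<omega> * ((W b \<omega> - W a \<omega>) * (W d \<omega> - W c \<omega>)) =
        \<zeta> \<omega> * ((W c \<omega> - W a \<omega>) * (W d \<omega> - W c \<omega>)) +
        (\<zeta> \<omega> * (W e \<omega> - W c \<omega>)\<^sup>2 + \<zeta> \<omega> * ((W e \<omega> - W c \<omega>) * (W f \<omega> - W e \<omega>)))" for \<omega>
      by (cases "b \<le> d") (simp_all add: e_def f_def min_def max_def power2_eq_square algebra_simps)
    have "(LINT \<omega>|M. \<zeta> \<omega> * ((W b \<omega> - W a \<omega>) * (W d \<omega> - W c \<omega>)))
      = (LINT \<omega>|M. \<zeta> \<omega> * ((W c \<omega> - W a \<omega>) * (W d \<omega> - W c \<omega>))) +
        ((LINT \<omega>|M. \<zeta> \<omega> * (W e \<omega> - W c \<omega>)\<^sup>2) + (LINT \<omega>|M. \<zeta> \<omega> * ((W e \<omega> - W c \<omega>) * (W f \<omega> - W e \<omega>))))"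
      unfolding split
      by (subst Bochner_Integration.integral_add, rule increments_mult_integrable[OF _ _ _ _ \<zeta>])
        (use a cef \<zeta> increments_mult_integrable[OF _ _ _ _ \<zeta>] mult_increment(3)[of c e \<zeta>] bdd_F_integrable[OF \<zeta>]
          in \<open>auto simp: bdd_F_def\<close>)
    also have "(LINT \<omega>|M. \<zeta> \<omega> * ((W c \<omega> - W a \<omega>) * (W d \<omega> - W c \<omega>))) = 0"
      using a by (intro increments_orthogonal[OF _ _ _ _ \<zeta>]) auto
    also have "(LINT \<omega>|M. \<zeta> \<omega> * ((W e \<omega> - W c \<omega>) * (W f \<omega> - W e \<omega>))) = 0"
      using cef by (intro increments_orthogonal[OF _ _ _ _ bdd_F_mono[OF _ \<zeta>]]) auto
    also have "(LINT \<omega>|M. \<zeta> \<omega> * (W e \<omega> - W c \<omega>)\<^sup>2) = (LINT \<omega>|M. \<zeta> \<omega>) * (e - c)"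
      using cef \<zeta> bdd_F_integrable[OF \<zeta>] by (intro mult_increment) (auto simp: bdd_F_def)
    finally show ?thesis unfolding eq using cef a by (simp add: \<zeta>_def e_def max_def)
  qed
qed

lemma increments_pair:
  assumes a: "0 \<le> a" "a \<le> b" "0 \<le> c" "c \<le> d" and \<xi>: "bdd_F a \<xi>" and \<eta>: "bdd_F c \<eta>"
  shows "(LINT \<omega>|M. (\<xi> \<omega> * (W b \<omega> - W a \<omega>)) * (\<eta> \<omega> * (W d \<omega> - W c \<omega>)))
    = (LINT \<omega>|M. \<xi> \<omega> * \<eta> \<omega>) * max 0 (min b d - max a c)"
proof (cases "a \<le> c")
  case True
  then show ?thesis using increments_pair_le[OF a(1,2) True a(4) \<xi> \<eta>] by simp
next
  case False
  then have "c \<le> a" by simp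
  then show ?thesis
    using increments_pair_le[OF a(3,4) _ a(2) \<eta> \<xi>] by (simp add: mult.commute min.commute max.commute)
qed

lemma bdd_increment_square_integrable:
  assumes "0 \<le> a" "a \<le> b" "bdd_F t \<xi>"
  shows "(\<lambda>\<omega>. \<xi> \<omega> * (W b \<omega> - W a \<omega>)) \<in> borel_measurable M"
    "integrable M (\<lambda>\<omega>. (\<xi> \<omega> * (W b \<omega> - W a \<omega>))\<^sup>2)"
proof -
  have [measurable]: "\<xi> \<in> borel_measurable M" using bdd_F_M assms by blast
  show "(\<lambda>\<omega>. \<xi> \<omega> * (W b \<omega> - W a \<omega>)) \<in> borel_measurable M"
    using W_M[of a] W_M[of b] assms by simp
  have "integrable M (\<lambda>\<omega>. (\<xi> \<omega> * \<xi> \<omega>) * (W b \<omega> - W a \<omega>)\<^sup>2)"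
    by (rule bdd_F_mult_integrable[OF bdd_F_mult[OF assms(3) assms(3)]]) (use increment_moments assms in auto)
  then show "integrable M (\<lambda>\<omega>. (\<xi> \<omega> * (W b \<omega> - W a \<omega>))\<^sup>2)"
    by (simp add: power_mult_distrib power2_eq_square ac_simps)
qed

text \<open>
  Overlapping intervals are allowed, so that two elementary processes over different partitions can be
  compared without a common refinement.
\<close>

lemma elementary_isometry:
  fixes a b :: "'i \<Rightarrow> real"
  assumes I: "finite I" and ab: "\<And>i. i \<in> I \<Longrightarrow> 0 \<le> a i \<and> a i \<le> b i" and \<xi>: "\<And>i. i \<in> I \<Longrightarrow> bdd_F (a i) (\<xi> i)"
  shows "(\<integral>\<^sup>+\<omega>. ennreal ((\<Sum>i\<in>I. \<xi> i \<omega> * (W (b i) \<omega> - W (a i) \<omega>))\<^sup>2) \<partial>M)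
    = (\<integral>\<^sup>+u. (\<integral>\<^sup>+\<omega>. ennreal ((\<Sum>i\<in>I. \<xi> i \<omega> * indicator {a i..<b i} u)\<^sup>2) \<partial>M) \<partial>lborel)"
proof -
  define X where "X i \<omega> = \<xi> i \<omega> * (W (b i) \<omega> - W (a i) \<omega>)" for i \<omega>
  \<comment> \<open>Length of the intersection of the i-th and j-th intervals. Both sides of the
    isometry expand into the same double sum with these weights.\<close>
  define l where "l i j = max 0 (min (b i) (b j) - max (a i) (a j))" for i j
  have Xm: "X i \<in> borel_measurable M" and Xsq: "integrable M (\<lambda>\<omega>. (X i \<omega>)\<^sup>2)" if "i \<in> I" for i
    using bdd_increment_square_integrable[of "a i" "b i" "a i" "\<xi> i"] ab[OF that] \<xi>[OF that]
    by (auto simp: X_def[abs_def])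
  have XX: "integrable M (\<lambda>\<omega>. X i \<omega> * X j \<omega>)" if "i \<in> I" "j \<in> I" for i j
    by (rule integrable_mult_of_squares) (use that Xm Xsq in auto)
  have \<xi>\<xi>: "integrable M (\<lambda>\<omega>. \<xi> i \<omega> * \<xi> j \<omega>)" if "i \<in> I" "j \<in> I" for i j
    using bdd_F_mult_integrable[OF \<xi>[OF that(1)] bdd_F_integrable[OF \<xi>[OF that(2)]]] .
  have sq: "(\<Sum>i\<in>I. z i)\<^sup>2 = (\<Sum>i\<in>I. \<Sum>j\<in>I. z i * z j)" for z :: "'i \<Rightarrow> real"
    by (simp add: power2_eq_square sum_product)
  have "(\<integral>\<^sup>+\<omega>. ennreal ((\<Sum>i\<in>I. X i \<omega>)\<^sup>2) \<partial>M) = ennreal (LINT \<omega>|M. (\<Sum>i\<in>I. X i \<omega>)\<^sup>2)"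
    by (rule nn_integral_eq_integral, simp add: sq XX, simp)
  also have "(LINT \<omega>|M. (\<Sum>i\<in>I. X i \<omega>)\<^sup>2) = (\<Sum>i\<in>I. \<Sum>j\<in>I. LINT \<omega>|M. X i \<omega> * X j \<omega>)"
    by (simp add: sq XX)
  also have "\<dots> = (\<Sum>i\<in>I. \<Sum>j\<in>I. (LINT \<omega>|M. \<xi> i \<omega> * \<xi> j \<omega>) * l i j)"
    unfolding X_def l_def using ab \<xi> by (intro sum.cong refl increments_pair) auto
  finally have lhs: "(\<integral>\<^sup>+\<omega>. ennreal ((\<Sum>i\<in>I. X i \<omega>)\<^sup>2) \<partial>M)
    = ennreal (\<Sum>i\<in>I. \<Sum>j\<in>I. (LINT \<omega>|M. \<xi> i \<omega> * \<xi> j \<omega>) * l i j)" .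
  define G where "G u = (\<Sum>i\<in>I. \<Sum>j\<in>I. (LINT \<omega>|M. \<xi> i \<omega> * \<xi> j \<omega>) *
    (indicator {a i..<b i} u * indicator {a j..<b j} u))" for u :: real
  have inner: "(\<integral>\<^sup>+\<omega>. ennreal ((\<Sum>i\<in>I. \<xi> i \<omega> * indicator {a i..<b i} u)\<^sup>2) \<partial>M) = ennreal (G u)" and G: "G u \<ge> 0" for u
  proof -
    have eq: "(\<Sum>i\<in>I. \<xi> i \<omega> * indicator {a i..<b i} u)\<^sup>2 = (\<Sum>i\<in>I. \<Sum>j\<in>I. (\<xi> i \<omega> * \<xi> j \<omega>) *
      (indicator {a i..<b i} u * indicator {a j..<b j} u))" for \<omega>
      unfolding sq by (intro sum.cong refl) (simp add: ac_simps)
    have int: "integrable M (\<lambda>\<omega>. (\<Sum>i\<in>I. \<xi> i \<omega> * indicator {a i..<b i} u)\<^sup>2)"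
      unfolding eq using \<xi>\<xi> by auto
    have val: "(LINT \<omega>|M. (\<Sum>i\<in>I. \<xi> i \<omega> * indicator {a i..<b i} u)\<^sup>2) = G u"
      unfolding eq G_def using \<xi>\<xi> by simp
    show "(\<integral>\<^sup>+\<omega>. ennreal ((\<Sum>i\<in>I. \<xi> i \<omega> * indicator {a i..<b i} u)\<^sup>2) \<partial>M) = ennreal (G u)"
      using int by (subst nn_integral_eq_integral) (auto simp: val)
    show "G u \<ge> 0" unfolding val[symmetric] by simp
  qed
  have ind: "has_bochner_integral lborel (\<lambda>u. indicator {a i..<b i} u * indicator {a j..<b j} u :: real) (l i j)" for i j
  proof -
    have "{a i..<b i} \<inter> {a j..<b j} = {max (a i) (a j)..<min (b i) (b j)}" by auto
    then have "(\<lambda>u. indicator {a i..<b i} u * indicator {a j..<b j} u :: real) = indicator {max (a i) (a j)..<min (b i) (b j)}"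
      by (simp add: indicator_inter_arith[symmetric])
    moreover have "has_bochner_integral lborel (indicator {x..<y} :: real \<Rightarrow> real) (max 0 (y - x))" for x y :: real
    proof (cases "x \<le> y")
      case True
      then show ?thesis using has_bochner_integral_real_indicator[of "{x..<y}" lborel] by simp
    next
      case False
      then have "indicator {x..<y} = (\<lambda>_. 0 :: real)" by auto
      then show ?thesis using False has_bochner_integral_zero[of lborel] by simp
    qed
    ultimately show ?thesis by (simp add: l_def)
  qed
  have "has_bochner_integral lborel G (\<Sum>i\<in>I. \<Sum>j\<in>I. (LINT \<omega>|M. \<xi> i \<omega> * \<xi> j \<omega>) * l i j)"
    unfolding G_def by (intro has_bochner_integral_sum has_bochner_integral_mult_right ind)
  then have "(\<integral>\<^sup>+u. ennreal (G u) \<partial>lborel) = ennreal (\<Sum>i\<in>I. \<Sum>j\<in>I. (LINT \<omega>|M. \<xi> i \<omega> * \<xi> j \<omega>) * l i j)"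
    using G by (subst nn_integral_eq_integral) (auto simp: has_bochner_integral_iff)
  then show ?thesis using lhs by (simp add: inner X_def)
qed

end

section \<open>Limits and sums in mean square\<close>

text \<open>Cauchy-Schwarz in [0, \<infinity>]: the square of the pairing is at most the vanishing
  integral of Dn^2 times the finite integral of Z^2.\<close>

lemma mult_L2_null:
  fixes Dn :: "nat \<Rightarrow> 'a \<Rightarrow> real"
  assumes D [measurable]: "\<And>n. Dn n \<in> borel_measurable M" and Z [measurable]: "Z \<in> borel_measurable M"
    and Z2: "integrable M (\<lambda>x. (Z x)\<^sup>2)"
    and lim: "(\<lambda>n. \<integral>\<^sup>+x. ennreal ((Dn n x)\<^sup>2) \<partial>M) \<longlonglongrightarrow> 0"
  shows "(\<lambda>n. LINT x|M. Dn n x * Z x) \<longlonglongrightarrow> 0"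
proof -
  have Zfin: "(\<integral>\<^sup>+x. ennreal ((Z x)\<^sup>2) \<partial>M) = ennreal (LINT x|M. (Z x)\<^sup>2)"
    using Z2 by (intro nn_integral_eq_integral) auto
  have le: "ennreal ((LINT x|M. Dn n x * Z x)\<^sup>2) \<le>
    (\<integral>\<^sup>+x. ennreal ((Dn n x)\<^sup>2) \<partial>M) * (\<integral>\<^sup>+x. ennreal ((Z x)\<^sup>2) \<partial>M)" for n
  proof -
    have "ennreal \<bar>LINT x|M. Dn n x * Z x\<bar> \<le> (\<integral>\<^sup>+x. ennreal (norm (Dn n x * Z x)) \<partial>M)"
    \<comment> \<open>If the product is not integrable, its Bochner integral is 0 by convention and
      the bound is trivial.\<close>
    proof (cases "integrable M (\<lambda>x. Dn n x * Z x)")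
      case True
      then show ?thesis using integral_norm_bound_ennreal[OF True] by simp
    qed (simp add: not_integrable_integral_eq)
    also have "\<dots> = (\<integral>\<^sup>+x. ennreal \<bar>Dn n x\<bar> * ennreal \<bar>Z x\<bar> \<partial>M)"
      by (simp add: abs_mult ennreal_mult)
    finally have "(ennreal \<bar>LINT x|M. Dn n x * Z x\<bar>)\<^sup>2 \<le> (\<integral>\<^sup>+x. ennreal \<bar>Dn n x\<bar> * ennreal \<bar>Z x\<bar> \<partial>M)\<^sup>2"
      by (rule power_mono) simp
    also have "\<dots> \<le> (\<integral>\<^sup>+x. (ennreal \<bar>Dn n x\<bar>)\<^sup>2 \<partial>M) * (\<integral>\<^sup>+x. (ennreal \<bar>Z x\<bar>)\<^sup>2 \<partial>M)"
      by (rule Cauchy_Schwarz_nn_integral) auto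
    finally show ?thesis by (simp add: ennreal_power)
  qed
  have "(\<lambda>n. (\<integral>\<^sup>+x. ennreal ((Z x)\<^sup>2) \<partial>M) * (\<integral>\<^sup>+x. ennreal ((Dn n x)\<^sup>2) \<partial>M)) \<longlonglongrightarrow> (\<integral>\<^sup>+x. ennreal ((Z x)\<^sup>2) \<partial>M) * 0"
    by (rule ennreal_tendsto_cmult[OF _ lim]) (simp add: Zfin)
  then have "(\<lambda>n. (\<integral>\<^sup>+x. ennreal ((Dn n x)\<^sup>2) \<partial>M) * (\<integral>\<^sup>+x. ennreal ((Z x)\<^sup>2) \<partial>M)) \<longlonglongrightarrow> 0"
    by (simp add: mult.commute)
  then have "(\<lambda>n. ennreal ((LINT x|M. Dn n x * Z x)\<^sup>2)) \<longlonglongrightarrow> 0"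
    by (rule tendsto_sandwich[OF always_eventually always_eventually tendsto_const, rotated 2])
      (simp_all only: le zero_le simp_thms)
  then have "(\<lambda>n. (LINT x|M. Dn n x * Z x)\<^sup>2) \<longlonglongrightarrow> 0"
    by (subst (asm) ennreal_tendsto_0_iff) auto
  then have "(\<lambda>n. sqrt ((LINT x|M. Dn n x * Z x)\<^sup>2)) \<longlonglongrightarrow> sqrt 0" by (rule tendsto_real_sqrt)
  then show ?thesis by (simp add: tendsto_rabs_zero_iff)
qed

lemma square_diff_le: "(x - y)\<^sup>2 \<le> 2 * (z - x)\<^sup>2 + 2 * (z - y)\<^sup>2" for x y z :: real
proof -
  have "0 \<le> ((z - x) + (z - y))\<^sup>2" by simp
  then show ?thesis by (simp add: power2_eq_square algebra_simps)
qed

lemma integrable_square_add: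
  fixes f g :: "'a \<Rightarrow> real"
  assumes "f \<in> borel_measurable N" "g \<in> borel_measurable N"
    and "integrable N (\<lambda>x. (f x)\<^sup>2)" "integrable N (\<lambda>x. (g x)\<^sup>2)"
  shows "integrable N (\<lambda>x. (f x + g x)\<^sup>2)"
proof -
  have "(f x + g x)\<^sup>2 = (f x)\<^sup>2 + 2 * (f x * g x) + (g x)\<^sup>2" for x
    by (simp add: power2_eq_square algebra_simps)
  then show ?thesis using integrable_mult_of_squares[OF assms] assms by simp
qed

lemma integrable_square_sum:
  fixes f :: "'i \<Rightarrow> 'a \<Rightarrow> real"
  assumes "\<And>i. i \<in> I \<Longrightarrow> f i \<in> borel_measurable N" "\<And>i. i \<in> I \<Longrightarrow> integrable N (\<lambda>x. (f i x)\<^sup>2)"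
  shows "integrable N (\<lambda>x. (\<Sum>i\<in>I. f i x)\<^sup>2)"
  using assms
proof (induction I rule: infinite_finite_induct)
  case (insert i I)
  have "(\<lambda>x. \<Sum>i\<in>I. f i x) \<in> borel_measurable N"
    by (rule borel_measurable_sum) (simp add: insert.prems)
  then have "integrable N (\<lambda>x. (f i x + (\<Sum>i\<in>I. f i x))\<^sup>2)"
    by (rule integrable_square_add[rotated]) (simp_all add: insert)
  then show ?case using insert.hyps by simp
qed simp_all

context brownian
begin

lemma elementary_bdd_F:
  assumes "elementary_process M F T k \<tau> \<xi>" "i < k"
  shows "bdd_F (\<tau> i) (\<xi> i)" "0 \<le> \<tau> i" "\<tau> i \<le> \<tau> (Suc i)"
proof -
  have m: "mono_on {..k} \<tau>" "\<tau> 0 = 0" using assms by (auto simp: elementary_process_def)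
  show "0 \<le> \<tau> i" using mono_onD[OF m(1), of 0 i] m(2) assms by simp
  show "\<tau> i \<le> \<tau> (Suc i)" using mono_onD[OF m(1), of i "Suc i"] assms by simp
  show "bdd_F (\<tau> i) (\<xi> i)" using assms by (auto simp: elementary_process_def bdd_F_def)
qed

lemma elementary_integral_L2:
  assumes "elementary_process M F T k \<tau> \<xi>"
  shows "elementary_integral W k \<tau> \<xi> \<in> borel_measurable M"
    "integrable M (\<lambda>\<omega>. (elementary_integral W k \<tau> \<xi> \<omega>)\<^sup>2)"
proof -
  have *: "(\<lambda>\<omega>. \<xi> i \<omega> * (W (\<tau> (Suc i)) \<omega> - W (\<tau> i) \<omega>)) \<in> borel_measurable M"
    "integrable M (\<lambda>\<omega>. (\<xi> i \<omega> * (W (\<tau> (Suc i)) \<omega> - W (\<tau> i) \<omega>))\<^sup>2)" if "i \<in> {..<k}" for i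
    using that elementary_bdd_F[OF assms, of i]
      bdd_increment_square_integrable[of "\<tau> i" "\<tau> (Suc i)" "\<tau> i" "\<xi> i"] by simp_all
  show "elementary_integral W k \<tau> \<xi> \<in> borel_measurable M"
    unfolding elementary_integral_def[abs_def] by (rule borel_measurable_sum[OF *(1)])
  show "integrable M (\<lambda>\<omega>. (elementary_integral W k \<tau> \<xi> \<omega>)\<^sup>2)"
    unfolding elementary_integral_def by (rule integrable_square_sum[OF *])
qed

lemma elementary_value_measurable:
  assumes "elementary_process M F T k \<tau> \<xi>"
  shows "(\<lambda>(u, \<omega>). elementary_value k \<tau> \<xi> u \<omega>) \<in> borel_measurable (restrict_space lborel A \<Otimes>\<^sub>M M)"
  unfolding elementary_value_def case_prod_unfold
proof (rule borel_measurable_sum)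
  fix i assume "i \<in> {..<k}"
  then have [measurable]: "\<xi> i \<in> borel_measurable M" using bdd_F_M[OF elementary_bdd_F(1)[OF assms]] by simp
  have "(\<lambda>u. u) \<in> borel_measurable (restrict_space lborel A)" by (rule measurable_restrict_space1) simp
  from measurable_compose[OF measurable_fst this]
  have [measurable]: "fst \<in> borel_measurable (restrict_space lborel A \<Otimes>\<^sub>M M)" .
  show "(\<lambda>p. \<xi> i (snd p) * indicator {\<tau> i..<\<tau> (Suc i)} (fst p)) \<in> borel_measurable (restrict_space lborel A \<Otimes>\<^sub>M M)"
    by measurable
qed

text \<open>Some approximating elementary integral lies at finite mean square distance from Y and is
  itself square integrable.\<close>

lemma ito_square_integrable:
  assumes "is_ito_integral M F W H T Y"
  shows "Y \<in> borel_measurable M" "integrable M (\<lambda>\<omega>. (Y \<omega>)\<^sup>2)"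
proof -
  show Y [measurable]: "Y \<in> borel_measurable M" using assms by (auto simp: is_ito_integral_def)
  obtain k \<tau> \<xi> where el: "\<And>n::nat. elementary_process M F T (k n) (\<tau> n) (\<xi> n)"
    and lim: "(\<lambda>n. \<integral>\<^sup>+\<omega>. ennreal ((Y \<omega> - elementary_integral W (k n) (\<tau> n) (\<xi> n) \<omega>)\<^sup>2) \<partial>M) \<longlonglongrightarrow> 0"
    using assms unfolding is_ito_integral_def by blast
  have "\<forall>\<^sub>F n in sequentially. (\<integral>\<^sup>+\<omega>. ennreal ((Y \<omega> - elementary_integral W (k n) (\<tau> n) (\<xi> n) \<omega>)\<^sup>2) \<partial>M) < 1"
    using lim by (rule order_tendstoD) simp
  then obtain n where n: "(\<integral>\<^sup>+\<omega>. ennreal ((Y \<omega> - elementary_integral W (k n) (\<tau> n) (\<xi> n) \<omega>)\<^sup>2) \<partial>M) < 1"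
    by (auto simp: eventually_sequentially)
  define J where "J = elementary_integral W (k n) (\<tau> n) (\<xi> n)"
  have [measurable]: "J \<in> borel_measurable M" and J: "integrable M (\<lambda>\<omega>. (J \<omega>)\<^sup>2)"
    using elementary_integral_L2[OF el] by (auto simp: J_def)
  have "integrable M (\<lambda>\<omega>. (Y \<omega> - J \<omega>)\<^sup>2)"
  proof (rule integrableI_nonneg)
    show "(\<integral>\<^sup>+\<omega>. ennreal ((Y \<omega> - J \<omega>)\<^sup>2) \<partial>M) < \<infinity>"
      using less_trans[OF n ennreal_one_less_top] by (simp add: J_def)
  qed auto
  then have "integrable M (\<lambda>\<omega>. (Y \<omega> - J \<omega> + J \<omega>)\<^sup>2)"
    by (rule integrable_square_add[rotated 2, OF _ J]) measurable
  then show "integrable M (\<lambda>\<omega>. (Y \<omega>)\<^sup>2)" by simp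
qed

lemma nn_integral_restrict_prod:
  assumes f: "f \<in> borel_measurable (restrict_space lborel {0..T} \<Otimes>\<^sub>M M)"
  shows "(\<integral>\<^sup>+p. f p \<partial>(restrict_space lborel {0..T} \<Otimes>\<^sub>M M))
    = (\<integral>\<^sup>+u. (\<integral>\<^sup>+\<omega>. f (u, \<omega>) \<partial>M) * indicator {0..T::real} u \<partial>lborel)"
  using nn_integral_fst[OF f] by (simp add: nn_integral_restrict_space)

text \<open>
  The approximants \<open>J\<close> of \<open>It\<close> are truncated at \<open>s\<close> to \<open>JS\<close>, which does not change the pairing with \<open>Z\<close>;
  by the isometry \<open>JS\<close> has the same limit as the approximants \<open>J'\<close> of \<open>Is\<close>, both approximating \<open>H\<close>
  on \<open>[0, s]\<close>.
\<close>

lemma ito_martingale: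
  assumes s: "0 \<le> s" "s \<le> t"
    and It: "is_ito_integral M F W H t It" and Is: "is_ito_integral M F W H s Is"
    and Z: "Z \<in> borel_measurable (F s)" "integrable M (\<lambda>\<omega>. (Z \<omega>)\<^sup>2)"
  shows "(LINT \<omega>|M. It \<omega> * Z \<omega>) = (LINT \<omega>|M. Is \<omega> * Z \<omega>)"
proof -
  have Zm [measurable]: "Z \<in> borel_measurable M" using F_M Z by blast
  have Hm: "(\<lambda>(u, \<omega>). H u \<omega>) \<in> borel_measurable (restrict_space lborel {0..t} \<Otimes>\<^sub>M M)"
    "(\<lambda>(u, \<omega>). H u \<omega>) \<in> borel_measurable (restrict_space lborel {0..s} \<Otimes>\<^sub>M M)"
    using It Is by (auto simp: is_ito_integral_def)
  note ItL = ito_square_integrable[OF It] and IsL = ito_square_integrable[OF Is]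
  note [measurable] = ItL(1) IsL(1)
  obtain k \<tau> \<xi> where el: "\<And>n::nat. elementary_process M F t (k n) (\<tau> n) (\<xi> n)"
    and Hlim: "(\<lambda>n. \<integral>\<^sup>+(u, \<omega>). ennreal ((H u \<omega> - elementary_value (k n) (\<tau> n) (\<xi> n) u \<omega>)\<^sup>2)
               \<partial>(restrict_space lborel {0..t} \<Otimes>\<^sub>M M)) \<longlonglongrightarrow> 0"
    and lim: "(\<lambda>n. \<integral>\<^sup>+\<omega>. ennreal ((It \<omega> - elementary_integral W (k n) (\<tau> n) (\<xi> n) \<omega>)\<^sup>2) \<partial>M) \<longlonglongrightarrow> 0"
    using It unfolding is_ito_integral_def by blast
  obtain k' \<tau>' \<xi>' where el': "\<And>n::nat. elementary_process M F s (k' n) (\<tau>' n) (\<xi>' n)"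
    and Hlim': "(\<lambda>n. \<integral>\<^sup>+(u, \<omega>). ennreal ((H u \<omega> - elementary_value (k' n) (\<tau>' n) (\<xi>' n) u \<omega>)\<^sup>2)
               \<partial>(restrict_space lborel {0..s} \<Otimes>\<^sub>M M)) \<longlonglongrightarrow> 0"
    and lim': "(\<lambda>n. \<integral>\<^sup>+\<omega>. ennreal ((Is \<omega> - elementary_integral W (k' n) (\<tau>' n) (\<xi>' n) \<omega>)\<^sup>2) \<partial>M) \<longlonglongrightarrow> 0"
    using Is unfolding is_ito_integral_def by blast
  define J where "J n = elementary_integral W (k n) (\<tau> n) (\<xi> n)" for n
  define J' where "J' n = elementary_integral W (k' n) (\<tau>' n) (\<xi>' n)" for n
  define v where "v n u \<omega> = elementary_value (k n) (\<tau> n) (\<xi> n) u \<omega>" for n u \<omega>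
  define v' where "v' n u \<omega> = elementary_value (k' n) (\<tau>' n) (\<xi>' n) u \<omega>" for n u \<omega>
  \<comment> \<open>For an interval starting at or after s, the truncated left end is s, where \<xi>
    need not yet be measurable. Its coefficient is replaced by 0, which loses nothing as the
    truncated interval is empty.\<close>
  define \<zeta> where "\<zeta> n i = (if \<tau> n i < s then \<xi> n i else (\<lambda>_. 0))" for n i
  define JS where "JS n \<omega> = (\<Sum>i<k n. \<zeta> n i \<omega> * (W (min (\<tau> n (Suc i)) s) \<omega> - W (min (\<tau> n i) s) \<omega>))" for n \<omega>
  note e = elementary_bdd_F[OF el] and e' = elementary_bdd_F[OF el']
  have \<tau>'_le: "\<tau>' n (Suc i) \<le> s" if "i < k' n" for n i
    using el'[of n] that mono_onD[of "{..k' n}" "\<tau>' n" "Suc i" "k' n"] by (auto simp: elementary_process_def)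
  have \<zeta>: "bdd_F (min (\<tau> n i) s) (\<zeta> n i)" if "i < k n" for n i
    using e(1)[OF that] by (auto simp: \<zeta>_def bdd_F_0 min_def)
  have \<zeta>_term: "(\<lambda>\<omega>. \<zeta> n i \<omega> * (W (min (\<tau> n (Suc i)) s) \<omega> - W (min (\<tau> n i) s) \<omega>)) \<in> borel_measurable M"
    "integrable M (\<lambda>\<omega>. (\<zeta> n i \<omega> * (W (min (\<tau> n (Suc i)) s) \<omega> - W (min (\<tau> n i) s) \<omega>))\<^sup>2)"
    if "i < k n" for n i
    using bdd_increment_square_integrable[OF _ _ \<zeta>[OF that], of "min (\<tau> n i) s" "min (\<tau> n (Suc i)) s"] e[OF that] s
    by auto
  have J [measurable]: "J n \<in> borel_measurable M" and Jsq: "integrable M (\<lambda>\<omega>. (J n \<omega>)\<^sup>2)" for n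
    using elementary_integral_L2[OF el[of n]] by (auto simp: J_def)
  have J' [measurable]: "J' n \<in> borel_measurable M" and Jsq': "integrable M (\<lambda>\<omega>. (J' n \<omega>)\<^sup>2)" for n
    using elementary_integral_L2[OF el'[of n]] by (auto simp: J'_def)
  have JS [measurable]: "JS n \<in> borel_measurable M" for n
    unfolding JS_def[abs_def] by (rule borel_measurable_sum) (simp add: \<zeta>_term)
  have JSsq: "integrable M (\<lambda>\<omega>. (JS n \<omega>)\<^sup>2)" for n
    unfolding JS_def by (rule integrable_square_sum) (simp_all add: \<zeta>_term)
  have JZ: "(LINT \<omega>|M. J n \<omega> * Z \<omega>) = (LINT \<omega>|M. JS n \<omega> * Z \<omega>)" for n
  proof -
    have Z1: "integrable M Z" using square_integrable_imp_integrable[OF Zm Z(2)] .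
    have \<xi>Z: "integrable M (\<lambda>\<omega>. (\<xi> n i \<omega> * (W (\<tau> n (Suc i)) \<omega> - W (\<tau> n i) \<omega>)) * Z \<omega>)" if "i < k n" for i
      using bdd_increment_square_integrable[OF e(2)[OF that] e(3)[OF that] e(1)[OF that]]
      by (rule integrable_mult_of_squares[OF _ Zm _ Z(2)])
    have \<zeta>Z: "integrable M (\<lambda>\<omega>. (\<zeta> n i \<omega> * (W (min (\<tau> n (Suc i)) s) \<omega> - W (min (\<tau> n i) s) \<omega>)) * Z \<omega>)"
      if "i < k n" for i
      using \<zeta>_term[OF that] by (rule integrable_mult_of_squares[OF _ Zm _ Z(2)])
    have part: "(LINT \<omega>|M. (\<xi> n i \<omega> * (W (\<tau> n (Suc i)) \<omega> - W (\<tau> n i) \<omega>)) * Z \<omega>)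
      = (LINT \<omega>|M. (\<zeta> n i \<omega> * (W (min (\<tau> n (Suc i)) s) \<omega> - W (min (\<tau> n i) s) \<omega>)) * Z \<omega>)"
      if i: "i < k n" for i
    proof -
      \<comment> \<open>Increments after s are invisible to Z: both factors \<xi> and Z are
        measurable at time a, so their product is independent of the mean-zero increment from a to
        b. An interval straddling s is cut there and only its second half is dropped.\<close>
      have zero: "(LINT \<omega>|M. (\<xi> n i \<omega> * Z \<omega>) * (W b \<omega> - W a \<omega>)) = 0"
        "integrable M (\<lambda>\<omega>. (\<xi> n i \<omega> * Z \<omega>) * (W b \<omega> - W a \<omega>))"
        if "\<tau> n i \<le> a" "s \<le> a" "a \<le> b" for a b
      proof -
        have a0: "0 \<le> a" using s that by simp
        have [measurable]: "Z \<in> borel_measurable (F a)" "\<xi> n i \<in> borel_measurable (F a)"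
          using F_mono[OF that(2) Z(1)] bdd_F_mono[OF that(1) e(1)[OF i]] by (simp_all add: bdd_F_def)
        have m: "(\<lambda>\<omega>. \<xi> n i \<omega> * Z \<omega>) \<in> borel_measurable (F a)" by measurable
        note mult_increment[OF a0 that(3) m bdd_F_mult_integrable[OF e(1)[OF i] Z1]]
        then show "(LINT \<omega>|M. (\<xi> n i \<omega> * Z \<omega>) * (W b \<omega> - W a \<omega>)) = 0"
          "integrable M (\<lambda>\<omega>. (\<xi> n i \<omega> * Z \<omega>) * (W b \<omega> - W a \<omega>))" by simp_all
      qed
      consider "\<tau> n (Suc i) \<le> s" "\<tau> n i < s" | "s \<le> \<tau> n i" | "\<tau> n i < s" "s < \<tau> n (Suc i)" by linarith
      then show ?thesis
      proof cases
        case 1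
        then show ?thesis by (simp add: \<zeta>_def)
      next
        case 2
        then show ?thesis using zero[of "\<tau> n i" "\<tau> n (Suc i)"] e(3)[OF i] by (simp add: \<zeta>_def ac_simps)
      next
        case 3
        have "integrable M (\<lambda>\<omega>. (\<xi> n i \<omega> * (W s \<omega> - W (\<tau> n i) \<omega>)) * Z \<omega>)"
          using bdd_increment_square_integrable[OF e(2)[OF i] less_imp_le[OF 3(1)] e(1)[OF i]]
          by (rule integrable_mult_of_squares[OF _ Zm _ Z(2)])
        moreover have "(\<xi> n i \<omega> * (W (\<tau> n (Suc i)) \<omega> - W (\<tau> n i) \<omega>)) * Z \<omega> =
          (\<xi> n i \<omega> * Z \<omega>) * (W (\<tau> n (Suc i)) \<omega> - W s \<omega>) + (\<xi> n i \<omega> * (W s \<omega> - W (\<tau> n i) \<omega>)) * Z \<omega>" for \<omega>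
          by (simp add: algebra_simps)
        ultimately show ?thesis using zero[of s "\<tau> n (Suc i)"] 3 by (simp add: \<zeta>_def)
      qed
    qed
    have "(LINT \<omega>|M. J n \<omega> * Z \<omega>) = (\<Sum>i<k n. LINT \<omega>|M. (\<xi> n i \<omega> * (W (\<tau> n (Suc i)) \<omega> - W (\<tau> n i) \<omega>)) * Z \<omega>)"
      unfolding J_def elementary_integral_def sum_distrib_right
      by (rule Bochner_Integration.integral_sum) (simp add: \<xi>Z)
    also have "\<dots> = (\<Sum>i<k n. LINT \<omega>|M. (\<zeta> n i \<omega> * (W (min (\<tau> n (Suc i)) s) \<omega> - W (min (\<tau> n i) s) \<omega>)) * Z \<omega>)"
      using part by (intro sum.cong) auto
    also have "\<dots> = (LINT \<omega>|M. JS n \<omega> * Z \<omega>)"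
      unfolding JS_def sum_distrib_right
      by (rule Bochner_Integration.integral_sum[symmetric]) (simp add: \<zeta>Z)
    finally show ?thesis .
  qed
  have vm: "(\<lambda>(u, \<omega>). v n u \<omega>) \<in> borel_measurable (restrict_space lborel {0..T} \<Otimes>\<^sub>M M)"
    and vm': "(\<lambda>(u, \<omega>). v' n u \<omega>) \<in> borel_measurable (restrict_space lborel {0..T} \<Otimes>\<^sub>M M)" for n T
    unfolding v_def v'_def by (rule elementary_value_measurable[OF el], rule elementary_value_measurable[OF el'])
  define A where "A n = (\<integral>\<^sup>+(u, \<omega>). ennreal ((H u \<omega> - v n u \<omega>)\<^sup>2) \<partial>(restrict_space lborel {0..t} \<Otimes>\<^sub>M M))" for n
  define A' where "A' n = (\<integral>\<^sup>+(u, \<omega>). ennreal ((H u \<omega> - v' n u \<omega>)\<^sup>2) \<partial>(restrict_space lborel {0..s} \<Otimes>\<^sub>M M))" for n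
  have bound: "(\<integral>\<^sup>+\<omega>. ennreal ((JS n \<omega> - J' n \<omega>)\<^sup>2) \<partial>M) \<le> 2 * A n + 2 * A' n" for n
  proof -
    \<comment> \<open>The disjoint sum of the two index sets, with the coefficients of the second
      family negated, presents \<open>JS n\<close> - \<open>J' n\<close> as one elementary sum over
      overlapping intervals, the form required by \<open>elementary_isometry\<close>.\<close>
    define a where "a = case_sum (\<lambda>i. min (\<tau> n i) s) (\<tau>' n)"
    define b where "b = case_sum (\<lambda>i. min (\<tau> n (Suc i)) s) (\<lambda>i. \<tau>' n (Suc i))"
    define x where "x = case_sum (\<zeta> n) (\<lambda>i \<omega>. - \<xi>' n i \<omega>)"
    define I where "I = {..<k n} <+> {..<k' n}"
    note vm[of n, measurable] vm'[of n, measurable] Hm[measurable]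
    have Jeq: "JS n \<omega> - J' n \<omega> = (\<Sum>i\<in>I. x i \<omega> * (W (b i) \<omega> - W (a i) \<omega>))" for \<omega>
      by (simp add: I_def sum.Plus a_def b_def x_def JS_def J'_def elementary_integral_def sum_negf)
    have veq: "v n u \<omega> - v' n u \<omega> = (\<Sum>i\<in>I. x i \<omega> * indicator {a i..<b i} u)" if "u < s" for u \<omega>
    proof -
      have "\<xi> n i \<omega> * indicator {\<tau> n i..<\<tau> n (Suc i)} u =
        \<zeta> n i \<omega> * indicator {min (\<tau> n i) s..<min (\<tau> n (Suc i)) s} u" for i
        using that by (auto simp: \<zeta>_def indicator_def)
      moreover have "(\<Sum>i\<in>I. x i \<omega> * indicator {a i..<b i} u) =
          (\<Sum>i<k n. \<zeta> n i \<omega> * indicator {min (\<tau> n i) s..<min (\<tau> n (Suc i)) s} u) +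
          (\<Sum>i<k' n. - (\<xi>' n i \<omega> * indicator {\<tau>' n i..<\<tau>' n (Suc i)} u))"
        by (simp only: I_def sum.Plus finite_lessThan comp_def a_def b_def x_def sum.case mult_minus_left)
      ultimately show ?thesis
        by (simp only: v_def v'_def elementary_value_def sum_negf diff_conv_add_uminus)
    qed
    \<comment> \<open>All intervals lie in [0, s), so the isometry's integral over the whole line
      only sees times at which both families approximate H.\<close>
    have zero: "(\<Sum>i\<in>I. x i \<omega> * indicator {a i..<b i} u) = 0" if "u \<notin> {0..<s}" for u \<omega>
    proof (rule sum.neutral, rule ballI)
      fix i assume "i \<in> I"
      then have "0 \<le> a i" "b i \<le> s"
        using s e(2) e'(2) \<tau>'_le by (auto simp: I_def a_def b_def)
      then show "x i \<omega> * indicator {a i..<b i} u = 0" using that by (auto simp: indicator_def)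
    qed
    have "(\<integral>\<^sup>+\<omega>. ennreal ((JS n \<omega> - J' n \<omega>)\<^sup>2) \<partial>M)
      = (\<integral>\<^sup>+u. (\<integral>\<^sup>+\<omega>. ennreal ((\<Sum>i\<in>I. x i \<omega> * indicator {a i..<b i} u)\<^sup>2) \<partial>M) \<partial>lborel)"
      unfolding Jeq
    proof (rule elementary_isometry)
      show "finite I" by (simp add: I_def)
      show "0 \<le> a i \<and> a i \<le> b i" if "i \<in> I" for i
        using that s e(2,3) e'(2,3) by (auto simp: I_def a_def b_def min_le_iff_disj)
      show "bdd_F (a i) (x i)" if "i \<in> I" for i
        using that \<zeta> e'(1) by (auto simp: I_def a_def x_def intro!: bdd_F_uminus)
    qed
    also have "\<dots> \<le> (\<integral>\<^sup>+u. 2 * ((\<integral>\<^sup>+\<omega>. ennreal ((H u \<omega> - v n u \<omega>)\<^sup>2) \<partial>M) * indicator {0..t} u) +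
        2 * ((\<integral>\<^sup>+\<omega>. ennreal ((H u \<omega> - v' n u \<omega>)\<^sup>2) \<partial>M) * indicator {0..s} u) \<partial>lborel)"
    proof (rule nn_integral_mono)
      fix u :: real
      show "(\<integral>\<^sup>+\<omega>. ennreal ((\<Sum>i\<in>I. x i \<omega> * indicator {a i..<b i} u)\<^sup>2) \<partial>M) \<le>
        2 * ((\<integral>\<^sup>+\<omega>. ennreal ((H u \<omega> - v n u \<omega>)\<^sup>2) \<partial>M) * indicator {0..t} u) +
        2 * ((\<integral>\<^sup>+\<omega>. ennreal ((H u \<omega> - v' n u \<omega>)\<^sup>2) \<partial>M) * indicator {0..s} u)"
      proof (cases "u \<in> {0..<s}")
        case True
        then have us: "u \<in> space (restrict_space lborel {0..s})" by (simp add: space_restrict_space)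
        have [measurable]: "H u \<in> borel_measurable M" "v n u \<in> borel_measurable M" "v' n u \<in> borel_measurable M"
          using measurable_compose[OF measurable_Pair1'[OF us] Hm(2)]
            measurable_compose[OF measurable_Pair1'[OF us] vm]
            measurable_compose[OF measurable_Pair1'[OF us] vm'] by simp_all
        have "(\<integral>\<^sup>+\<omega>. ennreal ((\<Sum>i\<in>I. x i \<omega> * indicator {a i..<b i} u)\<^sup>2) \<partial>M)
          = (\<integral>\<^sup>+\<omega>. ennreal ((v n u \<omega> - v' n u \<omega>)\<^sup>2) \<partial>M)"
          using True veq[of u] by simp
        also have "\<dots> \<le> (\<integral>\<^sup>+\<omega>. 2 * ennreal ((H u \<omega> - v n u \<omega>)\<^sup>2) + 2 * ennreal ((H u \<omega> - v' n u \<omega>)\<^sup>2) \<partial>M)"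
        proof (rule nn_integral_mono)
          fix \<omega>
          have "ennreal ((v n u \<omega> - v' n u \<omega>)\<^sup>2) \<le> ennreal (2 * (H u \<omega> - v n u \<omega>)\<^sup>2 + 2 * (H u \<omega> - v' n u \<omega>)\<^sup>2)"
            by (intro ennreal_leI square_diff_le)
          then show "ennreal ((v n u \<omega> - v' n u \<omega>)\<^sup>2) \<le>
            2 * ennreal ((H u \<omega> - v n u \<omega>)\<^sup>2) + 2 * ennreal ((H u \<omega> - v' n u \<omega>)\<^sup>2)"
            by (simp add: ennreal_plus ennreal_mult)
        qed
        also have "\<dots> = 2 * (\<integral>\<^sup>+\<omega>. ennreal ((H u \<omega> - v n u \<omega>)\<^sup>2) \<partial>M) + 2 * (\<integral>\<^sup>+\<omega>. ennreal ((H u \<omega> - v' n u \<omega>)\<^sup>2) \<partial>M)"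
          by (simp add: nn_integral_add nn_integral_cmult)
        finally show ?thesis using True s by (simp add: indicator_def)
      qed (simp add: zero)
    qed
    also have "\<dots> = 2 * A n + 2 * A' n"
    proof -
      have 1: "A n = (\<integral>\<^sup>+u. (\<integral>\<^sup>+\<omega>. ennreal ((H u \<omega> - v n u \<omega>)\<^sup>2) \<partial>M) * indicator {0..t} u \<partial>lborel)"
        unfolding A_def using vm[of n t] Hm(1)
        by (subst nn_integral_restrict_prod) (auto simp: case_prod_unfold)
      have 2: "A' n = (\<integral>\<^sup>+u. (\<integral>\<^sup>+\<omega>. ennreal ((H u \<omega> - v' n u \<omega>)\<^sup>2) \<partial>M) * indicator {0..s} u \<partial>lborel)"
        unfolding A'_def using vm'[of n s] Hm(2)
        by (subst nn_integral_restrict_prod) (auto simp: case_prod_unfold)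
      have m: "(\<lambda>u. (\<integral>\<^sup>+\<omega>. ennreal ((H u \<omega> - w u \<omega>)\<^sup>2) \<partial>M) * indicator {0..T} u) \<in> borel_measurable lborel"
        if "(\<lambda>(u, \<omega>). w u \<omega>) \<in> borel_measurable (restrict_space lborel {0..T} \<Otimes>\<^sub>M M)"
          "(\<lambda>(u, \<omega>). H u \<omega>) \<in> borel_measurable (restrict_space lborel {0..T} \<Otimes>\<^sub>M M)" for T :: real and w
      proof -
        note [measurable] = that
        have "(\<lambda>(u, \<omega>). ennreal ((H u \<omega> - w u \<omega>)\<^sup>2)) \<in> borel_measurable (restrict_space lborel {0..T} \<Otimes>\<^sub>M M)"
          by measurable
        from borel_measurable_nn_integral[OF this]
        have "(\<lambda>u. \<integral>\<^sup>+\<omega>. ennreal ((H u \<omega> - w u \<omega>)\<^sup>2) \<partial>M) \<in> borel_measurable (restrict_space lborel {0..T})" .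
        then show ?thesis by (subst (asm) borel_measurable_restrict_space_iff_ennreal) auto
      qed
      show ?thesis
        unfolding 1 2 using m[OF vm Hm(1)] m[OF vm' Hm(2)] by (simp add: nn_integral_add nn_integral_cmult)
    qed
    finally show ?thesis .
  qed
  have A: "A \<longlonglongrightarrow> 0" "A' \<longlonglongrightarrow> 0"
    using Hlim Hlim' by (simp_all only: A_def[abs_def] A'_def[abs_def] v_def v'_def)
  have "(\<lambda>n. 2 * A n + 2 * A' n) \<longlonglongrightarrow> 2 * 0 + 2 * 0"
    by (rule tendsto_add[OF ennreal_tendsto_cmult[OF _ A(1)] ennreal_tendsto_cmult[OF _ A(2)]]) simp_all
  then have "(\<lambda>n. 2 * A n + 2 * A' n) \<longlonglongrightarrow> 0" by simp
  then have "(\<lambda>n. \<integral>\<^sup>+\<omega>. ennreal ((JS n \<omega> - J' n \<omega>)\<^sup>2) \<partial>M) \<longlonglongrightarrow> 0"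
    by (rule tendsto_sandwich[OF always_eventually always_eventually tendsto_const, rotated 2])
      (simp_all add: bound)
  then have L1: "(\<lambda>n. LINT \<omega>|M. (JS n \<omega> - J' n \<omega>) * Z \<omega>) \<longlonglongrightarrow> 0"
    by (rule mult_L2_null[OF _ Zm Z(2), rotated]) measurable
  have L2: "(\<lambda>n. LINT \<omega>|M. (It \<omega> - J n \<omega>) * Z \<omega>) \<longlonglongrightarrow> 0"
    by (rule mult_L2_null[OF _ Zm Z(2) lim[folded J_def]]) measurable
  have L3: "(\<lambda>n. LINT \<omega>|M. (Is \<omega> - J' n \<omega>) * Z \<omega>) \<longlonglongrightarrow> 0"
    by (rule mult_L2_null[OF _ Zm Z(2) lim'[folded J'_def]]) measurable
  have int: "integrable M (\<lambda>\<omega>. f \<omega> * Z \<omega>)"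
    if "f \<in> borel_measurable M" "integrable M (\<lambda>\<omega>. (f \<omega>)\<^sup>2)" for f
    by (rule integrable_mult_of_squares[OF that(1) Zm that(2) Z(2)])
  have diff: "(LINT \<omega>|M. (f \<omega> - g \<omega>) * Z \<omega>) = (LINT \<omega>|M. f \<omega> * Z \<omega>) - (LINT \<omega>|M. g \<omega> * Z \<omega>)"
    if "integrable M (\<lambda>\<omega>. f \<omega> * Z \<omega>)" "integrable M (\<lambda>\<omega>. g \<omega> * Z \<omega>)" for f g
    using that by (simp add: left_diff_distrib)
  \<comment> \<open>Telescoping after pairing with Z: \<open>J n\<close> may be exchanged for
    \<open>JS n\<close>, and the three remaining differences all tend to 0 in mean square.\<close>
  have "(LINT \<omega>|M. It \<omega> * Z \<omega>) - (LINT \<omega>|M. Is \<omega> * Z \<omega>) =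
    (LINT \<omega>|M. (It \<omega> - J n \<omega>) * Z \<omega>) + (LINT \<omega>|M. (JS n \<omega> - J' n \<omega>) * Z \<omega>) - (LINT \<omega>|M. (Is \<omega> - J' n \<omega>) * Z \<omega>)" for n
    using int[OF ItL] int[OF IsL] int[OF J Jsq] int[OF J' Jsq'] int[OF JS JSsq] JZ[of n] by (simp add: diff)
  moreover have "(\<lambda>n. (LINT \<omega>|M. (It \<omega> - J n \<omega>) * Z \<omega>) + (LINT \<omega>|M. (JS n \<omega> - J' n \<omega>) * Z \<omega>) -
      (LINT \<omega>|M. (Is \<omega> - J' n \<omega>) * Z \<omega>)) \<longlonglongrightarrow> 0 + 0 - 0"
    by (intro tendsto_intros L1 L2 L3)
  ultimately have "(\<lambda>n::nat. (LINT \<omega>|M. It \<omega> * Z \<omega>) - (LINT \<omega>|M. Is \<omega> * Z \<omega>)) \<longlonglongrightarrow> 0" by simp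
  then show ?thesis by (simp add: LIMSEQ_const_iff)
qed

end

section \<open>Covariance of a diffusion with linear drift\<close>

text \<open>On [0, s] the function is merely integrable, and its integral there is absorbed into the
  constant. On [s, t] the equation bootstraps: the indefinite integral is continuous, hence so is f,
  hence f is differentiable with f' = a f, and f(x) exp(-a x) is constant.\<close>

lemma exponential_of_integral_equation:
  fixes f :: "real \<Rightarrow> real"
  assumes s: "0 \<le> s" "s \<le> t"
    and int: "set_integrable lborel {0..t} f"
    and eq: "\<And>x. s \<le> x \<Longrightarrow> x \<le> t \<Longrightarrow> f x = C + a * (LINT u:{0..x}|lborel. f u)"
  shows "f t = f s * exp (a * (t - s))"
proof -
  have sub: "set_integrable lborel A f" if "A \<subseteq> {0..t}" "A \<in> sets borel" for A
    using set_integrable_subset[OF int] that by auto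
  have HK: "f integrable_on {0..t}" using set_borel_integral_eq_integral(1)[OF int] .
  have HKs: "f integrable_on {s..t}"
    using set_borel_integral_eq_integral(1)[OF sub[of "{s..t}"]] s by auto
  define C' where "C' = C + a * integral {0..s} f"
  have eq': "f x = C' + a * integral {s..x} f" if x: "x \<in> {s..t}" for x
  proof -
    have "(LINT u:{0..x}|lborel. f u) = integral {0..x} f"
      using x s by (intro set_borel_integral_eq_integral(2) sub) auto
    also have "\<dots> = integral {0..s} f + integral {s..x} f"
      using x s integrable_subinterval_real[OF HK, of 0 x]
      by (intro Henstock_Kurzweil_Integration.integral_combine[symmetric]) auto
    finally show ?thesis using eq[of x] x by (simp add: C'_def algebra_simps)
  qed
  have cont: "continuous_on {s..t} f"
  proof -
    have "continuous_on {s..t} (\<lambda>x. C' + a * integral {s..x} f)"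
      by (intro continuous_intros indefinite_integral_continuous_1 HKs)
    then show ?thesis by (rule continuous_on_cong[THEN iffD1, OF refl, rotated]) (simp add: eq')
  qed
  have der: "(f has_real_derivative a * f x) (at x within {s..t})" if x: "x \<in> {s..t}" for x
  proof -
    have "((\<lambda>x. C' + a * integral {s..x} f) has_real_derivative a * f x) (at x within {s..t})"
      by (auto intro!: derivative_eq_intros integral_has_real_derivative[OF cont x])
    then show ?thesis
      unfolding has_field_derivative_def
      by (rule has_derivative_transform[OF x, rotated]) (simp add: eq')
  qed
  have "((\<lambda>x. f x * exp (- a * x)) has_real_derivative 0) (at x within {s..t})" if x: "x \<in> {s..t}" for x
    by (rule derivative_eq_intros der[OF x] refl)+ (simp add: algebra_simps)
  then obtain c where "\<forall>x\<in>{s..t}. f x * exp (- a * x) = c"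
    using has_field_derivative_zero_constant[of "{s..t}" "\<lambda>x. f x * exp (- a * x)"] by auto
  then have "f t * exp (- a * t) = f s * exp (- a * s)" using s by simp
  then have "f t * exp (- a * t) * exp (a * t) = f s * exp (- a * s) * exp (a * t)" by simp
  then show ?thesis by (simp add: mult.assoc exp_add[symmetric] algebra_simps)
qed

context brownian
begin

lemma linear_drift_covariance:
  assumes sde: "sde_solution M F W (\<lambda>x. a0 + a1 * x) \<sigma> X"
    and sq: "\<And>t. t \<ge> 0 \<Longrightarrow> integrable M (\<lambda>\<omega>. (X t \<omega>)\<^sup>2)"
    and sqK: "\<And>t. t \<ge> 0 \<Longrightarrow> (LINT \<omega>|M. (X t \<omega>)\<^sup>2) = K"
    and mean: "\<And>t. t \<ge> 0 \<Longrightarrow> (LINT \<omega>|M. X t \<omega>) = \<mu>"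
    and st: "0 \<le> s" "s \<le> t"
  shows "(LINT \<omega>|M. (X t \<omega> - \<mu>) * (X s \<omega> - \<mu>)) = (LINT \<omega>|M. (X s \<omega> - \<mu>)\<^sup>2) * exp (a1 * (t - s))"
proof -
  interpret P: pair_sigma_finite lborel M ..
  have XF: "X u \<in> borel_measurable (F u)" if "u \<ge> 0" for u using sde that by (simp add: sde_solution_def)
  have Xm: "X u \<in> borel_measurable M" if "u \<ge> 0" for u using F_M[OF XF[OF that]] .
  have cont: "continuous_on {0..} (\<lambda>u. X u \<omega>)" if "\<omega> \<in> space M" for \<omega> using sde that by (simp add: sde_solution_def)
  obtain I where ito: "\<And>u. u \<ge> 0 \<Longrightarrow> is_ito_integral M F W (\<lambda>u \<omega>. \<sigma> (X u \<omega>)) u (I u)"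
    and eqn: "\<And>u. u \<ge> 0 \<Longrightarrow> AE \<omega> in M. X u \<omega> = X 0 \<omega> + (LINT v:{0..u}|lborel. a0 + a1 * X v \<omega>) + I u \<omega>"
    using sde unfolding sde_solution_def by blast
  have J [measurable]: "(\<lambda>(u, \<omega>). X (max 0 u) \<omega>) \<in> borel_measurable (borel \<Otimes>\<^sub>M M)"
  proof (rule joint_measurable_right_continuous[OF Xm])
    fix \<omega> and u :: real assume "\<omega> \<in> space M" "u \<ge> 0"
    then have "((\<lambda>u. X u \<omega>) \<longlongrightarrow> X u \<omega>) (at u within {0..})"
      using cont[of \<omega>] by (auto simp: continuous_on)
    then show "((\<lambda>u. X u \<omega>) \<longlongrightarrow> X u \<omega>) (at_right u)"
      by (rule tendsto_within_subset) (use \<open>u \<ge> 0\<close> in auto)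
  qed
  define Z where "Z \<omega> = X s \<omega> - \<mu>" for \<omega>
  have ZF: "Z \<in> borel_measurable (F s)" unfolding Z_def using XF[OF st(1)] by measurable
  have Zm [measurable]: "Z \<in> borel_measurable M" using F_M[OF ZF] .
  have Z2: "integrable M (\<lambda>\<omega>. (Z \<omega>)\<^sup>2)"
    using integrable_square_add[OF Xm[OF st(1)] _ sq[OF st(1)], of "\<lambda>_. - \<mu>"] by (simp add: Z_def)
  have Z1: "integrable M Z" using square_integrable_imp_integrable[OF Zm Z2] .
  have X1: "integrable M (X u)" if "u \<ge> 0" for u using square_integrable_imp_integrable[OF Xm[OF that] sq[OF that]] .
  have Z0: "(LINT \<omega>|M. Z \<omega>) = 0" using X1[OF st(1)] mean[OF st(1)] prob_space by (simp add: Z_def)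
  have XZ: "integrable M (\<lambda>\<omega>. X u \<omega> * Z \<omega>)" if "u \<ge> 0" for u
    by (rule integrable_mult_of_squares[OF Xm[OF that] Zm sq[OF that] Z2])
  define f where "f u = (LINT \<omega>|M. X (max 0 u) \<omega> * Z \<omega>)" for u
  \<comment> \<open>The coefficients are kept general because two choices occur: p = 0, q = 1 gives
    integrability of the covariance function f, and p = a0, q = a1 gives the drift term.\<close>
  define g where "g p q T u \<omega> = indicator {0..T} u * ((p + q * X (max 0 u) \<omega>) * Z \<omega>)" for p q T u \<omega>
  have gint: "integrable (lborel \<Otimes>\<^sub>M M) (\<lambda>(u, \<omega>). g p q T u \<omega>)" if "T \<ge> 0" for p q T
  proof (rule integrableI_bounded)
    show m: "(\<lambda>(u, \<omega>). g p q T u \<omega>) \<in> borel_measurable (lborel \<Otimes>\<^sub>M M)" unfolding g_def by measurable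
    \<comment> \<open>A bound independent of u: stationarity fixes the second moment of X_u at K.
      This makes the integrand integrable on [0, T] times the sample space, as Fubini
      requires.\<close>
    define B where "B = \<bar>p\<bar> * (LINT \<omega>|M. \<bar>Z \<omega>\<bar>) + \<bar>q\<bar> * (K + (LINT \<omega>|M. (Z \<omega>)\<^sup>2))"
    have "(\<integral>\<^sup>+x. ennreal (norm (case x of (u, \<omega>) \<Rightarrow> g p q T u \<omega>)) \<partial>(lborel \<Otimes>\<^sub>M M))
      = (\<integral>\<^sup>+u. (\<integral>\<^sup>+\<omega>. ennreal (norm (g p q T u \<omega>)) \<partial>M) \<partial>lborel)"
      using m by (subst nn_integral_fst[symmetric]) auto
    also have "\<dots> \<le> (\<integral>\<^sup>+u. ennreal B * indicator {0..T} u \<partial>lborel)"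
    proof (rule nn_integral_mono)
      fix u :: real
      show "(\<integral>\<^sup>+\<omega>. ennreal (norm (g p q T u \<omega>)) \<partial>M) \<le> ennreal B * indicator {0..T} u"
      proof (cases "u \<in> {0..T}")
        case True
        then have u: "u \<ge> 0" by simp
        have dom: "integrable M (\<lambda>\<omega>. \<bar>p\<bar> * \<bar>Z \<omega>\<bar> + \<bar>q\<bar> * ((X u \<omega>)\<^sup>2 + (Z \<omega>)\<^sup>2))"
          using Z1 Z2 sq[OF u] by auto
        have "(\<integral>\<^sup>+\<omega>. ennreal (norm (g p q T u \<omega>)) \<partial>M) \<le> (\<integral>\<^sup>+\<omega>. ennreal (\<bar>p\<bar> * \<bar>Z \<omega>\<bar> + \<bar>q\<bar> * ((X u \<omega>)\<^sup>2 + (Z \<omega>)\<^sup>2)) \<partial>M)"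
        proof (intro nn_integral_mono ennreal_leI)
          fix \<omega>
          have le: "\<bar>X u \<omega>\<bar> * \<bar>Z \<omega>\<bar> \<le> (X u \<omega>)\<^sup>2 + (Z \<omega>)\<^sup>2"
          proof -
            have "0 \<le> \<bar>X u \<omega>\<bar> * \<bar>Z \<omega>\<bar>" by simp
            moreover have "2 * (\<bar>X u \<omega>\<bar> * \<bar>Z \<omega>\<bar>) \<le> (X u \<omega>)\<^sup>2 + (Z \<omega>)\<^sup>2"
              using sum_squares_bound[of "\<bar>X u \<omega>\<bar>" "\<bar>Z \<omega>\<bar>"] by (simp add: mult.assoc)
            ultimately show ?thesis by linarith
          qed
          have "norm (g p q T u \<omega>) = \<bar>p * Z \<omega> + q * (X u \<omega> * Z \<omega>)\<bar>"
            using True by (simp add: g_def algebra_simps)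
          also have "\<dots> \<le> \<bar>p\<bar> * \<bar>Z \<omega>\<bar> + \<bar>q\<bar> * (\<bar>X u \<omega>\<bar> * \<bar>Z \<omega>\<bar>)"
            using abs_triangle_ineq[of "p * Z \<omega>" "q * (X u \<omega> * Z \<omega>)"] by (simp add: abs_mult)
          also have "\<dots> \<le> \<bar>p\<bar> * \<bar>Z \<omega>\<bar> + \<bar>q\<bar> * ((X u \<omega>)\<^sup>2 + (Z \<omega>)\<^sup>2)"
            using le by (intro add_left_mono mult_left_mono) auto
          finally show "norm (g p q T u \<omega>) \<le> \<bar>p\<bar> * \<bar>Z \<omega>\<bar> + \<bar>q\<bar> * ((X u \<omega>)\<^sup>2 + (Z \<omega>)\<^sup>2)" .
        qed
        also have "\<dots> = ennreal (LINT \<omega>|M. \<bar>p\<bar> * \<bar>Z \<omega>\<bar> + \<bar>q\<bar> * ((X u \<omega>)\<^sup>2 + (Z \<omega>)\<^sup>2))"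
          by (rule nn_integral_eq_integral[OF dom]) auto
        also have "(LINT \<omega>|M. \<bar>p\<bar> * \<bar>Z \<omega>\<bar> + \<bar>q\<bar> * ((X u \<omega>)\<^sup>2 + (Z \<omega>)\<^sup>2)) = B"
          using Z1 Z2 sq[OF u] sqK[OF u] by (simp add: B_def)
        finally show ?thesis using True by simp
      qed (simp add: g_def)
    qed
    also have "\<dots> < \<infinity>" using that by (subst nn_integral_cmult_indicator) (auto simp: ennreal_mult_less_top)
    finally show "(\<integral>\<^sup>+x. ennreal (norm (case x of (u, \<omega>) \<Rightarrow> g p q T u \<omega>)) \<partial>(lborel \<Otimes>\<^sub>M M)) < \<infinity>" .
  qed
  \<comment> \<open>Z is centred, so the constant coefficient p, and with it a0, disappears from the
    equation.\<close>
  have g_inner: "(LINT \<omega>|M. g p q T u \<omega>) = indicator {0..T} u * (q * f u)" for p q T u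
  proof -
    have "(LINT \<omega>|M. (p + q * X (max 0 u) \<omega>) * Z \<omega>) = (LINT \<omega>|M. p * Z \<omega> + q * (X (max 0 u) \<omega> * Z \<omega>))"
      by (simp add: algebra_simps)
    also have "\<dots> = q * f u" using Z1 Z0 XZ[of "max 0 u"] by (simp add: f_def)
    finally show ?thesis by (simp add: g_def)
  qed
  have f_int: "set_integrable lborel {0..T} f" if "T \<ge> 0" for T
    using P.integrable_fst[OF gint[OF that, of 0 1]] by (simp add: g_inner set_integrable_def)
  have f_eq: "f T = ((LINT \<omega>|M. X 0 \<omega> * Z \<omega>) + (LINT \<omega>|M. I s \<omega> * Z \<omega>)) + a1 * (LINT u:{0..T}|lborel. f u)"
    if T: "s \<le> T" for T
  proof -
    have T0: "T \<ge> 0" using T st by simp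
    have IL: "I T \<in> borel_measurable M" "integrable M (\<lambda>\<omega>. (I T \<omega>)\<^sup>2)" using ito_square_integrable[OF ito[OF T0]] by auto
    have IZ: "integrable M (\<lambda>\<omega>. I T \<omega> * Z \<omega>)" by (rule integrable_mult_of_squares[OF IL(1) Zm IL(2) Z2])
    have G: "integrable M (\<lambda>\<omega>. LINT u|lborel. g a0 a1 T u \<omega>)" using P.integrable_snd[OF gint[OF T0, of a0 a1]] .
    have AE: "AE \<omega> in M. X T \<omega> * Z \<omega> = X 0 \<omega> * Z \<omega> + (LINT u|lborel. g a0 a1 T u \<omega>) + I T \<omega> * Z \<omega>"
      using eqn[OF T0]
    proof eventually_elim
      case (elim \<omega>)
      have "(LINT u|lborel. g a0 a1 T u \<omega>) = (LINT u|lborel. (indicator {0..T} u * (a0 + a1 * X u \<omega>)) * Z \<omega>)"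
        by (intro Bochner_Integration.integral_cong) (auto simp: g_def indicator_def)
      also have "\<dots> = (LINT v:{0..T}|lborel. a0 + a1 * X v \<omega>) * Z \<omega>"
        by (simp add: set_lebesgue_integral_def)
      finally show ?case by (subst elim) (simp add: algebra_simps)
    qed
    have "f T = (LINT \<omega>|M. X 0 \<omega> * Z \<omega> + (LINT u|lborel. g a0 a1 T u \<omega>) + I T \<omega> * Z \<omega>)"
      unfolding f_def using T0 AE XZ[of 0] XZ[OF T0] G IZ by (intro integral_cong_AE) auto
    also have "\<dots> = (LINT \<omega>|M. X 0 \<omega> * Z \<omega>) + (LINT \<omega>|M. LINT u|lborel. g a0 a1 T u \<omega>) + (LINT \<omega>|M. I T \<omega> * Z \<omega>)"
      using XZ[of 0] G IZ by simp
    also have "(LINT \<omega>|M. LINT u|lborel. g a0 a1 T u \<omega>) = (LINT u|lborel. LINT \<omega>|M. g a0 a1 T u \<omega>)"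
      by (rule P.Fubini_integral[OF gint[OF T0]])
    also have "\<dots> = a1 * (LINT u:{0..T}|lborel. f u)"
      by (simp add: g_inner set_lebesgue_integral_def mult.left_commute)
    \<comment> \<open>The martingale property makes this term independent of T for T \<ge> s, so it
      joins the constant of the integral equation.\<close>
    also have "(LINT \<omega>|M. I T \<omega> * Z \<omega>) = (LINT \<omega>|M. I s \<omega> * Z \<omega>)"
      by (rule ito_martingale[OF st(1) T ito[OF T0] ito[OF st(1)] ZF Z2])
    finally show ?thesis by simp
  qed
  have cov: "(LINT \<omega>|M. (X u \<omega> - \<mu>) * Z \<omega>) = f u" if u: "u \<ge> 0" for u
  proof -
    have "(LINT \<omega>|M. (X u \<omega> - \<mu>) * Z \<omega>) = (LINT \<omega>|M. X u \<omega> * Z \<omega> - \<mu> * Z \<omega>)"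
      by (simp add: algebra_simps)
    also have "\<dots> = f u" using XZ[OF u] Z1 Z0 u by (simp add: f_def)
    finally show ?thesis .
  qed
  have "f t = f s * exp (a1 * (t - s))"
    using exponential_of_integral_equation[OF st f_int f_eq] st by simp
  moreover have "f s = (LINT \<omega>|M. (X s \<omega> - \<mu>)\<^sup>2)"
    using cov[OF st(1)] by (simp add: Z_def power2_eq_square)
  ultimately show ?thesis using cov[of t] st by (simp add: Z_def)
qed

end

section \<open>Pearson diffusions\<close>

text \<open>The eigenvalue equation is available only where D > 0; two such points are enough to
  compare the slopes of two affine functions.\<close>

lemma pearson_D_two_positive:
  assumes "hermite_case d0 d1 d2 m \<or> laguerre_case d0 d1 d2 m \<or> jacobi_case d0 d1 d2 m"
  obtains y z where "y \<noteq> z" "pearson_D d0 d1 d2 y > 0" "pearson_D d0 d1 d2 z > 0"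
proof -
  consider "hermite_case d0 d1 d2 m" | "laguerre_case d0 d1 d2 m" | "jacobi_case d0 d1 d2 m" using assms by blast
  then show thesis
  proof cases
    case 1
    then show ?thesis by (intro that[of 0 1]) (auto simp: hermite_case_def pearson_D_def)
  next
    case 2
    then show ?thesis
      \<comment> \<open>At these two points D, which is affine, equals 1 and 2.\<close>
      by (intro that[of "(1 - d0) / d1" "(2 - d0) / d1"]) (auto simp: laguerre_case_def pearson_D_def)
  next
    case 3
    then obtain r1 r2 where r: "r1 < r2" "pearson_D d0 d1 d2 r1 = 0" "pearson_D d0 d1 d2 r2 = 0" and d2: "d2 < 0"
      unfolding jacobi_case_def by blast
    \<comment> \<open>Subtracting the two root equations gives the sum of the roots, and hence the
      factorization of D. The interval between the roots is where D > 0, and its points of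
      trisection serve as witnesses.\<close>
    have "(d1 + d2 * (r1 + r2)) * (r1 - r2) = 0"
      using r(2,3) by (simp add: pearson_D_def power2_eq_square algebra_simps)
    then have d1: "d1 = - d2 * (r1 + r2)" using r(1) by simp
    have d0: "d0 = d2 * r1 * r2" using r(2) by (simp add: pearson_D_def power2_eq_square d1 algebra_simps)
    have D: "pearson_D d0 d1 d2 y = (- d2) * ((y - r1) * (r2 - y))" for y
      by (simp add: pearson_D_def d0 d1 power2_eq_square algebra_simps)
    have pos: "pearson_D d0 d1 d2 y > 0" if "r1 < y" "y < r2" for y
      unfolding D using that d2 by (intro mult_pos_pos) auto
    show ?thesis
      by (rule that[of "(2 * r1 + r2) / 3" "(r1 + 2 * r2) / 3"]) (use r(1) in \<open>auto intro!: pos\<close>)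
  qed
qed

lemma degree_1_poly:
  assumes "degree p = 1"
  obtains q r where "q \<noteq> 0" "\<And>y. poly p y = r + q * (y :: real)"
proof -
  have p: "p = [:coeff p 0, coeff p 1:]"
    using assms by (intro poly_eqI) (auto simp: coeff_pCons coeff_eq_0 split: nat.splits)
  have "coeff p 1 \<noteq> 0" using assms leading_coeff_0_iff[of p] by auto
  moreover have "poly p y = coeff p 0 + coeff p 1 * y" for y by (subst p) simp
  ultimately show thesis by (rule that)
qed

text \<open>The second derivative of the affine \<open>Q 1\<close> vanishes, which removes \<sigma>;
  taking the equation at two points of positivity eliminates the constant terms.\<close>

lemma drift_eigenvalue:
  assumes cases: "hermite_case d0 d1 d2 m \<or> laguerre_case d0 d1 d2 m \<or> jacobi_case d0 d1 d2 m"
    and eig: "pearson_eigensystem (pearson_drift a0 a1) (pearson_D d0 d1 d2) \<sigma> m Q lam"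
  shows "a1 = - lam 1"
proof -
  have "degree (Q 1) = 1" using eig by (simp add: pearson_eigensystem_def)
  then obtain q r where q: "q \<noteq> 0" and Q: "\<And>y. poly (Q 1) y = r + q * y" by (rule degree_1_poly) (rule that)
  have d: "deriv (poly (Q 1)) = (\<lambda>_. q)"
    unfolding Q[abs_def] by (rule ext, rule DERIV_imp_deriv) (auto intro!: derivative_eq_intros)
  have e: "(a0 + a1 * y) * q = - lam 1 * (r + q * y)" if "pearson_D d0 d1 d2 y > 0" for y
  proof -
    have "generator (pearson_drift a0 a1) \<sigma> (poly (Q 1)) y = - lam 1 * poly (Q 1) y"
      using eig that unfolding pearson_eigensystem_def by blast
    then show ?thesis unfolding generator_def d Q by (simp add: pearson_drift_def)
  qed
  obtain y z where yz: "y \<noteq> z" "pearson_D d0 d1 d2 y > 0" "pearson_D d0 d1 d2 z > 0"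
    using pearson_D_two_positive[OF cases] .
  have "(a1 + lam 1) * (q * (y - z)) = 0"
    using e[OF yz(2)] e[OF yz(3)] by (simp add: algebra_simps)
  then show ?thesis using q yz(1) by auto
qed

text \<open>The moments are read off the eigenpolynomials: with \<open>Q 1\<close> = r + q y,
  orthogonality to the constant \<open>Q 0\<close> gives the mean - r / q, and the norm 1 gives the
  variance 1 / q^2. Square integrability is part of being a basis element.\<close>

lemma steady_state_moments:
  assumes M: "prob_space M" and st: "steady_state M X m"
    and eig: "pearson_eigensystem \<mu>' D \<sigma> m Q lam"
  obtains V \<mu> where "V > 0" "\<And>t. t \<ge> 0 \<Longrightarrow> X t \<in> borel_measurable M"
    "\<And>t. t \<ge> 0 \<Longrightarrow> integrable M (\<lambda>\<omega>. (X t \<omega> - \<mu>)\<^sup>2)" "\<And>t. t \<ge> 0 \<Longrightarrow> integrable M (X t)"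
    "\<And>t. t \<ge> 0 \<Longrightarrow> (LINT \<omega>|M. X t \<omega>) = \<mu>" "\<And>t. t \<ge> 0 \<Longrightarrow> (LINT \<omega>|M. (X t \<omega> - \<mu>)\<^sup>2) = V"
proof -
  interpret prob_space M by fact
  define N where "N = density lborel (\<lambda>y. ennreal (m y))"
  have on: "orthonormal_L2_basis N (\<lambda>n. poly (Q n))" and deg: "degree (Q n) = n" for n
    using eig by (auto simp: pearson_eigensystem_def N_def)
  obtain q r where q: "q \<noteq> 0" and Q1: "\<And>y. poly (Q 1) y = r + q * y"
    by (rule degree_1_poly[OF deg[of 1]]) (rule that)
  obtain q0 where "Q 0 = [:q0:]" using deg[of 0] by (rule degree_eq_zeroE)
  then have Q0: "poly (Q 0) y = q0" for y by simp
  have prod: "(LINT x|N. poly (Q i) x * poly (Q j) x) = (if i = j then 1 else 0)" for i j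
    using on by (simp add: orthonormal_L2_basis_def)
  have sqN: "integrable N (\<lambda>x. (poly (Q 1) x)\<^sup>2)" using on by (simp add: orthonormal_L2_basis_def)
  \<comment> \<open>A zero constant could not have norm 1.\<close>
  have "q0 \<noteq> 0" using prod[of 0 0] by (auto simp: Q0)
  then have m1: "(LINT x|N. r + q * x) = 0" using prod[of 0 1] unfolding Q0 Q1 by simp
  have m2: "(LINT x|N. (r + q * x)\<^sup>2) = 1" using prod[of 1 1] unfolding Q1 by (simp add: power2_eq_square)
  have Xm: "X t \<in> borel_measurable M" and NX: "N = distr M lborel (X t)" if "t \<ge> 0" for t
    using st that by (auto simp: steady_state_def distributed_def N_def)
  define \<mu> where "\<mu> = - r / q"
  have X\<mu>: "X t \<omega> - \<mu> = (r + q * X t \<omega>) / q" for t \<omega> using q by (simp add: \<mu>_def field_simps)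
  have sq: "integrable M (\<lambda>\<omega>. (r + q * X t \<omega>)\<^sup>2)" if "t \<ge> 0" for t
    using sqN Xm[OF that] unfolding NX[OF that] Q1 by (subst (asm) integrable_distr_eq) auto
  have lin: "(LINT \<omega>|M. r + q * X t \<omega>) = 0" if "t \<ge> 0" for t
    using m1 Xm[OF that] unfolding NX[OF that] by (subst (asm) integral_distr) auto
  have var: "(LINT \<omega>|M. (r + q * X t \<omega>)\<^sup>2) = 1" if "t \<ge> 0" for t
    using m2 Xm[OF that] unfolding NX[OF that] by (subst (asm) integral_distr) auto
  have sq\<mu>: "integrable M (\<lambda>\<omega>. (X t \<omega> - \<mu>)\<^sup>2)" if "t \<ge> 0" for t
    unfolding X\<mu> power_divide using sq[OF that] by simp
  have "integrable M (\<lambda>\<omega>. X t \<omega> - \<mu>)" if "t \<ge> 0" for t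
    by (rule square_integrable_imp_integrable[OF _ sq\<mu>[OF that]]) (use Xm[OF that] in measurable)
  then have X1: "integrable M (X t)" if "t \<ge> 0" for t
    using Bochner_Integration.integrable_add[of M "\<lambda>\<omega>. X t \<omega> - \<mu>" "\<lambda>_. \<mu>"] that by simp
  show thesis
  proof (rule that)
    show "1 / q\<^sup>2 > 0" using q by simp
    fix t :: real assume t: "t \<ge> 0"
    show "X t \<in> borel_measurable M" "integrable M (\<lambda>\<omega>. (X t \<omega> - \<mu>)\<^sup>2)" "integrable M (X t)"
      using Xm sq\<mu> X1 t by auto
    have "(LINT \<omega>|M. X t \<omega> - \<mu>) = 0" unfolding X\<mu> using lin[OF t] by simp
    then show "(LINT \<omega>|M. X t \<omega>) = \<mu>" using X1[OF t] prob_space by simp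
    show "(LINT \<omega>|M. (X t \<omega> - \<mu>)\<^sup>2) = 1 / q\<^sup>2" unfolding X\<mu> power_divide using var[OF t] by simp
  qed
qed

theorem theorem3p7:
  fixes M :: "'a measure" and F :: "real \<Rightarrow> 'a measure"
    and W X\<^sub>1 D :: "real \<Rightarrow> 'a \<Rightarrow> real"
    and a0 a1 d0 d1 d2 \<theta> :: real and \<sigma> m :: "real \<Rightarrow> real"
    and Q :: "nat \<Rightarrow> real poly" and lam c \<beta> :: "nat \<Rightarrow> real" and n :: nat
  defines "\<psi> \<equiv> laplace_exponent_sum n c \<beta>"
    and "E \<equiv> inverse_subordinator D"
  assumes "prob_space M"
    and "pearson_diffusion M F W a0 a1 d0 d1 d2 \<sigma> X\<^sub>1"
    and "steady_state M X\<^sub>1 m"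
    and "hermite_case d0 d1 d2 m \<or> laguerre_case d0 d1 d2 m \<or> jacobi_case d0 d1 d2 m"
    and "pearson_eigensystem (pearson_drift a0 a1) (pearson_D d0 d1 d2) \<sigma> m Q lam"
    and "\<theta> = lam 1"
    and "n \<ge> 1"
    and "\<forall>i\<in>{1..n}. c i > 0"
    and "\<forall>i\<in>{1..n}. 0 < \<beta> i \<and> \<beta> i < 1"
    and "strict_mono_on {1..n} \<beta>"
    and "subordinator M D"
    and "has_laplace_exponent M D \<psi>"
    and "indep_processes M X\<^sub>1 E"
  shows "(\<forall>t\<ge>0. \<forall>s\<ge>0. corr M (X\<^sub>1 t) (X\<^sub>1 s) = exp (- \<theta> * \<bar>t - s\<bar>)) \<and>
    (\<exists>h \<Phi>.
       (\<forall>s>0. has_laplace_transform h s (1 / \<psi> s)) \<and>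
       (\<forall>s>0. has_laplace_transform \<Phi> s (\<psi> s / (s * (\<theta> + \<psi> s)))) \<and>
       (\<forall>t\<ge>0. \<Phi> t = (LINT \<omega>|M. exp (- \<theta> * E t \<omega>))) \<and>
       (\<forall>s t. 0 \<le> s \<and> s \<le> t \<longrightarrow>
          corr M (time_change X\<^sub>1 E t) (time_change X\<^sub>1 E s) =
            \<theta> * (LINT y:{0..s}|lborel. h y * \<Phi> (t - y)) + \<Phi> t))"
proof -
  interpret prob_space M by fact
  interpret brownian M F W
    using assms(4) by unfold_locales (auto simp: pearson_diffusion_def)
  have a1: "a1 = - \<theta>" using drift_eigenvalue[OF assms(6,7)] assms(8) by simp
  have \<theta>: "\<theta> > 0"
    using assms(7,8) strict_monoD[of lam 0 1] by (auto simp: pearson_eigensystem_def)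
  obtain V \<mu> where V: "V > 0" and Xm: "\<And>t. t \<ge> 0 \<Longrightarrow> X\<^sub>1 t \<in> borel_measurable M"
    and sq: "\<And>t. t \<ge> 0 \<Longrightarrow> integrable M (\<lambda>\<omega>. (X\<^sub>1 t \<omega> - \<mu>)\<^sup>2)"
    and X1: "\<And>t. t \<ge> 0 \<Longrightarrow> integrable M (X\<^sub>1 t)"
    and mean: "\<And>t. t \<ge> 0 \<Longrightarrow> (LINT \<omega>|M. X\<^sub>1 t \<omega>) = \<mu>"
    and var: "\<And>t. t \<ge> 0 \<Longrightarrow> (LINT \<omega>|M. (X\<^sub>1 t \<omega> - \<mu>)\<^sup>2) = V"
    by (rule steady_state_moments[OF assms(3,5,7)]) (rule that)
  have mean0: "(LINT \<omega>|M. X\<^sub>1 t \<omega> - \<mu>) = 0" if "t \<ge> 0" for t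
    using X1[OF that] mean[OF that] prob_space by simp
  have sq_eq: "(X\<^sub>1 t \<omega>)\<^sup>2 = (X\<^sub>1 t \<omega> - \<mu>)\<^sup>2 + 2 * \<mu> * (X\<^sub>1 t \<omega> - \<mu>) + \<mu>\<^sup>2" for t \<omega>
    by (simp add: power2_eq_square algebra_simps)
  have X2: "integrable M (\<lambda>\<omega>. (X\<^sub>1 t \<omega>)\<^sup>2)" and X2V: "(LINT \<omega>|M. (X\<^sub>1 t \<omega>)\<^sup>2) = V + \<mu>\<^sup>2" if "t \<ge> 0" for t
  proof -
    have "integrable M (\<lambda>\<omega>. X\<^sub>1 t \<omega> - \<mu>)" using X1[OF that] by simp
    then show "integrable M (\<lambda>\<omega>. (X\<^sub>1 t \<omega>)\<^sup>2)" "(LINT \<omega>|M. (X\<^sub>1 t \<omega>)\<^sup>2) = V + \<mu>\<^sup>2"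
      unfolding sq_eq using sq[OF that] mean0[OF that] var[OF that] prob_space
      by (simp_all del: Bochner_Integration.integral_diff)
  qed
  have sde: "sde_solution M F W (\<lambda>x. a0 + a1 * x) \<sigma> X\<^sub>1"
    using assms(4) by (simp add: pearson_diffusion_def pearson_drift_def[abs_def])
  have cov_le: "(LINT \<omega>|M. (X\<^sub>1 t \<omega> - \<mu>) * (X\<^sub>1 s \<omega> - \<mu>)) = V * exp (- \<theta> * \<bar>t - s\<bar>)" if "0 \<le> s" "s \<le> t" for s t
    using linear_drift_covariance[OF sde X2 X2V mean that] that by (simp add: var a1)
  have cov: "(LINT \<omega>|M. (X\<^sub>1 t \<omega> - \<mu>) * (X\<^sub>1 s \<omega> - \<mu>)) = V * exp (- \<theta> * \<bar>t - s\<bar>)" if "0 \<le> t" "0 \<le> s" for s t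
  proof (cases "s \<le> t")
    case True
    then show ?thesis using cov_le[of s t] that by simp
  next
    case False
    then show ?thesis using cov_le[of t s] that by (simp add: mult.commute abs_minus_commute)
  qed
  have corr: "corr M (X\<^sub>1 t) (X\<^sub>1 s) = exp (- \<theta> * \<bar>t - s\<bar>)" if "0 \<le> t" "0 \<le> s" for t s
    using V that by (simp add: corr_def mean cov var)
  have cont: "continuous_on {0..} (\<lambda>t. X\<^sub>1 t \<omega>)" if "\<omega> \<in> space M" for \<omega>
    using sde that by (simp add: sde_solution_def)

  have \<psi>_pos: "\<psi> s > 0" if "s > 0" for s
    unfolding \<psi>_def using assms(9,10) that by (intro laplace_exponent_sum_pos) auto
  obtain D' where reg: "regular_subordinator M D' \<psi>"
    and ae: "AE \<omega> in M. \<forall>t. E t \<omega> = inverse_subordinator D' t \<omega>"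
    using regular_version[OF assms(13,14) \<psi>_pos] unfolding E_def by blast
  interpret D': regular_subordinator M D' \<psi> by (rule reg)
  define \<Phi> where "\<Phi> t = (LINT \<omega>|M. exp (- \<theta> * E t \<omega>))" for t
  have E_nonneg: "E t \<omega> \<ge> 0" for t \<omega> unfolding E_def by (rule inverse_subordinator_nonneg)
  \<comment> \<open>For the given D, measurability of E at nonnegative levels is extracted from the
    independence hypothesis, which treats its path as a random variable.\<close>
  have Em [measurable]: "E t \<in> borel_measurable M" if "t \<ge> 0" for t
  proof -
    have "(\<lambda>\<omega>. \<lambda>t\<in>{0..}. E t \<omega>) \<in> measurable M (PiM {0..} (\<lambda>_. borel))"
      using assms(15) unfolding indep_processes_def by (rule indep_var_rv2)
    from measurable_compose[OF this measurable_component_singleton[of t]] that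
    show ?thesis by simp
  qed
  \<comment> \<open>Nonnegative arguments are all that the transforms on (0, \<infinity>) and the
    convolution over [0, s] with s \<le> t evaluate.\<close>
  have \<Phi>_eq: "\<Phi> t = D'.\<Phi> \<theta> t" if "t \<ge> 0" for t
    unfolding \<Phi>_def D'.\<Phi>_def
  proof (rule integral_cong_AE)
    show "AE \<omega> in M. exp (- \<theta> * E t \<omega>) = exp (- \<theta> * D'.E t \<omega>)" using ae by eventually_elim simp
  qed (use Em[OF that] in measurable)
  have pot_lap: "(\<integral>\<^sup>+x. ennreal (exp (- s * x)) \<partial>D'.potential) = ennreal (1 / laplace_exponent_sum n c \<beta> s)" if "s > 0" for s
    using D'.potential_laplace[OF that] by (simp add: \<psi>_def)
  obtain h where h [measurable]: "h \<in> borel_measurable borel" and h0: "\<And>x. 0 \<le> h x" and hneg: "\<And>x. x < 0 \<Longrightarrow> h x = 0"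
    and pot: "D'.potential = density lborel (\<lambda>x. ennreal (h x))"
    using potential_density_exists[OF D'.sets_potential D'.potential_nonneg assms(9,10) _ assms(12) pot_lap] assms(11)
    by blast
  have h_lap: "has_laplace_transform h s (1 / \<psi> s)" if s: "s > 0" for s
  proof -
    have "has_bochner_integral lborel (\<lambda>t. indicator {0<..} t *\<^sub>R (exp (- s * t) * h t)) (1 / \<psi> s)"
    proof (rule has_bochner_integral_nn_integral)
      have "(\<integral>\<^sup>+t. ennreal (indicator {0<..} t *\<^sub>R (exp (- s * t) * h t)) \<partial>lborel)
        = (\<integral>\<^sup>+t. ennreal (h t) * ennreal (exp (- s * t)) \<partial>lborel)"
      proof (rule nn_integral_cong_AE)
        have "AE t in lborel. (t::real) \<noteq> 0" by (rule AE_lborel_singleton)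
        then show "AE t in lborel. ennreal (indicator {0<..} t *\<^sub>R (exp (- s * t) * h t)) = ennreal (h t) * ennreal (exp (- s * t))"
        proof eventually_elim
          case (elim t)
          then show ?case using hneg[of t] h0[of t]
            by (cases "t > 0") (simp_all add: ennreal_mult mult.commute)
        qed
      qed
      also have "\<dots> = (\<integral>\<^sup>+x. ennreal (exp (- s * x)) \<partial>D'.potential)"
        unfolding pot by (simp add: nn_integral_density)
      also have "\<dots> = ennreal (1 / \<psi> s)" by (rule D'.potential_laplace[OF s])
      finally show "(\<integral>\<^sup>+t. ennreal (indicator {0<..} t *\<^sub>R (exp (- s * t) * h t)) \<partial>lborel) = ennreal (1 / \<psi> s)" .
    qed (use h0 \<psi>_pos[OF s] in auto)
    then show ?thesis
      unfolding has_laplace_transform_def set_integrable_def set_lebesgue_integral_def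
      by (auto simp: has_bochner_integral_iff)
  qed
  have \<Phi>_lap: "has_laplace_transform \<Phi> s (\<psi> s / (s * (\<theta> + \<psi> s)))" if s: "s > 0" for s
  proof -
    have eq: "indicator {0<..} t *\<^sub>R (exp (- s * t) * \<Phi> t) = indicator {0<..} t *\<^sub>R (exp (- s * t) * D'.\<Phi> \<theta> t)" for t
      using \<Phi>_eq[of t] by (simp add: indicator_def)
    show ?thesis
      using D'.\<Phi>_laplace[OF \<theta> s]
      unfolding has_laplace_transform_def set_integrable_def set_lebesgue_integral_def eq .
  qed
  have main: "corr M (time_change X\<^sub>1 E t) (time_change X\<^sub>1 E s) =
      \<theta> * (LINT y:{0..s}|lborel. h y * \<Phi> (t - y)) + \<Phi> t" if s: "0 \<le> s" "s \<le> t" for s t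
  proof -
    have t: "0 \<le> t" using s by simp
    have "corr M (time_change X\<^sub>1 E t) (time_change X\<^sub>1 E s) = (LINT \<omega>|M. exp (- \<theta> * \<bar>E t \<omega> - E s \<omega>\<bar>))"
      by (rule corr_time_change[OF assms(3,15) cont E_nonneg t s(1) Em Xm V \<theta> sq mean0 cov])
    also have "\<dots> = (LINT \<omega>|M. exp (- \<theta> * (D'.E t \<omega> - D'.E s \<omega>)))"
    proof (rule integral_cong_AE)
      show "AE \<omega> in M. exp (- \<theta> * \<bar>E t \<omega> - E s \<omega>\<bar>) = exp (- \<theta> * (D'.E t \<omega> - D'.E s \<omega>))"
        using ae AE_space
      proof eventually_elim
        case (elim \<omega>)
        then show ?case using D'.E_mono[OF elim(2) s(2)] by simp
      qed
    qed (use Em[OF t] Em[OF s(1)] in measurable)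
    also have "\<dots> = \<theta> * (LINT y:{0..s}|lborel. h y * \<Phi> (t - y)) + \<Phi> t"
    proof -
      define L where "L = (LINT \<omega>|M. exp (- \<theta> * (D'.E t \<omega> - D'.E s \<omega>)))"
      define K where "K = (\<integral>\<^sup>+y. indicator {..s} y * ennreal (D'.\<Phi> \<theta> (t - y)) \<partial>D'.potential)"
      have int: "integrable M (\<lambda>\<omega>. exp (- \<theta> * (D'.E t \<omega> - D'.E s \<omega>)))"
        by (rule integrable_const_bound[where B=1]) (use \<theta> D'.E_mono[OF _ s(2)] in \<open>auto simp: AE_I2\<close>)
      have "ennreal L = (\<integral>\<^sup>+\<omega>. ennreal (exp (- \<theta> * (D'.E t \<omega> - D'.E s \<omega>))) \<partial>M)"
        unfolding L_def by (rule nn_integral_eq_integral[OF int, symmetric]) simp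
      also have "\<dots> = ennreal \<theta> * K + ennreal (D'.\<Phi> \<theta> t)"
        unfolding K_def by (rule D'.exp_increment_E[OF \<theta> s(2)])
      finally have L: "ennreal L = ennreal \<theta> * K + ennreal (D'.\<Phi> \<theta> t)" .
      \<comment> \<open>The left side is the expectation of a bounded function, hence finite, and
        \<theta> > 0; this makes h(y) \<Phi>(t - y) integrable on [0, s].\<close>
      have "K \<noteq> \<infinity>"
      proof
        assume "K = \<infinity>"
        then have "ennreal L = \<infinity>" using L \<theta> by (simp add: ennreal_mult_top)
        then show False by simp
      qed
      then obtain k where k: "k \<ge> 0" "K = ennreal k" by (cases K) auto
      have "K = (\<integral>\<^sup>+y. ennreal (h y) * (indicator {..s} y * ennreal (D'.\<Phi> \<theta> (t - y))) \<partial>lborel)"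
        unfolding K_def pot by (rule nn_integral_density) auto
      also have "\<dots> = (\<integral>\<^sup>+y. ennreal (indicator {0..s} y *\<^sub>R (h y * D'.\<Phi> \<theta> (t - y))) \<partial>lborel)"
      proof (rule nn_integral_cong)
        fix y :: real
        show "ennreal (h y) * (indicator {..s} y * ennreal (D'.\<Phi> \<theta> (t - y))) = ennreal (indicator {0..s} y *\<^sub>R (h y * D'.\<Phi> \<theta> (t - y)))"
          using hneg[of y] h0[of y]
          by (cases "y < 0"; cases "y \<le> s") (simp_all add: ennreal_mult D'.\<Phi>_bounds[OF \<theta>])
      qed
      finally have Kh: "(\<integral>\<^sup>+y. ennreal (indicator {0..s} y *\<^sub>R (h y * D'.\<Phi> \<theta> (t - y))) \<partial>lborel) = ennreal k"
        using k by simp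
      have "has_bochner_integral lborel (\<lambda>y. indicator {0..s} y *\<^sub>R (h y * D'.\<Phi> \<theta> (t - y))) k"
        by (rule has_bochner_integral_nn_integral[OF _ _ k(1) Kh]) (simp_all add: h0 D'.\<Phi>_bounds[OF \<theta>])
      moreover have eq: "indicator {0..s} y *\<^sub>R (h y * D'.\<Phi> \<theta> (t - y)) = indicator {0..s} y *\<^sub>R (h y * \<Phi> (t - y))" for y
        using \<Phi>_eq[of "t - y"] s by (simp add: indicator_def)
      ultimately have "(LINT y:{0..s}|lborel. h y * \<Phi> (t - y)) = k"
        unfolding set_lebesgue_integral_def has_bochner_integral_iff eq by blast
      moreover have "ennreal L = ennreal (\<theta> * k + \<Phi> t)"
        using L k \<theta> \<Phi>_eq[OF t] D'.\<Phi>_bounds(1)[OF \<theta>, of t] by (simp add: ennreal_mult ennreal_plus)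
      moreover have "L \<ge> 0" unfolding L_def by simp
      moreover have "\<theta> * k + \<Phi> t \<ge> 0" using k \<theta> \<Phi>_eq[OF t] D'.\<Phi>_bounds(1)[OF \<theta>, of t] by simp
      ultimately show ?thesis unfolding L_def[symmetric] by simp
    qed
    finally show ?thesis .
  qed
  show ?thesis
    using corr h_lap \<Phi>_lap main by (intro conjI exI[of _ h] exI[of _ \<Phi>]) (auto simp: \<Phi>_def)
qed

end
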